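(* There is an algorithm that, on input a domain $D\subseteq\{0,1\}^n$ (given as the list of its elements), halts in time $O(|D|^2n^2)$ and either returns that $D$ is not a local possibility domain, or outputs a local possibility integrity constraint $\phi$ containing $O(|D|n)$ clauses whose set of satisfying truth assignments is $D$.
   Context: Standing assumption: domains are non-degenerate (projection onto each coordinate is $\{0,1\}$). A $k$-ary aggregator for $D$ ($k\ge2$) is an $n$-tuple $(f_1,\ldots,f_n)$ of unanimous functions $f_j:\{0,1\}^k\to\{0,1\}$ such that whenever $x^1,\ldots,x^k\in D$, $(f_1(x^1_1,\ldots,x^k_1),\ldots,f_n(x^1_n,\ldots,x^k_n))\in D$; it is locally non-dictatorial if no $f_j$ is a projection. $D$ is a local possibility domain if it admits a locally non-dictatorial aggregator. Renaming a set $W$ of variables: swap $x\leftrightarrow\neg x$ for $x\in W$. A formula over $V$ is partially Horn with admissible set $V_0$ if every clause containing only variables from $V_0$ has at most one positive literal and variables of $V_0$ appear only negatively in clauses also containing variables outside $V_0$. For disjoint variable sets $V,V'$, a $(V,V')$-generalized clause is $(l_1\vee\cdots\vee l_s\vee(l_{s+1}\oplus\cdots\oplus l_t))$, $s<t$, with $l_1,\ldots,l_s$ literals over $V$ and $l_{s+1},\ldots,l_t$ literals over $V'$, falsified exactly by assignments falsifying all $l_i$, $i\le s$, and satisfying an even number of $l_{s+1},\ldots,l_t$. A formula $\phi$ over $V$ is a local possibility integrity constraint if there are pairwise disjoint $V_0,V_1,V_2$ with union $V$, no clause containing variables from both $V_1$ and $V_2$, such that (1) renaming some variables of $V_0$ yields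 a partially Horn formula with admissible set $V_0$; (2) every clause contains at most two variables from $V_1$; (3) clauses containing variables from $V_2$ are $(V_0,V_2)$-generalized clauses. *)

theory Defs
  imports Main
begin

section \<open>Domains and aggregators\<close>

text \<open>Vectors in \<open>{0,1}\<^sup>n\<close> are Boolean lists of length \<open>n\<close>; coordinates are numbered from 0.\<close>

definition nondegenerate_domain :: "nat \<Rightarrow> bool list set \<Rightarrow> bool" where
  "nondegenerate_domain n D \<longleftrightarrow>
     D \<subseteq> {x. length x = n} \<and> (\<forall>j<n. (\<lambda>x. x ! j) ` D = {False, True})"

definition unanimous :: "nat \<Rightarrow> (bool list \<Rightarrow> bool) \<Rightarrow> bool" where
  "unanimous k g \<longleftrightarrow> (\<forall>b. g (replicate k b) = b)"

definition is_projection :: "nat \<Rightarrow> (bool list \<Rightarrow> bool) \<Rightarrow> bool" where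
  "is_projection k g \<longleftrightarrow> (\<exists>i<k. \<forall>v. length v = k \<longrightarrow> g v = v ! i)"

text \<open>\<open>f j\<close> is only ever applied to lists of length \<open>k\<close>, so it stands for a function
  \<open>{0,1}\<^sup>k \<rightarrow> {0,1}\<close>.\<close>

definition aggregator :: "nat \<Rightarrow> nat \<Rightarrow> bool list set \<Rightarrow> (nat \<Rightarrow> bool list \<Rightarrow> bool) \<Rightarrow> bool" where
  "aggregator n k D f \<longleftrightarrow>
     k \<ge> 2 \<and> (\<forall>j<n. unanimous k (f j)) \<and>
     (\<forall>xs. length xs = k \<and> set xs \<subseteq> D \<longrightarrow>
        map (\<lambda>j. f j (map (\<lambda>x. x ! j) xs)) [0..<n] \<in> D)"

definition local_possibility_domain :: "nat \<Rightarrow> bool list set \<Rightarrow> bool" where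
  "local_possibility_domain n D \<longleftrightarrow>
     (\<exists>k f. aggregator n k D f \<and> (\<forall>j<n. \<not> is_projection k (f j)))"


section \<open>Formulas and local possibility integrity constraints\<close>

datatype literal = is_Pos: Pos (var: nat) | is_Neg: Neg (var: nat)

text \<open>\<open>Disj ls\<close> is the ordinary clause over \<open>ls\<close>, and \<open>DisjXor ls xs\<close> is the clause
  \<open>l\<^sub>1 \<or> \<dots> \<or> l\<^sub>s \<or> (l\<^sub>s\<^sub>+\<^sub>1 \<oplus> \<dots> \<oplus> l\<^sub>t)\<close> with \<open>ls = [l\<^sub>1, \<dots>, l\<^sub>s]\<close> and \<open>xs = [l\<^sub>s\<^sub>+\<^sub>1, \<dots>, l\<^sub>t]\<close>.\<close>

datatype clause = Disj "literal list" | DisjXor "literal list" "literal list"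

type_synonym formula = "clause list"

fun lit_true :: "bool list \<Rightarrow> literal \<Rightarrow> bool" where
  "lit_true x (Pos v) = x ! v"
| "lit_true x (Neg v) = (\<not> x ! v)"

fun clause_true :: "bool list \<Rightarrow> clause \<Rightarrow> bool" where
  "clause_true x (Disj ls) = (\<exists>l\<in>set ls. lit_true x l)"
| "clause_true x (DisjXor ls xs) =
     ((\<exists>l\<in>set ls. lit_true x l) \<or> odd (length (filter (lit_true x) xs)))"

definition satisfying :: "nat \<Rightarrow> formula \<Rightarrow> bool list set" where
  "satisfying n \<phi> = {x. length x = n \<and> (\<forall>c\<in>set \<phi>. clause_true x c)}"

fun clause_lits :: "clause \<Rightarrow> literal list" where
  "clause_lits (Disj ls) = ls"
| "clause_lits (DisjXor ls xs) = ls @ xs"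

definition clause_vars :: "clause \<Rightarrow> nat set" where
  "clause_vars c = var ` set (clause_lits c)"

fun rename_lit :: "nat set \<Rightarrow> literal \<Rightarrow> literal" where
  "rename_lit W (Pos v) = (if v \<in> W then Neg v else Pos v)"
| "rename_lit W (Neg v) = (if v \<in> W then Pos v else Neg v)"

fun rename_clause :: "nat set \<Rightarrow> clause \<Rightarrow> clause" where
  "rename_clause W (Disj ls) = Disj (map (rename_lit W) ls)"
| "rename_clause W (DisjXor ls xs) = DisjXor (map (rename_lit W) ls) (map (rename_lit W) xs)"

definition rename :: "nat set \<Rightarrow> formula \<Rightarrow> formula" where
  "rename W \<phi> = map (rename_clause W) \<phi>"

definition partially_horn :: "nat set \<Rightarrow> formula \<Rightarrow> bool" where
  "partially_horn V0 \<phi> \<longleftrightarrow>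
     (\<forall>c\<in>set \<phi>.
        (clause_vars c \<subseteq> V0 \<longrightarrow> length (filter is_Pos (clause_lits c)) \<le> 1) \<and>
        (\<not> clause_vars c \<subseteq> V0 \<longrightarrow> (\<forall>l\<in>set (clause_lits c). var l \<in> V0 \<longrightarrow> is_Neg l)))"

text \<open>For \<open>t = s + 1\<close> a generalized clause is an ordinary disjunction with exactly one literal
  over \<open>V'\<close>; this is the first equation.\<close>

fun generalized_clause :: "nat set \<Rightarrow> nat set \<Rightarrow> clause \<Rightarrow> bool" where
  "generalized_clause V V' (Disj ls) \<longleftrightarrow>
     (\<forall>l\<in>set ls. var l \<in> V \<union> V') \<and> length (filter (\<lambda>l. var l \<in> V') ls) = 1"
| "generalized_clause V V' (DisjXor ls xs) \<longleftrightarrow>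
     xs \<noteq> [] \<and> (\<forall>l\<in>set ls. var l \<in> V) \<and> (\<forall>l\<in>set xs. var l \<in> V')"

text \<open>The last conjunct makes explicit that clauses without variables from \<open>V2\<close> are ordinary
  disjunctions; otherwise \<open>DisjXor\<close> clauses over \<open>V0 \<union> V1\<close> would slip through.\<close>

definition lpic :: "nat \<Rightarrow> formula \<Rightarrow> bool" where
  "lpic n \<phi> \<longleftrightarrow>
     (\<forall>c\<in>set \<phi>. clause_vars c \<subseteq> {..<n}) \<and>
     (\<exists>V0 V1 V2.
        V0 \<inter> V1 = {} \<and> V0 \<inter> V2 = {} \<and> V1 \<inter> V2 = {} \<and> V0 \<union> V1 \<union> V2 = {..<n} \<and>
        (\<forall>c\<in>set \<phi>. clause_vars c \<inter> V1 = {} \<or> clause_vars c \<inter> V2 = {}) \<and>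
        (\<exists>W\<subseteq>V0. partially_horn V0 (rename W \<phi>)) \<and>
        (\<forall>c\<in>set \<phi>. card (clause_vars c \<inter> V1) \<le> 2) \<and>
        (\<forall>c\<in>set \<phi>. clause_vars c \<inter> V2 \<noteq> {} \<longrightarrow> generalized_clause V0 V2 c) \<and>
        (\<forall>c\<in>set \<phi>. clause_vars c \<inter> V2 = {} \<longrightarrow> (\<exists>ls. c = Disj ls)))"


section \<open>Algorithms: unit-cost random access programs\<close>

text \<open>Algorithms are structured programs for a random access machine. The memory consists of
  named arrays of natural numbers; a scalar variable is cell 0 of its array. A program mentions
  only finitely many array names, so interleaving the arrays turns it into a program for a
  machine with one linear memory at the cost of a constant factor. The arithmetic operations are
  addition and truncated subtraction, each of unit cost. Multiplication is left out because at
  unit cost it would make the machine unreasonably powerful.\<close>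

datatype aexp = Num nat | Cell string aexp | Add aexp aexp | Sub aexp aexp

datatype bexp = BLess aexp aexp | BEq aexp aexp | BNot bexp | BAnd bexp bexp

datatype com =
    Skip
  | Assign string aexp aexp  \<comment> \<open>\<open>Assign a i e\<close> is \<open>a[i] := e\<close>\<close>
  | Seq com com
  | Cond bexp com com
  | While bexp com

type_synonym store = "string \<Rightarrow> nat \<Rightarrow> nat"

fun aval :: "aexp \<Rightarrow> store \<Rightarrow> nat" where
  "aval (Num k) s = k"
| "aval (Cell a e) s = s a (aval e s)"
| "aval (Add e1 e2) s = aval e1 s + aval e2 s"
| "aval (Sub e1 e2) s = aval e1 s - aval e2 s"

fun bval :: "bexp \<Rightarrow> store \<Rightarrow> bool" where
  "bval (BLess e1 e2) s = (aval e1 s < aval e2 s)"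
| "bval (BEq e1 e2) s = (aval e1 s = aval e2 s)"
| "bval (BNot b) s = (\<not> bval b s)"
| "bval (BAnd b1 b2) s = (bval b1 s \<and> bval b2 s)"

fun acost :: "aexp \<Rightarrow> nat" where
  "acost (Num k) = 1"
| "acost (Cell a e) = acost e + 1"
| "acost (Add e1 e2) = acost e1 + acost e2 + 1"
| "acost (Sub e1 e2) = acost e1 + acost e2 + 1"

fun bcost :: "bexp \<Rightarrow> nat" where
  "bcost (BLess e1 e2) = acost e1 + acost e2 + 1"
| "bcost (BEq e1 e2) = acost e1 + acost e2 + 1"
| "bcost (BNot b) = bcost b + 1"
| "bcost (BAnd b1 b2) = bcost b1 + bcost b2 + 1"

text \<open>\<open>exec c s t s'\<close>: started in \<open>s\<close>, program \<open>c\<close> halts in \<open>s'\<close> after exactly \<open>t\<close> steps.\<close>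

inductive exec :: "com \<Rightarrow> store \<Rightarrow> nat \<Rightarrow> store \<Rightarrow> bool" where
  Skip: "exec Skip s 1 s"
| Assign: "exec (Assign a i e) s (acost i + acost e + 1)
             (s(a := (s a)(aval i s := aval e s)))"
| Seq: "\<lbrakk>exec c1 s t1 s1; exec c2 s1 t2 s2\<rbrakk> \<Longrightarrow> exec (Seq c1 c2) s (t1 + t2) s2"
| CondTrue: "\<lbrakk>bval b s; exec c1 s t s'\<rbrakk> \<Longrightarrow> exec (Cond b c1 c2) s (bcost b + t + 1) s'"
| CondFalse: "\<lbrakk>\<not> bval b s; exec c2 s t s'\<rbrakk> \<Longrightarrow> exec (Cond b c1 c2) s (bcost b + t + 1) s'"
| WhileFalse: "\<not> bval b s \<Longrightarrow> exec (While b c) s (bcost b + 1) s"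
| WhileTrue: "\<lbrakk>bval b s; exec c s t1 s1; exec (While b c) s1 t2 s2\<rbrakk>
             \<Longrightarrow> exec (While b c) s (bcost b + t1 + t2 + 1) s2"

inductive_cases exec_SkipE: "exec Skip s t s'"
inductive_cases exec_AssignE: "exec (Assign a i e) s t s'"
inductive_cases exec_SeqE: "exec (Seq c1 c2) s t s'"
inductive_cases exec_CondE: "exec (Cond b c1 c2) s t s'"
inductive_cases exec_WhileE: "exec (While b c) s t s'"

text \<open>Programs are deterministic, so a program that halts has exactly one running time and one
  final store.\<close>

lemma exec_deterministic:
  assumes "exec c s t s'" and "exec c s u s''"
  shows "t = u \<and> s' = s''"
  using assms
proof (induction arbitrary: u s'' rule: exec.induct)
  case (Skip s)
  then show ?case by (auto elim: exec_SkipE)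
next
  case (Assign a i e s)
  then show ?case by (auto elim: exec_AssignE)
next
  case (Seq c1 s t1 s1 c2 t2 s2)
  from Seq.prems obtain u1 s1' u2 where
    1: "exec c1 s u1 s1'" and 2: "exec c2 s1' u2 s''" and u: "u = u1 + u2"
    by (rule exec_SeqE)
  from Seq.IH(1)[OF 1] have eq: "t1 = u1" "s1 = s1'" by blast+
  have "t2 = u2 \<and> s2 = s''" by (rule Seq.IH(2)) (use 2 eq in simp)
  with eq u show ?case by simp
next
  case (CondTrue b s c1 t s' c2)
  from CondTrue.prems CondTrue.hyps(1) obtain u1 where
    1: "exec c1 s u1 s''" and u: "u = bcost b + u1 + 1"
    by (elim exec_CondE) auto
  from CondTrue.IH[OF 1] u show ?case by simp
next
  case (CondFalse b s c2 t s' c1)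
  from CondFalse.prems CondFalse.hyps(1) obtain u1 where
    1: "exec c2 s u1 s''" and u: "u = bcost b + u1 + 1"
    by (elim exec_CondE) auto
  from CondFalse.IH[OF 1] u show ?case by simp
next
  case (WhileFalse b s c)
  from WhileFalse.prems show ?case
    by (rule exec_WhileE) (use WhileFalse.hyps(1) in simp_all)
next
  case (WhileTrue b s c t1 s1 t2 s2)
  from WhileTrue.prems obtain u1 s1' u2 where
    1: "exec c s u1 s1'" and 2: "exec (While b c) s1' u2 s''" and
    u: "u = bcost b + u1 + u2 + 1"
    by (rule exec_WhileE) (use WhileTrue.hyps(1) in simp_all)
  from WhileTrue.IH(1)[OF 1] have eq: "t1 = u1" "s1 = s1'" by blast+
  have "t2 = u2 \<and> s2 = s''" by (rule WhileTrue.IH(2)) (use 2 eq in simp)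
  with eq u show ?case by simp
qed


section \<open>Input and output conventions\<close>

text \<open>The input store holds \<open>n\<close>, the number of listed vectors, and the vectors themselves, one
  after the other, with one bit per cell. All other cells are 0.\<close>

definition input_store :: "nat \<Rightarrow> bool list list \<Rightarrow> store" where
  "input_store n xs = (\<lambda>a i.
     if a = ''n'' \<and> i = 0 then n
     else if a = ''m'' \<and> i = 0 then length xs
     else if a = ''D'' \<and> i < length (concat xs) then of_bool (concat xs ! i)
     else 0)"

fun encode_lit :: "literal \<Rightarrow> nat" where
  "encode_lit (Pos v) = 2 * v"
| "encode_lit (Neg v) = 2 * v + 1"

text \<open>All lists are preceded by their lengths, so the encoding determines the formula.\<close>

definition encode_lits :: "literal list \<Rightarrow> nat list" where
  "encode_lits ls = length ls # map encode_lit ls"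

fun encode_clause :: "clause \<Rightarrow> nat list" where
  "encode_clause (Disj ls) = 0 # encode_lits ls"
| "encode_clause (DisjXor ls xs) = 1 # encode_lits ls @ encode_lits xs"

definition encode_formula :: "formula \<Rightarrow> nat list" where
  "encode_formula \<phi> = length \<phi> # concat (map encode_clause \<phi>)"

definition returns_none :: "store \<Rightarrow> bool" where
  "returns_none s \<longleftrightarrow> s ''answer'' 0 = 0"

definition outputs_formula :: "store \<Rightarrow> formula \<Rightarrow> bool" where
  "outputs_formula s \<phi> \<longleftrightarrow>
     s ''answer'' 0 = 1 \<and>
     (\<forall>i < length (encode_formula \<phi>). s ''out'' i = encode_formula \<phi> ! i)"

end

theory Submission
  imports Defs
begin

text \<open>
  Start from a CNF of \<open>D\<close>: for every vector of \<open>D\<close> and every position, the prefix with the last bit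
  flipped either extends to \<open>D\<close> or yields an implicate. Shrinking these at most \<open>|D| n\<close> implicates
  greedily makes them prime, and then each literal of a clause has its own witness in \<open>D\<close>, a vector
  that satisfies only this literal of the clause. So clauses have at most \<open>|D|\<close> literals.

  The partially Horn renamings of the CNF are the closed consistent sets of literals of an
  implication graph. The greatest possible \<open>V0\<close> arises from \<open>2 n\<close> searches, each linear in the size
  \<open>|D|\<^sup>2 n\<close> of the CNF. For a locally non-dictatorial aggregator of \<open>D\<close>, witnesses show that the
  components outside \<open>V0\<close> are self-dual and agree within each clause. A clause with at least three
  literals outside \<open>V0\<close> forces ternary parity among the minors of its component, and therefore in
  every clause connected to it the disjunction of the literals outside \<open>V0\<close> can be replaced by
  their exclusive or without losing a vector of \<open>D\<close>. Conversely, once this replacement is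
  harmless, the new formula is a local possibility integrity constraint for \<open>D\<close>, so it suffices to
  evaluate the new clauses on \<open>D\<close>.
\<close>

section \<open>Prime clauses and aggregators\<close>

text \<open>The statements about aggregators rest on one device. Two witnesses of a prime clause
  falsify the same literals of it, apart from the two witnessed ones. By unanimity these stay false
  in an aggregate of the two, and the aggregate lies in \<open>D\<close>, so it satisfies one of the
  two witnessed literals. Each clause thus becomes a relation between two (or three) components
  \<open>f j\<close>. A component that takes the same value on some \<open>v\<close> and on its
  complement spreads this defect along the implication graph, and the defects form a closed
  consistent set. That is why components outside the largest \<open>V0\<close> are self-dual, and
  self-duality makes the polarity of literals irrelevant.

  On the machine side the obstacle is that the implication graph may have far more edges than the
  CNF has literals. It is never built: a search follows occurrence lists and opens each clause at
  most once. Row offsets, negations and variables are tabulated, as there is neither multiplication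
  nor a parity test. The numerals in the time bounds are generous step counts.\<close>

fun neg_lit :: "literal \<Rightarrow> literal" where
  "neg_lit (Pos v) = Neg v"
| "neg_lit (Neg v) = Pos v"

lemma var_neg_lit [simp]: "var (neg_lit l) = var l"
  by (cases l) auto

lemma neg_neg_lit [simp]: "neg_lit (neg_lit l) = l"
  by (cases l) auto

lemma is_Pos_neg_lit [simp]: "is_Pos (neg_lit l) \<longleftrightarrow> \<not> is_Pos l"
  by (cases l) auto

lemma neg_lit_neq [simp]: "neg_lit l \<noteq> l" "l \<noteq> neg_lit l"
  by (cases l; simp)+

lemma neg_lit_eq_iff [simp]: "neg_lit l = neg_lit l' \<longleftrightarrow> l = l'"
  by (cases l; cases l') auto

lemma lit_true_neg_lit [simp]: "lit_true x (neg_lit l) \<longleftrightarrow> \<not> lit_true x l"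
  by (cases l) auto

lemma lit_true_iff: "lit_true x l \<longleftrightarrow> (x ! var l) = is_Pos l"
  by (cases l) auto

lemma var_eq_iff: "var l = var l' \<longleftrightarrow> l' = l \<or> l' = neg_lit l"
  by (cases l; cases l') auto

section \<open>Prime implicates and the witnesses of their literals\<close>

definition prime_clause :: "bool list set \<Rightarrow> literal list \<Rightarrow> bool" where
  "prime_clause D c \<longleftrightarrow>
     (\<forall>x\<in>D. \<exists>l\<in>set c. lit_true x l) \<and>
     (\<forall>l\<in>set c. \<exists>x\<in>D. \<forall>l'\<in>set c. lit_true x l' \<longleftrightarrow> l' = l)"

lemma prime_clauseD:
  assumes "prime_clause D c" "x \<in> D" obtains l where "l \<in> set c" "lit_true x l"
  using assms unfolding prime_clause_def by blast

lemma prime_clause_witness: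
  assumes "prime_clause D c" "l \<in> set c"
  obtains x where "x \<in> D" "lit_true x l"
    "\<And>l'. l' \<in> set c \<Longrightarrow> l' \<noteq> l \<Longrightarrow> \<not> lit_true x l'"
  using assms unfolding prime_clause_def by blast

lemma prime_clause_length:
  assumes "prime_clause D c" "distinct c" "finite D"
  shows "length c \<le> card D"
proof -
  have "\<forall>l\<in>set c. \<exists>x\<in>D. \<forall>l'\<in>set c. lit_true x l' \<longleftrightarrow> l' = l"
    using assms(1) unfolding prime_clause_def by blast
  then obtain w where w: "\<And>l. l \<in> set c \<Longrightarrow> w l \<in> D"
    "\<And>l l'. l \<in> set c \<Longrightarrow> l' \<in> set c \<Longrightarrow> lit_true (w l) l' \<longleftrightarrow> l' = l"
    by metis
  have "inj_on w (set c)"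
    by (rule inj_onI) (metis w(2))
  then have "card (set c) \<le> card D"
    using card_inj_on_le[of w "set c" D] w(1) assms(3) by blast
  then show ?thesis
    using distinct_card[OF assms(2)] by simp
qed

text \<open>A closed consistent set records, for every variable it mentions, the literal that becomes
  negative after the renaming; \<open>edge\<close> is the implication graph of the 2-CNF whose total solutions
  are the Horn renamings.\<close>

definition edge :: "literal list set \<Rightarrow> literal \<Rightarrow> literal \<Rightarrow> bool" where
  "edge \<C> a l \<longleftrightarrow> (\<exists>c\<in>\<C>. neg_lit a \<in> set c \<and> l \<in> set c \<and> l \<noteq> neg_lit a)"

definition closed_lits :: "literal list set \<Rightarrow> literal set \<Rightarrow> bool" where
  "closed_lits \<C> R \<longleftrightarrow> (\<forall>a\<in>R. \<forall>l. edge \<C> a l \<longrightarrow> l \<in> R)"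

definition consistent :: "literal set \<Rightarrow> bool" where
  "consistent R \<longleftrightarrow> (\<forall>l\<in>R. neg_lit l \<notin> R)"

text \<open>The largest possible \<open>V0\<close>: \<open>override_lits\<close> merges two such
  sets into one that covers the variables of both, so for finitely many variables a single set
  suffices.\<close>

definition horn_vars :: "literal list set \<Rightarrow> nat set" where
  "horn_vars \<C> = (\<Union>R\<in>{R. closed_lits \<C> R \<and> consistent R}. var ` R)"

section \<open>Merging closed consistent sets of literals\<close>

lemma edge_contrapos: "edge \<C> a l \<Longrightarrow> edge \<C> (neg_lit l) (neg_lit a)"
  unfolding edge_def by auto

lemma closed_litsD: "closed_lits \<C> R \<Longrightarrow> a \<in> R \<Longrightarrow> edge \<C> a l \<Longrightarrow> l \<in> R"
  unfolding closed_lits_def by blast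

text \<open>A plain union of consistent sets may contain complementary literals, so \<open>T\<close>
  decides every variable it mentions and \<open>R\<close> decides the rest.\<close>

definition override_lits :: "literal set \<Rightarrow> literal set \<Rightarrow> literal set" where
  "override_lits R T = T \<union> {l\<in>R. var l \<notin> var ` T}"

lemma var_in_image_iff: "var l \<in> var ` T \<longleftrightarrow> l \<in> T \<or> neg_lit l \<in> T"
proof
  assume "var l \<in> var ` T"
  then obtain l' where l': "l' \<in> T" "var l = var l'" by (rule imageE) blast
  from l'(2) have "l' = l \<or> l' = neg_lit l" unfolding var_eq_iff .
  with l'(1) show "l \<in> T \<or> neg_lit l \<in> T" by auto
next
  assume "l \<in> T \<or> neg_lit l \<in> T"
  then show "var l \<in> var ` T" by (auto intro: image_eqI[of _ _ l] image_eqI[of _ _ "neg_lit l"])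
qed

lemma consistent_override:
  assumes "consistent R" "consistent T" shows "consistent (override_lits R T)"
  unfolding consistent_def
proof
  fix l assume l: "l \<in> override_lits R T"
  show "neg_lit l \<notin> override_lits R T"
  proof (cases "l \<in> T")
    case True
    then show ?thesis
      using assms(2) unfolding consistent_def override_lits_def by (simp add: var_in_image_iff)
  next
    case False
    then have "l \<in> R" "neg_lit l \<notin> T"
      using l unfolding override_lits_def by (simp_all add: var_in_image_iff)
    then show ?thesis
      using assms(1) unfolding consistent_def override_lits_def by simp
  qed
qed

text \<open>Let \<open>a\<close> come from \<open>R\<close>, on a variable that \<open>T\<close>
  does not mention. An edge from \<open>a\<close> to a literal whose complement is in
  \<open>T\<close> would by contraposition put \<open>neg_lit a\<close> into \<open>T\<close>. So
  the edge ends in \<open>T\<close>, or on a variable that \<open>R\<close> still decides.\<close>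

lemma closed_override:
  assumes R: "closed_lits \<C> R" and T: "closed_lits \<C> T"
  shows "closed_lits \<C> (override_lits R T)"
  unfolding closed_lits_def
proof (intro ballI allI impI)
  fix a l assume a: "a \<in> override_lits R T" and e: "edge \<C> a l"
  show "l \<in> override_lits R T"
  proof (cases "a \<in> T")
    case True
    then show ?thesis using closed_litsD[OF T] e by (auto simp: override_lits_def)
  next
    case False
    with a have aR: "a \<in> R" and av: "a \<notin> T" "neg_lit a \<notin> T"
      by (auto simp: override_lits_def var_in_image_iff)
    have "neg_lit l \<notin> T"
      using closed_litsD[OF T _ edge_contrapos[OF e]] av by blast
    then show ?thesis
      using closed_litsD[OF R aR e] by (auto simp: override_lits_def var_in_image_iff)
  qed
qed

lemma var_override: "var ` override_lits R T = var ` R \<union> var ` T"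
proof
  show "var ` override_lits R T \<subseteq> var ` R \<union> var ` T"
    unfolding override_lits_def by auto
  have "var l \<in> var ` override_lits R T" if "l \<in> R" for l
  proof (cases "var l \<in> var ` T")
    case True
    then show ?thesis unfolding override_lits_def image_Un by (rule UnI1)
  next
    case False
    with that have "l \<in> override_lits R T" unfolding override_lits_def by simp
    then show ?thesis by (rule imageI)
  qed
  then show "var ` R \<union> var ` T \<subseteq> var ` override_lits R T"
    unfolding override_lits_def by auto
qed

text \<open>These variables have to go to \<open>V2\<close>: they are linked, through clauses and outside \<open>V0\<close>, to
  a clause with three literals outside \<open>V0\<close>.\<close>

inductive_set xor_vars :: "literal list set \<Rightarrow> nat set \<Rightarrow> nat set" for \<C> V0 where
  base: "c \<in> \<C> \<Longrightarrow> 3 \<le> length (filter (\<lambda>l. var l \<notin> V0) c) \<Longrightarrow> l \<in> set c \<Longrightarrow> var l \<notin> V0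
    \<Longrightarrow> var l \<in> xor_vars \<C> V0"
| step: "v \<in> xor_vars \<C> V0 \<Longrightarrow> c \<in> \<C> \<Longrightarrow> v \<in> var ` set c \<Longrightarrow> l \<in> set c \<Longrightarrow> var l \<notin> V0
    \<Longrightarrow> var l \<in> xor_vars \<C> V0"

lemma xor_vars_disjoint: "v \<in> xor_vars \<C> V0 \<Longrightarrow> v \<notin> V0"
  by (induction rule: xor_vars.induct) auto

section \<open>Self-dual functions and their ternary minors\<close>

definition self_dual :: "nat \<Rightarrow> (bool list \<Rightarrow> bool) \<Rightarrow> bool" where
  "self_dual k g \<longleftrightarrow> (\<forall>v. length v = k \<longrightarrow> g (map Not v) \<longleftrightarrow> \<not> g v)"

text \<open>A ternary identification minor of \<open>g\<close>: the coloring \<open>\<kappa>\<close>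
  tells each coordinate which of the three arguments it receives.\<close>

definition minor :: "(bool list \<Rightarrow> bool) \<Rightarrow> nat list \<Rightarrow> bool \<Rightarrow> bool \<Rightarrow> bool \<Rightarrow> bool" where
  "minor g \<kappa> p q r = g (map (\<lambda>c. if c = 0 then p else if c = 1 then q else r) \<kappa>)"

lemma minor_not:
  assumes "self_dual (length \<kappa>) g"
  shows "minor g \<kappa> (\<not> p) (\<not> q) (\<not> r) \<longleftrightarrow> \<not> minor g \<kappa> p q r"
proof -
  have eq: "map (\<lambda>c. if c = 0 then \<not> p else if c = 1 then \<not> q else \<not> r) \<kappa>
      = map Not (map (\<lambda>c. if c = 0 then p else if c = 1 then q else r) \<kappa>)"
    by auto
  have "g (map Not v) \<longleftrightarrow> \<not> g v" if "length v = length \<kappa>" for v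
    using assms that unfolding self_dual_def by blast
  from this[OF length_map] show ?thesis unfolding minor_def eq .
qed

lemma minor_const:
  assumes "unanimous (length \<kappa>) g"
  shows "minor g \<kappa> p p p = p"
proof -
  have "map (\<lambda>c. if c = 0 then p else if c = 1 then p else p) \<kappa> = replicate (length \<kappa>) p"
    by (auto simp: list_eq_iff_nth_eq)
  then show ?thesis
    using assms unfolding minor_def unanimous_def by metis
qed

text \<open>The sets whose indicator is accepted form an ultrafilter on a finite set as soon as every
  partition into three blocks has exactly one accepted block.\<close>

lemma nonprojection_minor:
  assumes sd: "self_dual k g" and un: "unanimous k g" and np: "\<not> is_projection k g"
  obtains \<kappa> where "length \<kappa> = k"
    "\<not> (minor g \<kappa> True False False \<and> \<not> minor g \<kappa> False True False \<and> \<not> minor g \<kappa> False False True)"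
    "\<not> (\<not> minor g \<kappa> True False False \<and> minor g \<kappa> False True False \<and> \<not> minor g \<kappa> False False True)"
    "\<not> (\<not> minor g \<kappa> True False False \<and> \<not> minor g \<kappa> False True False \<and> minor g \<kappa> False False True)"
proof (rule ccontr)
  note [simp del] = upt_Suc
  assume no: "\<not> thesis"
  note wit = that
  \<comment> \<open>\<open>F\<close> accepts arbitrary sets of naturals, so that blocks can be
    written with complements; only their part below \<open>k\<close> matters.\<close>
  define F where "F S = g (map (\<lambda>i. i \<in> S) [0..<k])" for S
  define col where "col A B = map (\<lambda>i. if i \<in> A then 0 else if i \<in> B then 1 else (2::nat)) [0..<k]"
    for A B :: "nat set"
  \<comment> \<open>If no coloring is as claimed, each partition into three blocks, read as a
    coloring, has exactly one accepted block.\<close>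
  have part: "(F A \<and> \<not> F B \<and> \<not> F (- A - B)) \<or> (\<not> F A \<and> F B \<and> \<not> F (- A - B)) \<or>
      (\<not> F A \<and> \<not> F B \<and> F (- A - B))" if "A \<inter> B = {}" for A B
  proof -
    have m: "minor g (col A B) True False False = F A"
      "minor g (col A B) False True False = F B"
      "minor g (col A B) False False True = F (- A - B)"
      using that unfolding minor_def F_def col_def map_map
      by (auto intro!: arg_cong[of _ _ g] split: if_splits)
    show ?thesis
      using no wit[of "col A B"] m unfolding col_def by fastforce
  qed
  have F0: "\<not> F {}"
  proof -
    have "map (\<lambda>i. i \<in> {}) [0..<k] = replicate k False" by (simp add: map_replicate_const)
    then show ?thesis using un unfolding F_def unanimous_def by metis
  qed
  have FU: "F {..<k}"
  proof -
    have "map (\<lambda>i. i \<in> {..<k}) [0..<k] = replicate k True"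
      by (rule nth_equalityI) auto
    then show ?thesis using un unfolding F_def unanimous_def by metis
  qed
  \<comment> \<open>A smallest accepted set is a singleton: if \<open>{i}\<close> were rejected, the
    partition into \<open>{i}\<close>, \<open>S - {i}\<close> and \<open>- S\<close> would make
    \<open>S - {i}\<close> accepted. The singleton then generates the ultrafilter, and
    \<open>g\<close> is a projection.\<close>
  obtain S where S: "F S" "finite S" and min: "\<And>T. F T \<Longrightarrow> finite T \<Longrightarrow> card S \<le> card T"
    using ex_has_least_nat[of "\<lambda>S. F S \<and> finite S" "{..<k}" card] FU by auto
  have "S \<noteq> {}" using S F0 by auto
  then obtain i where i: "i \<in> S" by blast
  have Fi: "F {i}"
  proof (rule ccontr)
    assume n: "\<not> F {i}"
    have "\<not> F (- S)" using part[of S "- S"] S F0 by auto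
    moreover have "- {i} - (S - {i}) = - S" using i by blast
    ultimately have "F (S - {i})"
      using part[of "{i}" "S - {i}"] n by auto
    from min[OF this] S i show False
      by (metis card_Diff1_less finite_Diff not_less)
  qed
  have Fiff: "F T \<longleftrightarrow> i \<in> T" for T
  proof (cases "i \<in> T")
    case True
    then have "- {i} - (T - {i}) = - T" by blast
    then have "\<not> F (- T)" using part[of "{i}" "T - {i}"] Fi by auto
    moreover have "- T - - T = {}" by blast
    ultimately show ?thesis using part[of T "- T"] F0 True by auto
  next
    case False
    then show ?thesis using part[of T "{i}"] Fi by blast
  qed
  have ik: "i < k"
  proof (rule ccontr)
    assume "\<not> i < k"
    then have "map (\<lambda>j. j \<in> {i}) [0..<k] = map (\<lambda>j. j \<in> {}) [0..<k]" by auto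
    then show False using Fi F0 unfolding F_def by metis
  qed
  have "g v = v ! i" if "length v = k" for v
  proof -
    have "v = map (\<lambda>j. j \<in> {j. v ! j}) [0..<k]"
      using that by (auto intro: nth_equalityI)
    then show ?thesis using Fiff[of "{j. v ! j}"] unfolding F_def by auto
  qed
  then show False using np ik unfolding is_projection_def by blast
qed

section \<open>What clause witnesses impose on a locally non-dictatorial aggregator\<close>

locale lpd =
  fixes n k :: nat and D :: "bool list set" and f :: "nat \<Rightarrow> bool list \<Rightarrow> bool"
    and \<C> :: "literal list set"
  assumes aggr: "aggregator n k D f"
    and nonproj: "j < n \<Longrightarrow> \<not> is_projection k (f j)"
    and prime: "c \<in> \<C> \<Longrightarrow> prime_clause D c"
    and vars: "c \<in> \<C> \<Longrightarrow> l \<in> set c \<Longrightarrow> var l < n"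
begin

definition app :: "bool list list \<Rightarrow> bool list" where
  "app xs = map (\<lambda>j. f j (map (\<lambda>x. x ! j) xs)) [0..<n]"

lemma app_in: "length xs = k \<Longrightarrow> set xs \<subseteq> D \<Longrightarrow> app xs \<in> D"
  using aggr unfolding aggregator_def app_def by blast

lemma app_nth: "j < n \<Longrightarrow> app xs ! j = f j (map (\<lambda>x. x ! j) xs)"
  unfolding app_def by simp

lemma unan: "j < n \<Longrightarrow> unanimous k (f j)"
  using aggr unfolding aggregator_def by blast

lemma app_unanimous:
  assumes "var l < n" "length xs = k" "\<forall>x\<in>set xs. lit_true x l = b"
  shows "lit_true (app xs) l = b"
proof -
  have "map (\<lambda>x. x ! var l) xs = replicate k (b = is_Pos l)"
    using assms(2,3) by (auto simp: lit_true_iff list_eq_iff_nth_eq)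
  then show ?thesis
    using unan[OF assms(1)] assms(1) unfolding unanimous_def lit_true_iff by (auto simp: app_nth)
qed

lemma clause_app:
  assumes "c \<in> \<C>" "length xs = k" "set xs \<subseteq> D"
  obtains l where "l \<in> set c" "lit_true (app xs) l"
  using assms prime app_in prime_clauseD by metis

text \<open>At a literal that holds in \<open>x\<close> and fails in \<open>y\<close>, the column of
  \<open>sel v x y\<close> is \<open>v\<close> or its complement, according to polarity. So a
  component can be probed at any chosen pattern.\<close>

definition sel :: "bool list \<Rightarrow> bool list \<Rightarrow> bool list \<Rightarrow> bool list list" where
  "sel v x y = map (\<lambda>b. if b then x else y) v"

lemma sel_props:
  "length (sel v x y) = length v" "x \<in> D \<Longrightarrow> y \<in> D \<Longrightarrow> set (sel v x y) \<subseteq> D"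
  "set (sel v x y) \<subseteq> {x, y}"
  unfolding sel_def by auto

lemma app_sel:
  assumes "var l < n" "lit_true x l" "\<not> lit_true y l"
  shows "lit_true (app (sel v x y)) l
     = (f (var l) (if is_Pos l then v else map Not v) = is_Pos l)"
proof -
  have "map (\<lambda>x. x ! var l) (sel v x y) = (if is_Pos l then v else map Not v)"
    using assms(2,3) unfolding sel_def lit_true_iff by (cases "is_Pos l") (auto simp: list_eq_iff_nth_eq)
  then show ?thesis using assms(1) by (simp add: lit_true_iff app_nth)
qed

text \<open>Suppose a component takes the same value on \<open>v\<close> and on its complement. Mix
  the witnesses of two literals \<open>l\<close>, \<open>l'\<close> of a clause along
  \<open>v\<close>, in both orders: if \<open>l\<close> comes out false both times, then
  \<open>l'\<close> must come out true both times. So the literals made true by such a defect form a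
  closed consistent set, which puts \<open>j\<close> into \<open>horn_vars \<C>\<close>.\<close>

lemma self_dual_outside:
  assumes j: "j < n" "j \<notin> horn_vars \<C>"
  shows "self_dual k (f j)"
proof (rule ccontr)
  assume "\<not> ?thesis"
  then obtain v where v: "length v = k" "f j (map Not v) = f j v"
    unfolding self_dual_def by blast
  \<comment> \<open>The literals made true by the common value of their component on
    \<open>v\<close> and on its complement.\<close>
  define R where "R = {l. var l < n \<and> f (var l) v = f (var l) (map Not v) \<and>
     f (var l) v = is_Pos l}"
  have "consistent R"
    unfolding consistent_def R_def by auto
  moreover have "closed_lits \<C> R"
    unfolding closed_lits_def
  proof (intro ballI allI impI)
    fix a l' assume a: "a \<in> R" and "edge \<C> a l'"
    then obtain c where c: "c \<in> \<C>" "neg_lit a \<in> set c" "l' \<in> set c" "l' \<noteq> neg_lit a"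
      unfolding edge_def by blast
    define l where "l = neg_lit a"
    obtain x where x: "x \<in> D" "lit_true x l"
      "\<And>l'. l' \<in> set c \<Longrightarrow> l' \<noteq> l \<Longrightarrow> \<not> lit_true x l'"
      using prime_clause_witness[OF prime[OF c(1)], of l] c l_def by metis
    obtain y where y: "y \<in> D" "lit_true y l'"
      "\<And>l''. l'' \<in> set c \<Longrightarrow> l'' \<noteq> l' \<Longrightarrow> \<not> lit_true y l''"
      using prime_clause_witness[OF prime[OF c(1)] c(3)] by metis
    have ln: "var l < n" "var l' < n" using vars[OF c(1) c(2)] vars[OF c(1) c(3)] l_def by auto
    have nl: "\<not> lit_true x l'" "\<not> lit_true y l"
      using x(3)[OF c(3)] y(3)[of l] c(2,4) l_def by metis+
    have al: "f (var l) v = f (var l) (map Not v)" "f (var l) v \<noteq> is_Pos l"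
      using a unfolding R_def l_def by auto
    have main: "lit_true (app (sel v p q)) l'" if "(p = x \<and> q = y) \<or> (p = y \<and> q = x)" for p q
    proof -
      have pq: "p \<in> D" "q \<in> D" using that x y by auto
      obtain l'' where l'': "l'' \<in> set c" "lit_true (app (sel v p q)) l''"
        using clause_app[OF c(1), of "sel v p q"] sel_props(1)[of v] sel_props(2)[OF pq] v(1) by metis
      have "l'' \<noteq> l"
      proof
        assume "l'' = l"
        moreover have "\<not> lit_true (app (sel v p q)) l"
        proof (cases "p = x \<and> q = y")
          case True
          then show ?thesis using app_sel[OF ln(1) x(2) nl(2), of v] al by auto
        next
          case False
          then have "p = y" "q = x" using that by auto
          \<comment> \<open>Exchanging the two witnesses amounts to complementing
            \<open>v\<close>.\<close>
          moreover have "sel v y x = sel (map Not v) x y" unfolding sel_def by auto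
          moreover have "map Not (map Not v) = v" by (simp add: map_idI)
          ultimately show ?thesis using app_sel[OF ln(1) x(2) nl(2), of "map Not v"] al by auto
        qed
        ultimately show False using l'' by blast
      qed
      \<comment> \<open>A third literal is false in both witnesses and therefore, by unanimity, in
        the aggregate.\<close>
      moreover have False if "l'' \<noteq> l" "l'' \<noteq> l'"
      proof -
        have "\<forall>z\<in>set (sel v p q). lit_true z l'' = False"
          using sel_props(3)[of v p q] x(3)[OF l''(1)] y(3)[OF l''(1)] that
            \<open>(p = x \<and> q = y) \<or> (p = y \<and> q = x)\<close> by blast
        then show False
          using app_unanimous[of l'' "sel v p q" False] vars[OF c(1) l''(1)] sel_props(1) v(1) l''(2)
          by metis
      qed
      ultimately show ?thesis using l'' by blast
    qed
    have t1: "lit_true (app (sel v y x)) l'" and t2: "lit_true (app (sel v x y)) l'"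
      using main by auto
    have nn: "map Not (map Not v) = v" by (simp add: map_idI)
    have e: "sel v x y = sel (map Not v) y x" unfolding sel_def by auto
    have "f (var l') (if is_Pos l' then v else map Not v) = is_Pos l'"
      using app_sel[OF ln(2) y(2) nl(1)] t1 by blast
    moreover have "f (var l') (if is_Pos l' then map Not v else v) = is_Pos l'"
      using app_sel[OF ln(2) y(2) nl(1), of "map Not v"] t2 nn unfolding e by metis
    ultimately show "l' \<in> R"
      using ln unfolding R_def by (auto split: if_splits)
  qed
  moreover have "j \<in> var ` R"
    using v j unfolding R_def by (cases "f j v") (auto intro: image_eqI[of _ _ "Pos j"] image_eqI[of _ _ "Neg j"])
  ultimately show False using j unfolding horn_vars_def by blast
qed

lemma app_sel_self_dual:
  assumes "var l < n" "var l \<notin> horn_vars \<C>" "lit_true x l" "\<not> lit_true y l" "length v = k"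
  shows "lit_true (app (sel v x y)) l = f (var l) v"
  using app_sel[OF assms(1,3,4), of v] self_dual_outside[OF assms(1,2)] assms(5)
  unfolding self_dual_def by auto

text \<open>Mix the witnesses of \<open>l\<close> and \<open>l'\<close> along \<open>v\<close>. By
  self-duality \<open>l'\<close> comes out true only if \<open>f (var l') v\<close> is false, which
  is excluded. So \<open>l\<close> has to satisfy the clause, and its truth value is
  \<open>f (var l) v\<close>.\<close>

lemma same_component_le:
  assumes c: "c \<in> \<C>" "l \<in> set c" "l' \<in> set c" "l \<noteq> l'"
    and o: "var l \<notin> horn_vars \<C>" "var l' \<notin> horn_vars \<C>" and v: "length v = k" "f (var l') v"
  shows "f (var l) v"
proof -
  obtain x where x: "x \<in> D" "lit_true x l"
    "\<And>l'. l' \<in> set c \<Longrightarrow> l' \<noteq> l \<Longrightarrow> \<not> lit_true x l'"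
    using prime_clause_witness[OF prime[OF c(1)] c(2)] by metis
  obtain y where y: "y \<in> D" "lit_true y l'"
    "\<And>l''. l'' \<in> set c \<Longrightarrow> l'' \<noteq> l' \<Longrightarrow> \<not> lit_true y l''"
    using prime_clause_witness[OF prime[OF c(1)] c(3)] by metis
  have ln: "var l < n" "var l' < n" using vars[OF c(1)] c by auto
  obtain l'' where l'': "l'' \<in> set c" "lit_true (app (sel v x y)) l''"
    using clause_app[OF c(1), of "sel v x y"] sel_props(1)[of v] sel_props(2)[OF x(1) y(1)] v(1) by metis
  consider "l'' = l" | "l'' = l'" | "l'' \<noteq> l" "l'' \<noteq> l'" by blast
  then show ?thesis
  proof cases
    case 1
    then show ?thesis
      using l'' app_sel_self_dual[OF ln(1) o(1) x(2)] y(3) c v(1) by metis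
  next
    case 2
    have "map Not (map Not v) = v" by (simp add: map_idI)
    then have e: "sel v x y = sel (map Not v) y x" unfolding sel_def by auto
    have "lit_true (app (sel (map Not v) y x)) l' = f (var l') (map Not v)"
      using app_sel_self_dual[OF ln(2) o(2) y(2), of x "map Not v"] x(3) c v(1) by simp
    then have "f (var l') (map Not v)" using l'' 2 e by simp
    then show ?thesis
      using self_dual_outside[OF ln(2) o(2)] v unfolding self_dual_def by blast
  next
    case 3
    have "\<forall>z\<in>set (sel v x y). lit_true z l'' = False"
      using sel_props(3)[of v x y] x(3)[OF l''(1)] y(3)[OF l''(1)] 3 by blast
    then show ?thesis
      using app_unanimous[of l'' "sel v x y" False] vars[OF c(1) l''(1)] sel_props(1) v(1) l''(2)
      by metis
  qed
qed

lemma same_component: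
  assumes c: "c \<in> \<C>" "l \<in> set c" "l' \<in> set c"
    and o: "var l \<notin> horn_vars \<C>" "var l' \<notin> horn_vars \<C>" and v: "length v = k"
  shows "f (var l) v = f (var l') v"
  using same_component_le[OF c _ o v] same_component_le[OF c(1,3,2) _ o(2,1) v] by (cases "l = l'") auto

definition sel3 :: "nat list \<Rightarrow> bool list \<Rightarrow> bool list \<Rightarrow> bool list \<Rightarrow> bool list list" where
  "sel3 \<kappa> x y z = map (\<lambda>c. if c = 0 then x else if c = 1 then y else z) \<kappa>"

lemma sel3_props:
  "length (sel3 \<kappa> x y z) = length \<kappa>" "set (sel3 \<kappa> x y z) \<subseteq> {x, y, z}"
  unfolding sel3_def by auto

text \<open>For a negative literal all three arguments and the result are complemented, which
  self-duality permits. So negative literals aggregate like positive ones.\<close>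

lemma app_sel3:
  assumes l: "var l < n" "var l \<notin> horn_vars \<C>" and \<kappa>: "length \<kappa> = k"
  shows "lit_true (app (sel3 \<kappa> x y z)) l
     = minor (f (var l)) \<kappa> (lit_true x l) (lit_true y l) (lit_true z l)"
proof -
  have "app (sel3 \<kappa> x y z) ! var l = minor (f (var l)) \<kappa> (x ! var l) (y ! var l) (z ! var l)"
    using l(1) unfolding app_nth[OF l(1)] minor_def sel3_def map_map
    by (auto intro!: arg_cong[of _ _ "f (var l)"])
  then show ?thesis
    using minor_not[of \<kappa> "f (var l)"] self_dual_outside[OF l] \<kappa> unfolding lit_true_iff
    by (cases "is_Pos l") auto
qed

lemma minor_cong:
  assumes c: "c \<in> \<C>" "l \<in> set c" "l' \<in> set c"
    and o: "var l \<notin> horn_vars \<C>" "var l' \<notin> horn_vars \<C>" and \<kappa>: "length \<kappa> = k"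
  shows "minor (f (var l)) \<kappa> = minor (f (var l')) \<kappa>"
  using same_component[OF c o] \<kappa> unfolding minor_def by (intro ext) simp

text \<open>Aggregating three witnesses shows that the minor accepts at least one unit vector, and
  \<open>nonprojection_minor\<close> excludes exactly one. If it accepts two, let the aggregate
  \<open>w\<close> replace the witness in the rejected slot: a second aggregation falsifies all
  three literals. So all three are accepted, which for a self-dual idempotent function means ternary
  parity.\<close>

lemma xor_minor_base:
  assumes c: "c \<in> \<C>" "3 \<le> length (filter (\<lambda>l. var l \<notin> horn_vars \<C>) c)" "distinct c"
    and l: "l \<in> set c" "var l \<notin> horn_vars \<C>"
  shows "\<exists>\<kappa>. length \<kappa> = k \<and> minor (f (var l)) \<kappa> True False False \<and>
    minor (f (var l)) \<kappa> False True False \<and> minor (f (var l)) \<kappa> False False True"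
proof -
  define us where "us = filter (\<lambda>l. var l \<notin> horn_vars \<C>) c"
  have "distinct us" "3 \<le> length us" using c us_def by auto
  then obtain l1 l2 l3 rest where us: "us = l1 # l2 # l3 # rest"
    by (metis Suc_le_length_iff numeral_3_eq_3)
  have d: "l1 \<noteq> l2" "l1 \<noteq> l3" "l2 \<noteq> l3" using \<open>distinct us\<close> us by auto
  have "{l1, l2, l3} \<subseteq> {l\<in>set c. var l \<notin> horn_vars \<C>}"
    using arg_cong[OF us, of set] unfolding us_def by auto
  then have lc: "l1 \<in> set c" "l2 \<in> set c" "l3 \<in> set c"
    and lo: "var l1 \<notin> horn_vars \<C>" "var l2 \<notin> horn_vars \<C>" "var l3 \<notin> horn_vars \<C>"
    by auto
  have ln: "var l1 < n" "var l2 < n" "var l3 < n" using lc vars c by auto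
  obtain x where x: "x \<in> D" "lit_true x l1"
    "\<And>l'. l' \<in> set c \<Longrightarrow> l' \<noteq> l1 \<Longrightarrow> \<not> lit_true x l'"
    using prime_clause_witness[OF prime[OF c(1)] lc(1)] by metis
  obtain y where y: "y \<in> D" "lit_true y l2"
    "\<And>l'. l' \<in> set c \<Longrightarrow> l' \<noteq> l2 \<Longrightarrow> \<not> lit_true y l'"
    using prime_clause_witness[OF prime[OF c(1)] lc(2)] by metis
  obtain z where z: "z \<in> D" "lit_true z l3"
    "\<And>l'. l' \<in> set c \<Longrightarrow> l' \<noteq> l3 \<Longrightarrow> \<not> lit_true z l'"
    using prime_clause_witness[OF prime[OF c(1)] lc(3)] by metis
  have vl: "var l < n" using vars c l by auto
  define g where "g = f (var l)"
  have sd: "self_dual k g" and un: "unanimous k g" and np: "\<not> is_projection k g"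
    unfolding g_def using self_dual_outside[OF vl l(2)] unan[OF vl] nonproj[OF vl] by auto
  obtain \<kappa> where \<kappa>: "length \<kappa> = k"
    and np1: "\<not> (minor g \<kappa> True False False \<and> \<not> minor g \<kappa> False True False \<and> \<not> minor g \<kappa> False False True)"
    and np2: "\<not> (\<not> minor g \<kappa> True False False \<and> minor g \<kappa> False True False \<and> \<not> minor g \<kappa> False False True)"
    and np3: "\<not> (\<not> minor g \<kappa> True False False \<and> \<not> minor g \<kappa> False True False \<and> minor g \<kappa> False False True)"
    by (rule nonprojection_minor[OF sd un np])
  have mg: "minor (f (var l1)) \<kappa> = minor g \<kappa>" "minor (f (var l2)) \<kappa> = minor g \<kappa>"
    "minor (f (var l3)) \<kappa> = minor g \<kappa>"
    unfolding g_def using minor_cong[OF c(1) _ l(1) _ l(2) \<kappa>] lc lo by auto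
  have neg: "minor g \<kappa> (\<not> p) (\<not> q) (\<not> r) = (\<not> minor g \<kappa> p q r)" for p q r
    using minor_not[of \<kappa> g] sd \<kappa> by simp
  have const: "minor g \<kappa> p p p = p" for p
    using minor_const[of \<kappa> g] un \<kappa> by simp
  \<comment> \<open>Members of \<open>D\<close> that can satisfy the clause only through
    \<open>l1\<close>, \<open>l2\<close> or \<open>l3\<close>. This set is closed under aggregation
    by \<open>\<kappa>\<close>, so aggregates may be aggregated again.\<close>
  define cl where "cl = {p. p \<in> D \<and> (\<forall>l'\<in>set c. l' \<noteq> l1 \<and> l' \<noteq> l2 \<and> l' \<noteq> l3 \<longrightarrow> \<not> lit_true p l')}"
  have xyz: "x \<in> cl" "y \<in> cl" "z \<in> cl" unfolding cl_def using x y z by auto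
  have cl_app: "app (sel3 \<kappa> p q r) \<in> cl" if pqr: "p \<in> cl" "q \<in> cl" "r \<in> cl" for p q r
  proof -
    have "set (sel3 \<kappa> p q r) \<subseteq> cl" using sel3_props(2)[of \<kappa> p q r] pqr by auto
    then have s: "set (sel3 \<kappa> p q r) \<subseteq> D"
      "\<forall>l'\<in>set c. l' \<noteq> l1 \<and> l' \<noteq> l2 \<and> l' \<noteq> l3 \<longrightarrow> (\<forall>x\<in>set (sel3 \<kappa> p q r). lit_true x l' = False)"
      unfolding cl_def by auto
    have len: "length (sel3 \<kappa> p q r) = k" using sel3_props(1) \<kappa> by simp
    have "app (sel3 \<kappa> p q r) \<in> D" using app_in[OF len s(1)] .
    moreover have "\<not> lit_true (app (sel3 \<kappa> p q r)) l'"
      if "l' \<in> set c" "l' \<noteq> l1 \<and> l' \<noteq> l2 \<and> l' \<noteq> l3" for l'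
    proof -
      have "\<forall>x\<in>set (sel3 \<kappa> p q r). lit_true x l' = False" using s(2) that by blast
      from app_unanimous[OF vars[OF c(1) that(1)] len this] show ?thesis by simp
    qed
    ultimately show ?thesis unfolding cl_def by blast
  qed
  have some: "lit_true p l1 \<or> lit_true p l2 \<or> lit_true p l3" if "p \<in> cl" for p
  proof -
    have "p \<in> D" using that unfolding cl_def by simp
    then obtain l' where l': "l' \<in> set c" "lit_true p l'"
      by (rule prime_clauseD[OF prime[OF c(1)]])
    with that have "l' = l1 \<or> l' = l2 \<or> l' = l3" unfolding cl_def by blast
    with l'(2) show ?thesis by auto
  qed
  have ev: "lit_true (app (sel3 \<kappa> p q r)) l1 = minor g \<kappa> (lit_true p l1) (lit_true q l1) (lit_true r l1)"
    "lit_true (app (sel3 \<kappa> p q r)) l2 = minor g \<kappa> (lit_true p l2) (lit_true q l2) (lit_true r l2)"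
    "lit_true (app (sel3 \<kappa> p q r)) l3 = minor g \<kappa> (lit_true p l3) (lit_true q l3) (lit_true r l3)"
    for p q r
    using app_sel3[OF ln(1) lo(1) \<kappa>] app_sel3[OF ln(2) lo(2) \<kappa>] app_sel3[OF ln(3) lo(3) \<kappa>] mg
    by simp_all
  have trx: "lit_true x l1" "\<not> lit_true x l2" "\<not> lit_true x l3"
    "\<not> lit_true y l1" "lit_true y l2" "\<not> lit_true y l3"
    "\<not> lit_true z l1" "\<not> lit_true z l2" "lit_true z l3"
    using x y z lc d by auto
  define w where "w = app (sel3 \<kappa> x y z)"
  have wcl: "w \<in> cl" using cl_app xyz w_def by simp
  have trw: "lit_true w l1 = minor g \<kappa> True False False"
    "lit_true w l2 = minor g \<kappa> False True False"
    "lit_true w l3 = minor g \<kappa> False False True"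
    unfolding w_def ev by (simp_all add: trx)
  \<comment> \<open>Self-duality and unanimity determine the minor from its values on the three unit
    vectors.\<close>
  have n1: "minor g \<kappa> False True True = (\<not> minor g \<kappa> True False False)"
    and n2: "minor g \<kappa> True False True = (\<not> minor g \<kappa> False True False)"
    and n3: "minor g \<kappa> True True False = (\<not> minor g \<kappa> False False True)"
    using neg[of True False False] neg[of False True False] neg[of False False True] by simp_all
  have c0: "\<not> minor g \<kappa> False False False" using const[of False] by simp
  let ?a = "minor g \<kappa> True False False"
  let ?b = "minor g \<kappa> False True False"
  let ?c = "minor g \<kappa> False False True"
  have "?a \<or> ?b \<or> ?c" using some[OF wcl] unfolding trw .
  then consider "?a" "?b" "?c" | "?a" "?b" "\<not> ?c" | "?a" "\<not> ?b" "?c" | "\<not> ?a" "?b" "?c"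
    using np1 np2 np3 by argo
  then have "?a \<and> ?b \<and> ?c"
  proof cases
    case 1
    then show ?thesis by simp
  next
    case 2
    then show ?thesis using some[OF cl_app[OF xyz(1,2) wcl]] unfolding ev trw
      by (simp add: trx n1 n2 c0)
  next
    case 3
    then show ?thesis using some[OF cl_app[OF xyz(1) wcl xyz(3)]] unfolding ev trw
      by (simp add: trx n1 n3 c0)
  next
    case 4
    then show ?thesis using some[OF cl_app[OF wcl xyz(2,3)]] unfolding ev trw
      by (simp add: trx n2 n3 c0)
  qed
  then show ?thesis using \<kappa> unfolding g_def by blast
qed

text \<open>Components outside \<open>horn_vars \<C>\<close> agree within a clause, so the coloring
  found at a clause with three outside literals remains valid along every chain of clauses linked to
  it.\<close>

lemma xor_minor:
  assumes "v \<in> xor_vars \<C> (horn_vars \<C>)" "\<And>c. c \<in> \<C> \<Longrightarrow> distinct c"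
  shows "\<exists>\<kappa>. length \<kappa> = k \<and> minor (f v) \<kappa> True False False \<and>
    minor (f v) \<kappa> False True False \<and> minor (f v) \<kappa> False False True"
  using assms(1)
proof induction
  case (base c l)
  then show ?case using xor_minor_base[of c l] assms(2) by blast
next
  case (step v c l)
  obtain l0 where l0: "l0 \<in> set c" "v = var l0" using step by blast
  have "var l0 \<notin> horn_vars \<C>" using xor_vars_disjoint step(1) l0 by blast
  then show ?case
    using minor_cong[OF step(2) step(4) l0(1) step(5)] step.IH l0 by metis
qed

text \<open>Adding two witnesses with the ternary parity makes two true literals false and leaves the
  others alone; the literals over \<open>V0\<close> stay false by unanimity.\<close>

lemma odd_parity:
  assumes c: "c \<in> \<C>" "distinct c" and l0: "l0 \<in> set c" "var l0 \<notin> horn_vars \<C>"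
    and \<kappa>: "length \<kappa> = k" "minor (f (var l0)) \<kappa> True False False"
      "minor (f (var l0)) \<kappa> False True False" "minor (f (var l0)) \<kappa> False False True"
    and x: "x \<in> D" "\<And>l. l \<in> set c \<Longrightarrow> var l \<in> horn_vars \<C> \<Longrightarrow> \<not> lit_true x l"
  shows "odd (card {l\<in>set c. lit_true x l})"
  using x
proof (induction "card {l\<in>set c. lit_true x l}" arbitrary: x rule: less_induct)
  case less
  define A where "A = {l\<in>set c. lit_true x l}"
  have fA: "finite A" unfolding A_def by simp
  have "A \<noteq> {}" using prime_clauseD[OF prime[OF c(1)] less(2)] unfolding A_def by blast
  then obtain a where a: "a \<in> A" by blast
  show ?case
  proof (cases "A = {a}")
    case True
    then show ?thesis unfolding A_def by simp
  next
    case False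
    then obtain b where b: "b \<in> A" "a \<noteq> b" using a by blast
    have ab: "a \<in> set c" "b \<in> set c" using a b unfolding A_def by auto
    obtain p where p: "p \<in> D" "lit_true p a"
      "\<And>l'. l' \<in> set c \<Longrightarrow> l' \<noteq> a \<Longrightarrow> \<not> lit_true p l'"
      using prime_clause_witness[OF prime[OF c(1)] ab(1)] by metis
    obtain q where q: "q \<in> D" "lit_true q b"
      "\<And>l'. l' \<in> set c \<Longrightarrow> l' \<noteq> b \<Longrightarrow> \<not> lit_true q l'"
      using prime_clause_witness[OF prime[OF c(1)] ab(2)] by metis
    define w where "w = app (sel3 \<kappa> x p q)"
    have len: "length (sel3 \<kappa> x p q) = k" using sel3_props(1) \<kappa> by simp
    have wD: "w \<in> D" unfolding w_def
      by (rule app_in[OF len]) (use sel3_props(2)[of \<kappa> x p q] p q less in auto)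
    have oab: "var a \<notin> horn_vars \<C>" "var b \<notin> horn_vars \<C>"
      using less(3) a b unfolding A_def by auto
    have wh: "\<not> lit_true w l" if l: "l \<in> set c" "var l \<in> horn_vars \<C>" for l
    proof -
      have "\<forall>y\<in>set (sel3 \<kappa> x p q). lit_true y l = False"
        using sel3_props(2)[of \<kappa> x p q] less(3)[OF l] p(3)[OF l(1)] q(3)[OF l(1)] l oab by blast
      then show ?thesis
        unfolding w_def using app_unanimous[OF vars[OF c(1) l(1)] len] by blast
    qed
    define g where "g = minor (f (var l0)) \<kappa>"
    have sd: "self_dual k (f (var l0))" and un: "unanimous k (f (var l0))"
      using self_dual_outside[OF vars[OF c(1) l0(1)] l0(2)] unan[OF vars[OF c(1) l0(1)]] by auto
    have neg: "g (\<not> p) (\<not> q) (\<not> r) = (\<not> g p q r)" for p q r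
      unfolding g_def using minor_not[of \<kappa> "f (var l0)"] sd \<kappa> by simp
    have const: "g p p p = p" for p
      unfolding g_def using minor_const[of \<kappa> "f (var l0)"] un \<kappa> by simp
    have g: "g True False False" "g False True False" "g False False True"
      "\<not> g True True False" "\<not> g True False True" "\<not> g False True True"
      using \<kappa> neg[of True False False] neg[of False True False] neg[of False False True]
      unfolding g_def by auto
    have "g False False False = False" "g True True True = True" using const by blast+
    then have w_iff: "lit_true w l \<longleftrightarrow> lit_true x l \<and> l \<noteq> a \<and> l \<noteq> b" if l: "l \<in> set c" for l
    proof (cases "var l \<in> horn_vars \<C>")
      case True
      then show ?thesis using wh less(3) l by blast
    next
      case False
      have "lit_true w l = g (lit_true x l) (lit_true p l) (lit_true q l)"
        unfolding w_def g_def app_sel3[OF vars[OF c(1) l] False \<kappa>(1)]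
        using minor_cong[OF c(1) l l0(1) False l0(2) \<kappa>(1)] by simp
      moreover have "lit_true p l \<longleftrightarrow> l = a" "lit_true q l \<longleftrightarrow> l = b" using p q l by auto
      moreover have "lit_true x a" "lit_true x b" using a b unfolding A_def by auto
      ultimately show ?thesis using g \<open>g False False False = False\<close> \<open>g True True True = True\<close> b(2)
        by (cases "l = a"; cases "l = b"; cases "lit_true x l") auto
    qed
    have eq: "{l\<in>set c. lit_true w l} = A - {a, b}"
      using w_iff unfolding A_def by auto
    have ca: "card A = Suc (Suc (card (A - {a, b})))"
      using fA a b by (metis Diff_insert2 card_Suc_Diff1 finite_Diff insertE insert_Diff)
    have "odd (card {l\<in>set c. lit_true w l})"
      by (rule less(1)[OF _ wD wh]) (use eq ca A_def in auto)
    then show ?thesis using eq ca unfolding A_def by auto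
  qed
qed

end

lemma xor_clause_odd:
  assumes D: "local_possibility_domain n D"
    and C: "\<And>c. c \<in> \<C> \<Longrightarrow> prime_clause D c \<and> distinct c \<and> (\<forall>l\<in>set c. var l < n)"
    and c: "c \<in> \<C>" and l: "l \<in> set c" "var l \<in> xor_vars \<C> (horn_vars \<C>)"
    and x: "x \<in> D" "\<And>l. l \<in> set c \<Longrightarrow> var l \<in> horn_vars \<C> \<Longrightarrow> \<not> lit_true x l"
  shows "odd (length (filter (lit_true x) c))"
proof -
  obtain k f where "aggregator n k D f" "\<forall>j<n. \<not> is_projection k (f j)"
    using D unfolding local_possibility_domain_def by blast
  then interpret lpd n k D f \<C>
    using C by unfold_locales auto
  have "odd (card {l\<in>set c. lit_true x l})"
    using xor_minor[OF l(2)] C odd_parity[OF c _ l(1) xor_vars_disjoint[OF l(2)] _ _ _ _ x] c by blast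
  moreover have "card {l\<in>set c. lit_true x l} = length (filter (lit_true x) c)"
    using C[OF c] distinct_card[of "filter (lit_true x) c"] by simp
  ultimately show ?thesis by simp
qed

section \<open>Running time of programs\<close>

definition run :: "com \<Rightarrow> store \<Rightarrow> nat \<Rightarrow> (store \<Rightarrow> bool) \<Rightarrow> bool" where
  "run c s T Q \<longleftrightarrow> (\<exists>t s'. exec c s t s' \<and> t \<le> T \<and> Q s')"

fun avars :: "com \<Rightarrow> string set" where
  "avars Skip = {}"
| "avars (Assign a i e) = {a}"
| "avars (Seq c1 c2) = avars c1 \<union> avars c2"
| "avars (Cond b c1 c2) = avars c1 \<union> avars c2"
| "avars (While b c) = avars c"

lemma exec_frame: "exec c s t s' \<Longrightarrow> a \<notin> avars c \<Longrightarrow> s' a = s a"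
  by (induction rule: exec.induct) auto

definition same :: "string set \<Rightarrow> store \<Rightarrow> store \<Rightarrow> bool" where
  "same X s s' \<longleftrightarrow> (\<forall>a. a \<notin> X \<longrightarrow> s' a = s a)"

lemma sameD: "same X s s' \<Longrightarrow> a \<notin> X \<Longrightarrow> s' a = s a"
  unfolding same_def by blast

lemma same_refl: "same X s s"
  unfolding same_def by simp

lemma same_trans: "same X s s' \<Longrightarrow> same X s' s'' \<Longrightarrow> same X s s''"
  unfolding same_def by simp

lemma same_mono: "same X s s' \<Longrightarrow> X \<subseteq> Y \<Longrightarrow> same Y s s'"
  unfolding same_def by blast

lemma run_frame:
  assumes "run c s T Q"
  shows "run c s T (\<lambda>s'. Q s' \<and> same (avars c) s s')"
  using assms exec_frame unfolding run_def same_def by blast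

text \<open>Weakening may use that unwritten arrays are unchanged. Hence specifications of programs
  state only what is computed, and everything else is carried over by the frame.\<close>

lemma run_mono:
  assumes "run c s T Q" "T \<le> T'" "\<And>s'. Q s' \<Longrightarrow> same (avars c) s s' \<Longrightarrow> Q' s'"
  shows "run c s T' Q'"
proof -
  from run_frame[OF assms(1)] obtain t s' where e: "exec c s t s'" "t \<le> T" "Q s'" "same (avars c) s s'"
    unfolding run_def by auto
  have "t \<le> T'" using e(2) assms(2) by simp
  with e(1) assms(3)[OF e(3,4)] show ?thesis unfolding run_def by auto
qed

lemma run_Skip: "run Skip s T Q \<longleftrightarrow> 1 \<le> T \<and> Q s"
  unfolding run_def using exec.Skip by (auto elim: exec_SkipE)

lemma run_Assign: "run (Assign a i e) s T Q \<longleftrightarrow>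
    acost i + acost e + 1 \<le> T \<and> Q (s(a := (s a)(aval i s := aval e s)))"
proof -
  have "run (Assign a i e) s T Q" if "acost i + acost e + 1 \<le> T"
    "Q (s(a := (s a)(aval i s := aval e s)))"
    unfolding run_def using exec.Assign that by blast
  then show ?thesis unfolding run_def by (auto elim!: exec_AssignE)
qed

lemma run_Cond: "run (Cond b c1 c2) s T Q \<longleftrightarrow>
    bcost b + 1 \<le> T \<and> (if bval b s then run c1 s (T - (bcost b + 1)) Q
      else run c2 s (T - (bcost b + 1)) Q)"
proof
  assume "run (Cond b c1 c2) s T Q"
  then obtain t s' where e: "exec (Cond b c1 c2) s t s'" "t \<le> T" "Q s'"
    unfolding run_def by auto
  from e(1) consider (1) t0 where "t = bcost b + t0 + 1" "bval b s" "exec c1 s t0 s'"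
    | (2) t0 where "t = bcost b + t0 + 1" "\<not> bval b s" "exec c2 s t0 s'"
    by (elim exec_CondE) auto
  then show "bcost b + 1 \<le> T \<and> (if bval b s then run c1 s (T - (bcost b + 1)) Q
      else run c2 s (T - (bcost b + 1)) Q)"
  proof cases
    case 1
    then have "t0 \<le> T - (bcost b + 1)" "bcost b + 1 \<le> T" using e(2) by auto
    then show ?thesis using 1 e(3) unfolding run_def by auto
  next
    case 2
    then have "t0 \<le> T - (bcost b + 1)" "bcost b + 1 \<le> T" using e(2) by auto
    then show ?thesis using 2 e(3) unfolding run_def by auto
  qed
next
  assume r: "bcost b + 1 \<le> T \<and> (if bval b s then run c1 s (T - (bcost b + 1)) Q
      else run c2 s (T - (bcost b + 1)) Q)"
  show "run (Cond b c1 c2) s T Q"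
  proof (cases "bval b s")
    case True
    with r obtain t s' where e: "exec c1 s t s'" "t \<le> T - (bcost b + 1)" "Q s'"
      unfolding run_def by auto
    have "bcost b + t + 1 \<le> T" using r e(2) by linarith
    then show ?thesis using exec.CondTrue[OF True e(1)] e(3) unfolding run_def by blast
  next
    case False
    with r obtain t s' where e: "exec c2 s t s'" "t \<le> T - (bcost b + 1)" "Q s'"
      unfolding run_def by auto
    have "bcost b + t + 1 \<le> T" using r e(2) by linarith
    then show ?thesis using exec.CondFalse[OF False e(1)] e(3) unfolding run_def by blast
  qed
qed

lemma run_Cond_True: "bval b s \<Longrightarrow> run c1 s T Q \<Longrightarrow> T' = T + (bcost b + 1) \<Longrightarrow> run (Cond b c1 c2) s T' Q"
  unfolding run_Cond by simp

lemma run_Cond_False: "\<not> bval b s \<Longrightarrow> run c2 s T Q \<Longrightarrow> T' = T + (bcost b + 1) \<Longrightarrow> run (Cond b c1 c2) s T' Q"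
  unfolding run_Cond by simp

lemma run_Seq:
  assumes "run c1 s T1 Q1" "\<And>s'. Q1 s' \<Longrightarrow> same (avars c1) s s' \<Longrightarrow> run c2 s' T2 Q"
  shows "run (Seq c1 c2) s (T1 + T2) Q"
proof -
  from run_frame[OF assms(1)] obtain t1 s1 where 1: "exec c1 s t1 s1" "t1 \<le> T1" "Q1 s1"
    "same (avars c1) s s1" unfolding run_def by blast
  from assms(2)[OF 1(3,4)] obtain t2 s2 where "exec c2 s1 t2 s2" "t2 \<le> T2" "Q s2"
    unfolding run_def by blast
  then have "exec (Seq c1 c2) s (t1 + t2) s2" "t1 + t2 \<le> T1 + T2" "Q s2"
    using exec.Seq[OF 1(1)] 1(2) by auto
  then show ?thesis unfolding run_def by blast
qed

lemma run_Seq_Assign: "run (Seq (Assign a i e) c) s T Q \<longleftrightarrow>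
    acost i + acost e + 1 \<le> T \<and>
    run c (s(a := (s a)(aval i s := aval e s))) (T - (acost i + acost e + 1)) Q"
proof
  assume "run (Seq (Assign a i e) c) s T Q"
  then show "acost i + acost e + 1 \<le> T \<and>
    run c (s(a := (s a)(aval i s := aval e s))) (T - (acost i + acost e + 1)) Q"
  proof -
    assume "run (Seq (Assign a i e) c) s T Q"
    then obtain t1 s1 t2 s2 where e: "exec (Assign a i e) s t1 s1" "exec c s1 t2 s2"
      "t1 + t2 \<le> T" "Q s2"
      unfolding run_def by (auto elim!: exec_SeqE)
    from e(1) have 1: "t1 = acost i + acost e + 1" "s1 = s(a := (s a)(aval i s := aval e s))"
      by (auto elim: exec_AssignE)
    have "t2 \<le> T - (acost i + acost e + 1)" "acost i + acost e + 1 \<le> T" using e(3) 1 by auto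
    then show ?thesis using e(2,4) 1 unfolding run_def by blast
  qed
next
  assume r: "acost i + acost e + 1 \<le> T \<and>
    run c (s(a := (s a)(aval i s := aval e s))) (T - (acost i + acost e + 1)) Q"
  then obtain t s' where e: "exec c (s(a := (s a)(aval i s := aval e s))) t s'"
    "t \<le> T - (acost i + acost e + 1)" "Q s'" unfolding run_def by blast
  have "acost i + acost e + 1 + t \<le> T" using r e(2) by linarith
  then show "run (Seq (Assign a i e) c) s T Q"
    using exec.Seq[OF exec.Assign e(1)] e(3) unfolding run_def by blast
qed

lemmas run_simps = run_Skip run_Assign run_Cond run_Seq_Assign

lemma run_Seq_AssignI:
  assumes "acost i + acost e + 1 \<le> T1" "run c (s(a := (s a)(aval i s := aval e s))) T2 Q"
  shows "run (Seq (Assign a i e) c) s (T1 + T2) Q"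
proof -
  have "run (Assign a i e) s T1 (\<lambda>s'. s' = s(a := (s a)(aval i s := aval e s)))"
    using assms(1) by (simp add: run_Assign)
  from run_Seq[OF this] assms(2) show ?thesis by blast
qed

text \<open>The invariant carries the potential that pays for the remaining iterations, so amortised
  bounds are obtained directly.\<close>

lemma run_While:
  assumes "I \<phi> s"
    and step: "\<And>\<phi> s'. I \<phi> s' \<Longrightarrow> bval b s' \<Longrightarrow> same (avars c) s s' \<Longrightarrow>
      \<exists>T. run c s' T (\<lambda>s''. \<exists>\<phi>'. I \<phi>' s'' \<and> T + bcost b + 1 + \<phi>' \<le> \<phi>)"
  shows "run (While b c) s (\<phi> + bcost b + 1) (\<lambda>s'. \<exists>\<phi>'. I \<phi>' s' \<and> \<not> bval b s')"
proof -
  have "I \<phi> s' \<Longrightarrow> same (avars c) s s' \<Longrightarrow>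
    run (While b c) s' (\<phi> + bcost b + 1) (\<lambda>s'. \<exists>\<phi>'. I \<phi>' s' \<and> \<not> bval b s')" for s'
  proof (induction \<phi> arbitrary: s' rule: less_induct)
    case (less \<phi>)
    show ?case
    proof (cases "bval b s'")
      case False
      from exec.WhileFalse[OF False] show ?thesis
        using less(2) False unfolding run_def by fastforce
    next
      case True
      from step[OF less(2) True less(3)] obtain T where
        "run c s' T (\<lambda>s''. \<exists>\<phi>'. I \<phi>' s'' \<and> T + bcost b + 1 + \<phi>' \<le> \<phi>)" by blast
      from run_frame[OF this] obtain t1 s1 \<phi>1 where 1: "exec c s' t1 s1" "t1 \<le> T" "I \<phi>1 s1"
        "T + bcost b + 1 + \<phi>1 \<le> \<phi>" "same (avars c) s' s1" unfolding run_def by blast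
      have "run (While b c) s1 (\<phi>1 + bcost b + 1) (\<lambda>s'. \<exists>\<phi>'. I \<phi>' s' \<and> \<not> bval b s')"
        by (rule less(1)) (use 1 same_trans[OF less(3) 1(5)] in auto)
      then obtain t2 s2 \<phi>2 where 2: "exec (While b c) s1 t2 s2" "t2 \<le> \<phi>1 + bcost b + 1"
        "I \<phi>2 s2" "\<not> bval b s2" unfolding run_def by blast
      have "bcost b + t1 + t2 + 1 \<le> \<phi> + bcost b + 1" using 1 2 by simp
      then show ?thesis using exec.WhileTrue[OF True 1(1) 2(1)] 2(3,4) unfolding run_def by blast
    qed
  qed
  from this[OF assms(1) same_refl] show ?thesis .
qed

section \<open>Counting loops\<close>

abbreviation V :: "string \<Rightarrow> aexp" where "V a \<equiv> Cell a (Num 0)"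

abbreviation set_var :: "string \<Rightarrow> aexp \<Rightarrow> com" (infix ":=\<^sub>v" 61) where
  "a :=\<^sub>v e \<equiv> Assign a (Num 0) e"

abbreviation seq (infixr ";;" 60) where "c1 ;; c2 \<equiv> Seq c1 c2"

definition For :: "string \<Rightarrow> aexp \<Rightarrow> aexp \<Rightarrow> com \<Rightarrow> com" where
  "For v a b c = (v :=\<^sub>v a ;; While (BLess (V v) b) (c ;; v :=\<^sub>v Add (V v) (Num 1)))"

lemma avars_For [simp]: "avars (For v a b c) = insert v (avars c)"
  unfolding For_def by auto

fun reads :: "aexp \<Rightarrow> string set" where
  "reads (Num k) = {}"
| "reads (Cell a e) = insert a (reads e)"
| "reads (Add e1 e2) = reads e1 \<union> reads e2"
| "reads (Sub e1 e2) = reads e1 \<union> reads e2"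

lemma aval_same: "same X s s' \<Longrightarrow> reads e \<inter> X = {} \<Longrightarrow> aval e s' = aval e s"
  by (induction e) (auto simp: same_def Int_Un_distrib2)

text \<open>The bound \<open>b\<close> is evaluated again in every round, so the loop must not write
  what \<open>b\<close> reads. The invariant gets the round number as a parameter and must ignore
  the counter array, so that it survives the increment.\<close>

lemma run_For:
  assumes fresh: "v \<notin> avars c" "reads b \<inter> insert v (avars c) = {}"
    and bnd: "aval b s = aval a s + N"
    and I0: "I 0 s"
    and inv: "\<And>k s x. I k (s(v := x)) = I k s"
    and step: "\<And>k s'. k < N \<Longrightarrow> s' v 0 = aval a s + k \<Longrightarrow> same (insert v (avars c)) s s' \<Longrightarrow> I k s'
      \<Longrightarrow> run c s' T (I (Suc k))"
  shows "run (For v a b c) s (N * (T + acost b + 10) + acost a + acost b + 6) (I N)"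
proof -
  define A where "A = aval a s"
  define J where "J s' = (\<exists>k\<le>N. s' v 0 = A + k \<and> I k s' \<and> same (insert v (avars c)) s s')" for s'
  \<comment> \<open>A round costs \<open>T\<close> for the body, 6 for the increment and
    \<open>acost b + 4\<close> for the test.\<close>
  define \<Phi> where "\<Phi> s' = (A + N - s' v 0) * (T + acost b + 10)" for s' :: store
  have "run (While (BLess (V v) b) (c ;; v :=\<^sub>v Add (V v) (Num 1))) (s(v := (s v)(0 := A)))
     (\<Phi> (s(v := (s v)(0 := A))) + bcost (BLess (V v) b) + 1)
     (\<lambda>s'. \<exists>\<phi>. (J s' \<and> \<phi> = \<Phi> s') \<and> \<not> bval (BLess (V v) b) s')"
  proof (rule run_While[where I = "\<lambda>\<phi> s'. J s' \<and> \<phi> = \<Phi> s'"])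
    have "J (s(v := (s v)(0 := A)))"
      unfolding J_def by (rule exI[of _ 0]) (simp add: I0 inv same_def)
    then show "J (s(v := (s v)(0 := A))) \<and> \<Phi> (s(v := (s v)(0 := A))) = \<Phi> (s(v := (s v)(0 := A)))"
      by simp
  next
    fix \<phi> s' assume "J s' \<and> \<phi> = \<Phi> s'" and b: "bval (BLess (V v) b) s'"
    then obtain k where k: "k \<le> N" "s' v 0 = A + k" "I k s'" "same (insert v (avars c)) s s'"
      and \<phi>: "\<phi> = \<Phi> s'"
      unfolding J_def by blast
    have "aval b s' = A + N" using aval_same[OF k(4) fresh(2)] bnd unfolding A_def by simp
    then have kN: "k < N" using b k(2) by simp
    have r: "run c s' T (\<lambda>s''. run (v :=\<^sub>v Add (V v) (Num 1)) s'' 6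
      (\<lambda>s''. J s'' \<and> s'' v 0 = A + Suc k))"
    proof (rule run_mono[OF step[OF kN _ k(4,3)]])
      show "s' v 0 = aval a s + k" using k(2) A_def by simp
      fix s'' assume I: "I (Suc k) s''" and sm: "same (avars c) s' s''"
      have v: "s'' v 0 = A + k" using sameD[OF sm fresh(1)] k(2) by simp
      have "same (insert v (avars c)) s s''"
        using same_trans[OF k(4) same_mono[OF sm]] by blast
      then show "run (v :=\<^sub>v Add (V v) (Num 1)) s'' 6 (\<lambda>s''. J s'' \<and> s'' v 0 = A + Suc k)"
        unfolding run_Assign J_def using v kN I
        by (auto simp: inv same_def intro!: exI[of _ "Suc k"])
    qed simp
    have "run (c ;; v :=\<^sub>v Add (V v) (Num 1)) s' (T + 6) (\<lambda>s''. J s'' \<and> s'' v 0 = A + Suc k)"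
      by (rule run_Seq[OF r])
    then have "run (c ;; v :=\<^sub>v Add (V v) (Num 1)) s' (T + 6) (\<lambda>s''. \<exists>\<phi>'. (J s'' \<and> \<phi>' = \<Phi> s'') \<and>
       T + 6 + bcost (BLess (V v) b) + 1 + \<phi>' \<le> \<phi>)"
    proof (rule run_mono)
      fix s'' assume J: "J s'' \<and> s'' v 0 = A + Suc k"
      have "A + N - (A + k) = Suc (A + N - (A + Suc k))" using kN by simp
      then have "\<Phi> s' = (T + acost b + 10) + \<Phi> s''" unfolding \<Phi>_def using J k(2) by simp
      then show "\<exists>\<phi>'. (J s'' \<and> \<phi>' = \<Phi> s'') \<and> T + 6 + bcost (BLess (V v) b) + 1 + \<phi>' \<le> \<phi>"
        using J \<phi> by simp
    qed simp
    then show "\<exists>T. run (c ;; v :=\<^sub>v Add (V v) (Num 1)) s' T (\<lambda>s''.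
       \<exists>\<phi>'. (J s'' \<and> \<phi>' = \<Phi> s'') \<and> T + bcost (BLess (V v) b) + 1 + \<phi>' \<le> \<phi>)" by blast
  qed
  then have w: "run (While (BLess (V v) b) (c ;; v :=\<^sub>v Add (V v) (Num 1))) (s(v := (s v)(0 := A)))
     (N * (T + acost b + 10) + acost b + 4) (I N)"
  proof (rule run_mono)
    fix s' assume "\<exists>\<phi>. (J s' \<and> \<phi> = \<Phi> s') \<and> \<not> bval (BLess (V v) b) s'"
    then obtain k where k: "k \<le> N" "s' v 0 = A + k" "I k s'" "same (insert v (avars c)) s s'"
      and nb: "\<not> bval (BLess (V v) b) s'" unfolding J_def by blast
    have "aval b s' = A + N" using aval_same[OF k(4) fresh(2)] bnd unfolding A_def by simp
    with nb k have "k = N" by simp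
    with k show "I N s'" by simp
  qed (simp add: \<Phi>_def)
  show ?thesis
    unfolding For_def run_Seq_Assign using run_mono[OF w] A_def by simp
qed

text \<open>Product form for nested loops: each level multiplies the size bound by \<open>N'\<close>
  and only enlarges the constant. The loop overhead is absorbed because \<open>N'\<close> and
  \<open>X\<close> are at least 1.\<close>

lemma run_For_le:
  assumes "v \<notin> avars c" "reads b \<inter> insert v (avars c) = {}"
    and "aval b s = aval a s + N"
    and "I 0 s"
    and "\<And>k s x. I k (s(v := x)) = I k s"
    and "\<And>k s'. k < N \<Longrightarrow> s' v 0 = aval a s + k \<Longrightarrow> same (insert v (avars c)) s s' \<Longrightarrow> I k s'
      \<Longrightarrow> run c s' (K * X) (I (Suc k))"
    and "\<And>s'. I N s' \<Longrightarrow> same (insert v (avars c)) s s' \<Longrightarrow> Q s'"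
    and "N \<le> N'" "1 \<le> N'" "1 \<le> X" "K + 2 * acost b + acost a + 16 \<le> K'"
  shows "run (For v a b c) s (K' * (N' * X)) Q"
proof (rule run_mono[OF run_For[where N = N and T = "K * X" and I = I]])
  have NX: "1 \<le> N' * X" "N \<le> N' * X" "N * X \<le> N' * X"
    using mult_le_mono[OF assms(9,10)] mult_le_mono[OF assms(8,10)] mult_le_mono1[OF assms(8), of X]
    by simp_all
  have "N * (K * X + acost b + 10) + acost a + acost b + 6
      = K * (N * X) + (acost b + 10) * N + (acost a + acost b + 6) * 1"
    by (simp add: algebra_simps)
  also have "\<dots> \<le> K * (N' * X) + (acost b + 10) * (N' * X) + (acost a + acost b + 6) * (N' * X)"
    by (intro add_mono mult_le_mono2 NX)
  also have "\<dots> = (K + 2 * acost b + acost a + 16) * (N' * X)" by (simp add: algebra_simps)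
  also have "\<dots> \<le> K' * (N' * X)" using assms(11) by (rule mult_le_mono1)
  finally show "N * (K * X + acost b + 10) + acost a + acost b + 6 \<le> K' * (N' * X)" .
qed (use assms in \<open>simp_all\<close>)

section \<open>Prime clauses\<close>

definition lit :: "bool list \<Rightarrow> nat \<Rightarrow> literal" where
  "lit z t = (if z ! t then Neg t else Pos t)"

text \<open>\<open>lit z t\<close> is the literal at position \<open>t\<close> that \<open>z\<close>
  falsifies. A clause of such literals is violated exactly by the vectors that agree with
  \<open>z\<close> on its positions.\<close>

lemma lit_simps [simp]: "var (lit z t) = t" "lit_true x (lit z t) \<longleftrightarrow> x ! t \<noteq> z ! t"
  "encode_lit (lit z t) = 2 * t + of_bool (z ! t)"
  unfolding lit_def by auto

definition count_true :: "literal list \<Rightarrow> bool list \<Rightarrow> nat" where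
  "count_true c x = length (filter (lit_true x) c)"

lemma count_true_simps [simp]:
  "count_true [] x = 0"
  "count_true (l # c) x = of_bool (lit_true x l) + count_true c x"
  "count_true (c @ c') x = count_true c x + count_true c' x"
  unfolding count_true_def by auto

lemma count_true_pos: "0 < count_true c x \<longleftrightarrow> (\<exists>l\<in>set c. lit_true x l)"
  unfolding count_true_def by (auto simp: filter_empty_conv)

text \<open>The clause violated exactly by the vectors that agree with \<open>x\<close> before position \<open>j\<close> and
  differ from it there.\<close>

definition flip :: "bool list \<Rightarrow> nat \<Rightarrow> bool list" where
  "flip x j = x[j := \<not> x ! j]"

definition prefix_clause :: "bool list \<Rightarrow> nat \<Rightarrow> literal list" where
  "prefix_clause x j = map (lit (flip x j)) [0..<Suc j]"

text \<open>After \<open>t\<close> rounds the current clause consists of the kept literals and the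
  unexamined rest \<open>drop t c\<close>. The literal \<open>c ! t\<close> is dropped if no vector
  of \<open>xs\<close> relies on it alone in this current clause.\<close>

fun shrink :: "bool list list \<Rightarrow> literal list \<Rightarrow> nat \<Rightarrow> literal list" where
  "shrink xs c 0 = []"
| "shrink xs c (Suc t) =
    (if \<forall>x\<in>set xs. lit_true x (c ! t) \<longrightarrow> 2 \<le> count_true (shrink xs c t @ drop t c) x
     then shrink xs c t else shrink xs c t @ [c ! t])"

definition clauses_at :: "bool list list \<Rightarrow> bool list \<Rightarrow> nat \<Rightarrow> literal list list" where
  "clauses_at xs x j = (let c = prefix_clause x j in
     if \<forall>y\<in>set xs. 0 < count_true c y then [shrink xs c (length c)] else [])"

definition clauses_row :: "bool list list \<Rightarrow> bool list \<Rightarrow> nat \<Rightarrow> literal list list" where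
  "clauses_row xs x j = concat (map (clauses_at xs x) [0..<j])"

text \<open>Indexed by the number of finished rows, as required of the invariant of the outer loop
  in \<open>find_clauses\<close>.\<close>

definition clauses_upto :: "nat \<Rightarrow> bool list list \<Rightarrow> nat \<Rightarrow> literal list list" where
  "clauses_upto n xs i = concat (map (\<lambda>x. clauses_row xs x n) (take i xs))"

abbreviation prime_cnf :: "nat \<Rightarrow> bool list list \<Rightarrow> literal list list" where
  "prime_cnf n xs \<equiv> clauses_upto n xs (length xs)"

text \<open>A kept literal has a vector satisfying nothing else in the current clause. Later rounds
  preserve this: a literal is dropped only if every vector satisfying it has a second true literal,
  so the dropped literal was false in that vector.\<close>

lemma shrink_prime:
  assumes "\<forall>x\<in>set xs. 0 < count_true c x" "distinct (map var c)" "t \<le> length c"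
  shows "(\<forall>x\<in>set xs. 0 < count_true (shrink xs c t @ drop t c) x) \<and>
    (\<forall>l\<in>set (shrink xs c t). \<exists>x\<in>set xs. lit_true x l \<and>
       count_true (shrink xs c t @ drop t c) x = 1) \<and>
    set (shrink xs c t) \<subseteq> set (take t c) \<and> distinct (map var (shrink xs c t))"
  using assms(3)
proof (induction t)
  case 0
  then show ?case using assms(1) by simp
next
  case (Suc t)
  then have t: "t < length c" by simp
  have d: "drop t c = c ! t # drop (Suc t) c" using t by (simp add: Cons_nth_drop_Suc)
  define ks where "ks = shrink xs c t"
  have IH: "\<forall>x\<in>set xs. 0 < count_true (ks @ drop t c) x"
    "\<forall>l\<in>set ks. \<exists>x\<in>set xs. lit_true x l \<and> count_true (ks @ drop t c) x = 1"
    "set ks \<subseteq> set (take t c)" "distinct (map var ks)"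
    using Suc unfolding ks_def by auto
  have tk: "take (Suc t) c = take t c @ [c ! t]" using t by (simp add: take_Suc_conv_app_nth)
  show ?case
  proof (cases "\<forall>x\<in>set xs. lit_true x (c ! t) \<longrightarrow> 2 \<le> count_true (ks @ drop t c) x")
    case True
    then have sh: "shrink xs c (Suc t) = ks" unfolding ks_def by simp
    have "\<forall>x\<in>set xs. 0 < count_true (ks @ drop (Suc t) c) x"
    proof
      fix x assume x: "x \<in> set xs"
      show "0 < count_true (ks @ drop (Suc t) c) x"
      proof (cases "lit_true x (c ! t)")
        case t: True
        then have "2 \<le> count_true (ks @ drop t c) x" using True x by blast
        then show ?thesis using t unfolding d by (simp, linarith)
      next
        case False
        then show ?thesis using IH(1) x unfolding d by fastforce
      qed
    qed
    moreover have "\<exists>x\<in>set xs. lit_true x l \<and> count_true (ks @ drop (Suc t) c) x = 1"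
      if l: "l \<in> set ks" for l
    proof -
      obtain x where x: "x \<in> set xs" "lit_true x l" "count_true (ks @ drop t c) x = 1"
        using IH(2) l by blast
      then have "\<not> lit_true x (c ! t)" using True by fastforce
      then show ?thesis using x unfolding d by auto
    qed
    ultimately show ?thesis unfolding sh tk using IH(3,4) by auto
  next
    case False
    then have sh: "shrink xs c (Suc t) = ks @ [c ! t]" unfolding ks_def by auto
    have e: "(ks @ [c ! t]) @ drop (Suc t) c = ks @ drop t c" unfolding d by simp
    obtain x where x: "x \<in> set xs" "lit_true x (c ! t)" "count_true (ks @ drop t c) x < 2"
      using False by auto
    then have "count_true (ks @ drop t c) x = 1" using IH(1) by fastforce
    moreover have "var (c ! t) \<notin> var ` set ks"
    proof
      assume "var (c ! t) \<in> var ` set ks"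
      then have "var (c ! t) \<in> set (map var (take t c))" using IH(3) by auto
      moreover have "distinct (map var (take t c) @ [var (c ! t)])"
        using distinct_take[OF assms(2), of "Suc t"] unfolding take_map[symmetric] tk
        by (simp add: take_map tk)
      ultimately show False by simp
    qed
    ultimately show ?thesis unfolding sh e tk using IH x by auto
  qed
qed

lemma count_true_one:
  assumes "count_true c x = 1" "distinct c" "l \<in> set c" "lit_true x l" "l' \<in> set c" "lit_true x l'"
  shows "l' = l"
proof (rule ccontr)
  assume "l' \<noteq> l"
  have "card {l\<in>set c. lit_true x l} = 1"
    using assms(1) distinct_card[of "filter (lit_true x) c"] assms(2) unfolding count_true_def by simp
  then obtain a where a: "{l\<in>set c. lit_true x l} = {a}" by (rule card_1_singletonE)
  have "l \<in> {l\<in>set c. lit_true x l}" "l' \<in> {l\<in>set c. lit_true x l}" using assms(3-6) by auto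
  then show False using \<open>l' \<noteq> l\<close> unfolding a by simp
qed

lemma prefix_clause_props:
  "length (prefix_clause x j) = Suc j"
  "map var (prefix_clause x j) = [0..<Suc j]"
  "t \<le> j \<Longrightarrow> prefix_clause x j ! t = lit (flip x j) t"
  unfolding prefix_clause_def by (auto simp: comp_def simp del: upt_Suc)

lemma clauses_at_prime:
  assumes "c \<in> set (clauses_at xs x j)" "j < n"
  shows "prime_clause (set xs) c" "distinct (map var c)" "\<forall>l\<in>set c. var l < n"
proof -
  let ?p = "prefix_clause x j"
  have p: "\<forall>y\<in>set xs. 0 < count_true ?p y" and c: "c = shrink xs ?p (length ?p)"
    using assms(1) unfolding clauses_at_def Let_def by (auto split: if_splits)
  have d: "distinct (map var ?p)" using prefix_clause_props by simp
  note s = shrink_prime[OF p d order_refl, folded c]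
  show dc: "distinct (map var c)" using s by simp
  have "set c \<subseteq> set ?p" using s by simp
  then have "var ` set c \<subseteq> set (map var ?p)" by auto
  then show "\<forall>l\<in>set c. var l < n" unfolding prefix_clause_props(2) using assms(2) by auto
  show "prime_clause (set xs) c"
    unfolding prime_clause_def
  proof (intro conjI ballI)
    fix y assume "y \<in> set xs"
    then show "\<exists>l\<in>set c. lit_true y l" using s count_true_pos by auto
  next
    fix l assume l: "l \<in> set c"
    then obtain y where y: "y \<in> set xs" "lit_true y l" "count_true c y = 1" using s by auto
    have "distinct c" using dc by (simp add: distinct_map)
    then have "\<forall>l'\<in>set c. lit_true y l' \<longleftrightarrow> l' = l"
      using count_true_one[OF y(3) _ l y(2)] y(2) by blast
    then show "\<exists>x\<in>set xs. \<forall>l'\<in>set c. lit_true x l' \<longleftrightarrow> l' = l" using y(1) by blast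
  qed
qed

lemma prime_cnf_prime:
  assumes "c \<in> set (prime_cnf n xs)"
  shows "prime_clause (set xs) c" "distinct (map var c)" "\<forall>l\<in>set c. var l < n"
proof -
  obtain x j where "c \<in> set (clauses_at xs x j)" "j < n"
    using assms unfolding clauses_upto_def clauses_row_def by auto
  then show "prime_clause (set xs) c" "distinct (map var c)" "\<forall>l\<in>set c. var l < n"
    using clauses_at_prime by blast+
qed

lemma length_clauses_row: "length (clauses_row xs x j) \<le> j"
  unfolding clauses_row_def by (induction j) (auto simp: clauses_at_def Let_def)

lemma length_clauses_upto: "i \<le> length xs \<Longrightarrow> length (clauses_upto n xs i) \<le> i * n"
proof (induction i)
  case (Suc i)
  then show ?case using length_clauses_row[of xs "xs ! i" n]
    unfolding clauses_upto_def by (simp add: take_Suc_conv_app_nth)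
qed (simp add: clauses_upto_def)

text \<open>For \<open>z\<close> outside the domain, take the first position at which the prefix of
  \<open>z\<close> is no longer a prefix of a listed vector. A listed vector that agrees with
  \<open>z\<close> up to there yields a prefix clause that is an implicate and that \<open>z\<close>
  violates; shrinking only removes literals, so \<open>z\<close> violates the prime clause as
  well.\<close>

lemma prime_cnf_sat:
  assumes "xs \<noteq> []" "\<forall>x\<in>set xs. length x = n"
  shows "{x. length x = n \<and> (\<forall>c\<in>set (prime_cnf n xs). \<exists>l\<in>set c. lit_true x l)} = set xs"
proof (intro equalityI subsetI)
  fix x assume "x \<in> set xs"
  then show "x \<in> {x. length x = n \<and> (\<forall>c\<in>set (prime_cnf n xs). \<exists>l\<in>set c. lit_true x l)}"
    using assms(2) prime_cnf_prime(1)[of _ n xs] unfolding prime_clause_def by auto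
next
  fix z assume "z \<in> {x. length x = n \<and> (\<forall>c\<in>set (prime_cnf n xs). \<exists>l\<in>set c. lit_true x l)}"
  then have z: "length z = n" "\<And>c. c \<in> set (prime_cnf n xs) \<Longrightarrow> \<exists>l\<in>set c. lit_true z l" by auto
  show "z \<in> set xs"
  proof (rule ccontr)
    assume nz: "z \<notin> set xs"
    define agree where "agree j \<longleftrightarrow> (\<exists>x\<in>set xs. \<forall>t<j. x ! t = z ! t)" for j
    have "agree 0" using assms(1) unfolding agree_def by (simp add: ex_in_conv)
    moreover have "\<not> agree n"
    proof
      assume "agree n"
      then obtain x where x: "x \<in> set xs" "\<forall>t<n. x ! t = z ! t" unfolding agree_def by blast
      then have "x = z" using z(1) assms(2) by (auto intro: nth_equalityI)
      then show False using x nz by simp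
    qed
    \<comment> \<open>The prefix of length \<open>j\<close> occurs in the domain, the one of length
      \<open>Suc j\<close> does not.\<close>
    ultimately obtain j where j: "j < n" "agree j" "\<not> agree (Suc j)"
      by (metis dec_induct le0)
    obtain x where x: "x \<in> set xs" "\<forall>t<j. x ! t = z ! t" using j unfolding agree_def by blast
    have xj: "x ! j \<noteq> z ! j"
      using j(3) x unfolding agree_def by (metis less_Suc_eq)
    have fl: "flip x j ! t = z ! t" if "t \<le> j" for t
      using that x xj j assms(2) unfolding flip_def by (cases "t = j") auto
    let ?p = "prefix_clause x j"
    have p: "lit_true y l \<longleftrightarrow> y ! var l \<noteq> z ! var l" "var l \<le> j" if "l \<in> set ?p" for l y
    proof -
      have "l \<in> lit (flip x j) ` {..j}"
        using that unfolding prefix_clause_def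
        by (simp del: upt_Suc add: atLeast0LessThan lessThan_Suc_atMost)
      then obtain t where "t \<le> j" "l = lit (flip x j) t" by auto
      then show "lit_true y l \<longleftrightarrow> y ! var l \<noteq> z ! var l" "var l \<le> j" using fl by auto
    qed
    have impl: "\<forall>y\<in>set xs. 0 < count_true ?p y"
    proof
      fix y assume "y \<in> set xs"
      then obtain t where t: "t \<le> j" "y ! t \<noteq> z ! t"
        using j(3) unfolding agree_def by (auto simp: less_Suc_eq_le)
      then have "lit (flip x j) t \<in> set ?p"
        unfolding prefix_clause_def by (auto simp del: upt_Suc)
      then show "0 < count_true ?p y" using t fl unfolding count_true_pos by fastforce
    qed
    define c where "c = shrink xs ?p (length ?p)"
    have "c \<in> set (clauses_at xs x j)" using impl unfolding clauses_at_def c_def Let_def by simp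
    then have "c \<in> set (prime_cnf n xs)"
      unfolding clauses_upto_def clauses_row_def using x(1) j(1)
      by (auto intro!: bexI[of _ x] bexI[of _ j])
    then obtain l where l: "l \<in> set c" "lit_true z l" using z(2) by blast
    have "set c \<subseteq> set ?p"
      using shrink_prime[OF impl _ order_refl, folded c_def] by (simp add: prefix_clause_props(2))
    then show False using p(1)[of l z] l fl p(2)[of l] by blast
  qed
qed

section \<open>Computing the prime clauses\<close>

definition arr :: "(nat \<Rightarrow> nat) \<Rightarrow> nat list \<Rightarrow> bool" where
  "arr f ys \<longleftrightarrow> (\<forall>q<length ys. f q = ys ! q)"

lemma arr_Nil [simp]: "arr f []"
  unfolding arr_def by simp

lemma arr_append: "arr f ys \<Longrightarrow> q = length ys \<Longrightarrow> arr (f(q := v)) (ys @ [v])"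
  unfolding arr_def by (auto simp: nth_append less_Suc_eq)

text \<open>The start of row \<open>y\<close> is read from the table \<open>row\<close>, because the
  machine cannot multiply \<open>y\<close> by \<open>n\<close>.\<close>

definition rows :: "nat \<Rightarrow> bool list list \<Rightarrow> store \<Rightarrow> bool" where
  "rows n xs s \<longleftrightarrow> s ''n'' 0 = n \<and> s ''m'' 0 = length xs \<and>
     (\<forall>y<length xs. \<forall>t<n. s ''D'' (s ''row'' y + t) = of_bool (xs ! y ! t))"

lemma rows_same:
  assumes sm: "same X s s'" and X: "{''n'', ''m'', ''D'', ''row''} \<inter> X = {}"
  shows "rows n xs s' = rows n xs s"
  using X unfolding rows_def by (simp add: sameD[OF sm])

text \<open>There is one entry more than there are clauses, so that the end of a clause is always
  the start of the next entry.\<close>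

definition offsets :: "literal list list \<Rightarrow> nat list" where
  "offsets cs = map (\<lambda>c. length (concat (take c cs))) [0..<Suc (length cs)]"

text \<open>The inverse of \<open>offsets\<close>: it leads from a position in the concatenated
  clauses back to the index of its clause in constant time.\<close>

definition owners :: "literal list list \<Rightarrow> nat list" where
  "owners cs = concat (map (\<lambda>(c, i). replicate (length c) i) (zip cs [0..<length cs]))"

text \<open>The clauses \<open>cs\<close> are stored one after the other; \<open>ks\<close> is the part of the next clause that
  has been written already.\<close>

definition stored :: "literal list list \<Rightarrow> literal list \<Rightarrow> store \<Rightarrow> bool" where
  "stored cs ks s \<longleftrightarrow> s ''count'' 0 = length cs \<and> s ''size'' 0 = length (concat cs @ ks) \<and>
     arr (s ''start'') (offsets cs) \<and> arr (s ''lits'') (map encode_lit (concat cs @ ks)) \<and>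
     arr (s ''owner'') (owners cs @ replicate (length ks) (length cs))"

lemma offsets_append: "offsets (cs @ [c]) = offsets cs @ [length (concat cs @ c)]"
  unfolding offsets_def by simp

lemma owners_append: "owners (cs @ [c]) = owners cs @ replicate (length c) (length cs)"
  unfolding owners_def by simp

lemma length_owners: "length (owners cs) = length (concat cs)"
proof (induction cs rule: rev_induct)
  case Nil
  then show ?case unfolding owners_def by simp
next
  case (snoc c cs)
  then show ?case unfolding owners_append by simp
qed

lemma stored_same:
  assumes sm: "same X s s'" and X: "{''count'', ''size'', ''start'', ''lits'', ''owner''} \<inter> X = {}"
  shows "stored cs ks s' = stored cs ks s"
  using X unfolding stored_def by (simp add: sameD[OF sm])

lemma stored_literal:
  assumes "stored cs ks s"
  shows "stored cs (ks @ [l]) (s(''lits'' := (s ''lits'')(s ''size'' 0 := encode_lit l),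
     ''owner'' := (s ''owner'')(s ''size'' 0 := s ''count'' 0),
     ''size'' := (s ''size'')(0 := Suc (s ''size'' 0))))"
proof -
  have "arr ((s ''lits'')(s ''size'' 0 := encode_lit l)) (map encode_lit (concat cs @ ks) @ [encode_lit l])"
    by (rule arr_append) (use assms in \<open>auto simp: stored_def\<close>)
  moreover have "arr ((s ''owner'')(s ''size'' 0 := s ''count'' 0))
    ((owners cs @ replicate (length ks) (length cs)) @ [s ''count'' 0])"
    by (rule arr_append) (use assms in \<open>auto simp: stored_def length_owners\<close>)
  ultimately show ?thesis
    using assms unfolding stored_def by (simp add: replicate_append_same)
qed

lemma stored_clause:
  assumes "stored cs ks s"
  shows "stored (cs @ [ks]) [] (s(''count'' := (s ''count'')(0 := Suc (s ''count'' 0)),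
     ''start'' := (s ''start'')(Suc (s ''count'' 0) := s ''size'' 0)))"
proof -
  have "arr ((s ''start'')(Suc (s ''count'' 0) := s ''size'' 0)) (offsets cs @ [s ''size'' 0])"
    by (rule arr_append) (use assms in \<open>auto simp: stored_def offsets_def\<close>)
  then show ?thesis
    using assms unfolding stored_def by (simp add: offsets_append owners_append)
qed

abbreviation bit :: "string \<Rightarrow> string \<Rightarrow> aexp" where
  "bit y t \<equiv> Cell ''D'' (Add (Cell ''row'' (V y)) (V t))"

section \<open>Programs that build and shrink prefix clauses\<close>

definition flip_row :: com where
  "flip_row = (For ''t'' (Num 0) (V ''n'') (Assign ''z'' (V ''t'') (bit ''i'' ''t'')) ;;
     Assign ''z'' (V ''j'') (Sub (Num 1) (Cell ''z'' (V ''j''))))"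

definition count_row :: com where
  "count_row = For ''t'' (Num 0) (Add (V ''j'') (Num 1))
     (Cond (BEq (bit ''y'' ''t'') (Cell ''z'' (V ''t''))) Skip
       (Assign ''k'' (V ''y'') (Add (Cell ''k'' (V ''y'')) (Num 1))))"

text \<open>The array \<open>k\<close> holds for each row the number of true literals of the current
  clause. Once it is filled, testing or dropping a literal takes a single pass over the rows,
  instead of evaluating the clause anew.\<close>

definition count_rows :: com where
  "count_rows = For ''y'' (Num 0) (V ''m'')
     (Assign ''k'' (V ''y'') (Num 0) ;; count_row ;;
      Cond (BEq (Cell ''k'' (V ''y'')) (Num 0)) (''ok'' :=\<^sub>v Num 0) Skip)"

definition test_literal :: com where
  "test_literal = For ''y'' (Num 0) (V ''m'')
     (Cond (BAnd (BNot (BEq (bit ''y'' ''t'') (Cell ''z'' (V ''t'')))) (BLess (Cell ''k'' (V ''y'')) (Num 2)))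
       (''g'' :=\<^sub>v Num 0) Skip)"

definition drop_literal :: com where
  "drop_literal = For ''y'' (Num 0) (V ''m'')
     (Cond (BEq (bit ''y'' ''t'') (Cell ''z'' (V ''t''))) Skip
       (Assign ''k'' (V ''y'') (Sub (Cell ''k'' (V ''y'')) (Num 1))))"

definition keep_literal :: com where
  "keep_literal = (Assign ''lits'' (V ''size'') (Add (Add (V ''t'') (V ''t'')) (Cell ''z'' (V ''t''))) ;;
     Assign ''owner'' (V ''size'') (V ''count'') ;; ''size'' :=\<^sub>v Add (V ''size'') (Num 1))"

definition shrink_clause :: com where
  "shrink_clause = For ''t'' (Num 0) (Add (V ''j'') (Num 1))
     (''g'' :=\<^sub>v Num 1 ;; test_literal ;; Cond (BEq (V ''g'') (Num 1)) drop_literal keep_literal)"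

definition clause_at :: com where
  "clause_at = (flip_row ;; ''ok'' :=\<^sub>v Num 1 ;; count_rows ;;
     Cond (BEq (V ''ok'') (Num 1))
      (shrink_clause ;; ''count'' :=\<^sub>v Add (V ''count'') (Num 1) ;;
       Assign ''start'' (V ''count'') (V ''size'')) Skip)"

definition find_clauses :: com where
  "find_clauses = For ''i'' (Num 0) (V ''m'') (For ''j'' (Num 0) (V ''n'') clause_at)"

lemma avars_find [simp]:
  "avars flip_row = {''t'', ''z''}"
  "avars count_row = {''t'', ''k''}"
  "avars count_rows = {''y'', ''t'', ''k'', ''ok''}"
  "avars test_literal = {''y'', ''g''}"
  "avars drop_literal = {''y'', ''k''}"
  "avars keep_literal = {''lits'', ''owner'', ''size''}"
  "avars shrink_clause = {''t'', ''g'', ''y'', ''k'', ''lits'', ''owner'', ''size''}"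
  "avars clause_at = {''t'', ''z'', ''ok'', ''y'', ''k'', ''g'', ''lits'', ''owner'', ''size'', ''count'', ''start''}"
  "avars find_clauses = {''i'', ''j'', ''t'', ''z'', ''ok'', ''y'', ''k'', ''g'', ''lits'', ''owner'', ''size'', ''count'', ''start''}"
  unfolding find_clauses_def clause_at_def shrink_clause_def keep_literal_def drop_literal_def
    test_literal_def count_rows_def count_row_def flip_row_def by auto

definition bits :: "nat \<Rightarrow> bool list \<Rightarrow> store \<Rightarrow> bool" where
  "bits n z s \<longleftrightarrow> (\<forall>t<n. s ''z'' t = of_bool (z ! t))"

section \<open>Correctness and cost of the clause computation\<close>

locale table =
  fixes n :: nat and xs :: "bool list list"
  assumes n: "1 \<le> n" and ne: "xs \<noteq> []" and len: "x \<in> set xs \<Longrightarrow> length x = n"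
begin

abbreviation m :: nat where "m \<equiv> length xs"

lemma m: "1 \<le> m"
  using ne by (simp add: Suc_leI)

lemma flip_row:
  assumes "rows n xs s" "s ''i'' 0 = i" "i < m" "s ''j'' 0 = j" "j < n"
  shows "run flip_row s (50 * n) (bits n (flip (xs ! i) j))"
proof -
  have "run (For ''t'' (Num 0) (V ''n'') (Assign ''z'' (V ''t'') (bit ''i'' ''t''))) s (40 * (n * 1))
    (bits n (xs ! i))"
  proof (rule run_For_le[where I = "\<lambda>t. bits t (xs ! i)" and K = 11 and N = n])
    fix t s' assume h: "t < n" "s' ''t'' 0 = aval (Num 0) s + t" "bits t (xs ! i) s'"
      and sm: "same (insert ''t'' (avars (Assign ''z'' (V ''t'') (bit ''i'' ''t'')))) s s'"
    show "run (Assign ''z'' (V ''t'') (bit ''i'' ''t'')) s' (11 * 1) (bits (Suc t) (xs ! i))"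
      using h assms unfolding run_Assign bits_def rows_def
      by (simp add: sameD[OF sm] less_Suc_eq)
  qed (use assms n in \<open>auto simp: bits_def rows_def\<close>)
  then have "run flip_row s (40 * (n * 1) + 10) (bits n (flip (xs ! i) j))"
    unfolding flip_row_def
  proof (rule run_Seq)
    fix s' assume b: "bits n (xs ! i) s'"
      and sm: "same (avars (For ''t'' (Num 0) (V ''n'') (Assign ''z'' (V ''t'') (bit ''i'' ''t'')))) s s'"
    have "length (xs ! i) = n" using len assms by simp
    then show "run (Assign ''z'' (V ''j'') (Sub (Num 1) (Cell ''z'' (V ''j'')))) s' 10
      (bits n (flip (xs ! i) j))"
      using b assms unfolding run_Assign bits_def flip_def by (auto simp: sameD[OF sm] nth_list_update)
  qed
  then show ?thesis by (rule run_mono) (use n in auto)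
qed

lemma count_row:
  assumes "rows n xs s" "bits n z s" "s ''j'' 0 = j" "j < n" "s ''y'' 0 = y" "y < m" "s ''k'' y = 0"
  shows "run count_row s (60 * n) (\<lambda>s'. s' ''k'' y = count_true (map (lit z) [0..<Suc j]) (xs ! y) \<and>
     (\<forall>y'. y' \<noteq> y \<longrightarrow> s' ''k'' y' = s ''k'' y'))"
proof -
  let ?c = "Cond (BEq (bit ''y'' ''t'') (Cell ''z'' (V ''t''))) Skip
       (Assign ''k'' (V ''y'') (Add (Cell ''k'' (V ''y'')) (Num 1)))"
  have "run count_row s (60 * (n * 1)) (\<lambda>s'. s' ''k'' y = count_true (map (lit z) [0..<Suc j]) (xs ! y) \<and>
     (\<forall>y'. y' \<noteq> y \<longrightarrow> s' ''k'' y' = s ''k'' y'))"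
    unfolding count_row_def
  proof (rule run_For_le[where I = "\<lambda>t s'. s' ''k'' y = count_true (map (lit z) [0..<t]) (xs ! y) \<and>
     (\<forall>y'. y' \<noteq> y \<longrightarrow> s' ''k'' y' = s ''k'' y')" and K = 30 and N = "Suc j"])
    fix t s' assume h: "t < Suc j" "s' ''t'' 0 = aval (Num 0) s + t"
      and sm: "same (insert ''t'' (avars ?c)) s s'"
      and I: "s' ''k'' y = count_true (map (lit z) [0..<t]) (xs ! y) \<and> (\<forall>y'. y' \<noteq> y \<longrightarrow> s' ''k'' y' = s ''k'' y')"
    have "s' ''D'' (s' ''row'' y + t) = of_bool (xs ! y ! t)" "s' ''z'' t = of_bool (z ! t)"
      using assms h unfolding rows_def bits_def by (auto simp: sameD[OF sm])
    then show "run ?c s' (30 * 1) (\<lambda>s'. s' ''k'' y = count_true (map (lit z) [0..<Suc t]) (xs ! y) \<and>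
     (\<forall>y'. y' \<noteq> y \<longrightarrow> s' ''k'' y' = s ''k'' y'))"
      using h I assms(5) by (simp add: run_simps sameD[OF sm])
  qed (use assms n in \<open>auto simp: rows_def\<close>)
  then show ?thesis by simp
qed

lemma count_rows:
  assumes "rows n xs s" "bits n z s" "s ''j'' 0 = j" "j < n" "s ''ok'' 0 = 1"
  shows "run count_rows s (120 * (m * n)) (\<lambda>s'.
     (\<forall>y<m. s' ''k'' y = count_true (map (lit z) [0..<Suc j]) (xs ! y)) \<and>
     s' ''ok'' 0 = of_bool (\<forall>y\<in>set xs. 0 < count_true (map (lit z) [0..<Suc j]) y))"
proof -
  let ?N = "\<lambda>y. count_true (map (lit z) [0..<Suc j]) (xs ! y)"
  let ?c = "Assign ''k'' (V ''y'') (Num 0) ;; count_row ;;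
      Cond (BEq (Cell ''k'' (V ''y'')) (Num 0)) (''ok'' :=\<^sub>v Num 0) Skip"
  let ?I = "\<lambda>y s'. (\<forall>y'<y. s' ''k'' y' = ?N y') \<and> s' ''ok'' 0 = of_bool (\<forall>y'<y. 0 < ?N y')"
  show ?thesis
    unfolding count_rows_def
  proof (rule run_For_le[where I = ?I and K = 90 and N = m])
    fix y s' assume h: "y < m" "s' ''y'' 0 = aval (Num 0) s + y"
      and sm: "same (insert ''y'' (avars ?c)) s s'" and I: "?I y s'"
    have "run ?c s' (5 + (60 * n + 20)) (?I (Suc y))"
    proof (rule run_Seq_AssignI)
      let ?s1 = "s'(''k'' := (s' ''k'')(aval (V ''y'') s' := aval (Num 0) s'))"
      have "rows n xs s'" using rows_same[OF sm] assms(1) by simp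
      then have r: "rows n xs ?s1" by (simp add: rows_def)
      have b: "bits n z ?s1" using assms(2) unfolding bits_def by (simp add: sameD[OF sm])
      show "run (count_row ;; Cond (BEq (Cell ''k'' (V ''y'')) (Num 0)) (''ok'' :=\<^sub>v Num 0) Skip)
        ?s1 (60 * n + 20) (?I (Suc y))"
      proof (rule run_Seq)
        show "run count_row ?s1 (60 * n) (\<lambda>s'. s' ''k'' y = ?N y \<and>
           (\<forall>y'. y' \<noteq> y \<longrightarrow> s' ''k'' y' = ?s1 ''k'' y'))"
          by (rule count_row[OF r b]) (use assms h in \<open>auto simp: sameD[OF sm]\<close>)
        fix s2 assume q: "s2 ''k'' y = ?N y \<and> (\<forall>y'. y' \<noteq> y \<longrightarrow> s2 ''k'' y' = ?s1 ''k'' y')"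
          and sm2: "same (avars count_row) ?s1 s2"
        have "s2 ''y'' 0 = y" "s2 ''ok'' 0 = s' ''ok'' 0" using h by (auto simp: sameD[OF sm2])
        then show "run (Cond (BEq (Cell ''k'' (V ''y'')) (Num 0)) (''ok'' :=\<^sub>v Num 0) Skip) s2 20 (?I (Suc y))"
          using q I h by (auto simp: run_simps less_Suc_eq all_conj_distrib simp del: upt_Suc)
      qed
    qed simp
    then show "run ?c s' (90 * n) (?I (Suc y))" by (rule run_mono) (use n in auto)
  qed (use assms n m in \<open>auto simp: rows_def all_set_conv_all_nth simp del: upt_Suc\<close>)
qed

lemma test_literal:
  assumes "rows n xs s" "bits n z s" "s ''t'' 0 = t" "t < n" "s ''g'' 0 = 1"
    and k: "\<And>y. y < m \<Longrightarrow> s ''k'' y = count_true c (xs ! y)"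
  shows "run test_literal s (70 * m) (\<lambda>s'. s' ''g'' 0 =
     of_bool (\<forall>x\<in>set xs. lit_true x (lit z t) \<longrightarrow> 2 \<le> count_true c x))"
proof -
  let ?c = "Cond (BAnd (BNot (BEq (bit ''y'' ''t'') (Cell ''z'' (V ''t'')))) (BLess (Cell ''k'' (V ''y'')) (Num 2)))
       (''g'' :=\<^sub>v Num 0) Skip"
  let ?I = "\<lambda>y s'. s' ''g'' 0 = of_bool (\<forall>y'<y. lit_true (xs ! y') (lit z t) \<longrightarrow> 2 \<le> count_true c (xs ! y'))"
  have "run test_literal s (70 * (m * 1)) (\<lambda>s'. s' ''g'' 0 =
     of_bool (\<forall>x\<in>set xs. lit_true x (lit z t) \<longrightarrow> 2 \<le> count_true c x))"
    unfolding test_literal_def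
  proof (rule run_For_le[where I = ?I and K = 40 and N = m])
    fix y s' assume h: "y < m" "s' ''y'' 0 = aval (Num 0) s + y"
      and sm: "same (insert ''y'' (avars ?c)) s s'" and I: "?I y s'"
    have "s' ''D'' (s' ''row'' y + t) = of_bool (xs ! y ! t)" "s' ''z'' t = of_bool (z ! t)"
      "s' ''k'' y = count_true c (xs ! y)" "s' ''t'' 0 = t" "s' ''y'' 0 = y"
      using assms h unfolding rows_def bits_def by (auto simp: sameD[OF sm])
    then show "run ?c s' (40 * 1) (?I (Suc y))"
      using I by (auto simp: run_simps less_Suc_eq all_conj_distrib)
  qed (use assms m in \<open>auto simp: rows_def all_set_conv_all_nth\<close>)
  then show ?thesis by simp
qed

lemma drop_literal:
  assumes "rows n xs s" "bits n z s" "s ''t'' 0 = t" "t < n"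
    and k: "\<And>y. y < m \<Longrightarrow> s ''k'' y = of_bool (lit_true (xs ! y) (lit z t)) + N y"
  shows "run drop_literal s (60 * m) (\<lambda>s'. \<forall>y<m. s' ''k'' y = N y)"
proof -
  let ?c = "Cond (BEq (bit ''y'' ''t'') (Cell ''z'' (V ''t''))) Skip
       (Assign ''k'' (V ''y'') (Sub (Cell ''k'' (V ''y'')) (Num 1)))"
  let ?I = "\<lambda>y s'. (\<forall>y'<y. s' ''k'' y' = N y') \<and> (\<forall>y'\<ge>y. s' ''k'' y' = s ''k'' y')"
  have "run drop_literal s (60 * (m * 1)) (\<lambda>s'. \<forall>y<m. s' ''k'' y = N y)"
    unfolding drop_literal_def
  proof (rule run_For_le[where I = ?I and K = 30 and N = m])
    fix y s' assume h: "y < m" "s' ''y'' 0 = aval (Num 0) s + y"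
      and sm: "same (insert ''y'' (avars ?c)) s s'" and I: "?I y s'"
    have "s' ''D'' (s' ''row'' y + t) = of_bool (xs ! y ! t)" "s' ''z'' t = of_bool (z ! t)"
      "s' ''t'' 0 = t" "s' ''y'' 0 = y"
      using assms h unfolding rows_def bits_def by (auto simp: sameD[OF sm])
    moreover have "s' ''k'' y = of_bool (lit_true (xs ! y) (lit z t)) + N y" using I k[OF h(1)] by simp
    ultimately show "run ?c s' (30 * 1) (?I (Suc y))"
      using I by (auto simp: run_simps less_Suc_eq all_conj_distrib)
  qed (use assms m in \<open>auto simp: rows_def\<close>)
  then show ?thesis by simp
qed

text \<open>The counters follow the clause made of kept and unexamined literals. Keeping a literal
  only moves it from the second group to the first, so just \<open>drop_literal\<close> has to
  update them.\<close>

lemma shrink_clause: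
  assumes r: "rows n xs s" and b: "bits n z s" and j: "s ''j'' 0 = j" "j < n"
    and c: "c = map (lit z) [0..<Suc j]"
    and k: "\<And>y. y < m \<Longrightarrow> s ''k'' y = count_true c (xs ! y)"
    and st: "stored cs [] s"
  shows "run shrink_clause s (250 * (n * m)) (stored cs (shrink xs c (length c)))"
proof -
  note [simp del] = upt_Suc
  let ?b = "''g'' :=\<^sub>v Num 1 ;; test_literal ;; Cond (BEq (V ''g'') (Num 1)) drop_literal keep_literal"
  let ?I = "\<lambda>t s'. stored cs (shrink xs c t) s' \<and>
    (\<forall>y<m. s' ''k'' y = count_true (shrink xs c t @ drop t c) (xs ! y))"
  have lc: "length c = Suc j" using c by simp
  show ?thesis
    unfolding shrink_clause_def
  proof (rule run_For_le[where I = ?I and K = 200 and N = "Suc j"])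
    fix t s' assume h: "t < Suc j" "s' ''t'' 0 = aval (Num 0) s + t"
      and sm: "same (insert ''t'' (avars ?b)) s s'" and I: "?I t s'"
    have tn: "t < n" using h j by simp
    have ct: "c ! t = lit z t" using c h by simp
    have dc: "drop t c = lit z t # drop (Suc t) c" using h lc ct by (metis Cons_nth_drop_Suc)
    let ?s1 = "s'(''g'' := (s' ''g'')(aval (Num 0) s' := aval (Num 1) s'))"
    have "rows n xs s'" using rows_same[OF sm] r by simp
    then have r1: "rows n xs ?s1" by (simp add: rows_def)
    have b1: "bits n z ?s1" using b unfolding bits_def by (simp add: sameD[OF sm])
    define G where "G \<longleftrightarrow> (\<forall>x\<in>set xs. lit_true x (lit z t) \<longrightarrow> 2 \<le> count_true (shrink xs c t @ drop t c) x)"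
    have "run ?b s' (10 + (70 * m + (20 + 60 * m))) (?I (Suc t))"
    proof (rule run_Seq_AssignI, simp, rule run_Seq)
      show "run test_literal ?s1 (70 * m) (\<lambda>s'. s' ''g'' 0 = of_bool G)"
        unfolding G_def by (rule test_literal[OF r1 b1]) (use h tn I in auto)
      fix s2 assume g: "s2 ''g'' 0 = of_bool G" and sm2: "same (avars test_literal) ?s1 s2"
      have r2: "rows n xs s2" using rows_same[OF sm2] r1 by simp
      have b2: "bits n z s2" using b1 unfolding bits_def by (simp add: sameD[OF sm2])
      have st2: "stored cs (shrink xs c t) s2"
        using stored_same[OF sm2, of cs "shrink xs c t"] I by (simp add: stored_def)
      have t2: "s2 ''t'' 0 = t" using h by (simp add: sameD[OF sm2])
      have k2: "s2 ''k'' y = count_true (shrink xs c t @ drop t c) (xs ! y)" if "y < m" for y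
        using I that by (simp add: sameD[OF sm2])
      show "run (Cond (BEq (V ''g'') (Num 1)) drop_literal keep_literal) s2 (20 + 60 * m) (?I (Suc t))"
      proof (cases G)
        case True
        have sh: "shrink xs c (Suc t) = shrink xs c t" using True ct unfolding G_def by simp
        have "run drop_literal s2 (60 * m) (\<lambda>s'. \<forall>y<m. s' ''k'' y = count_true (shrink xs c t @ drop (Suc t) c) (xs ! y))"
          by (rule drop_literal[OF r2 b2 t2 tn]) (use k2 dc in simp)
        then have "run drop_literal s2 (60 * m + 15) (?I (Suc t))"
        proof (rule run_mono)
          fix s3 assume "\<forall>y<m. s3 ''k'' y = count_true (shrink xs c t @ drop (Suc t) c) (xs ! y)"
            and sm3: "same (avars drop_literal) s2 s3"
          then show "?I (Suc t) s3" unfolding sh using stored_same[OF sm3] st2 by simp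
        qed simp
        then show ?thesis
          by (rule run_Cond_True[rotated]) (use True g in simp_all)
      next
        case False
        have sh: "shrink xs c (Suc t) = shrink xs c t @ [lit z t]" using False ct unfolding G_def by auto
        have "s2 ''z'' t = of_bool (z ! t)" using b2 tn unfolding bits_def by simp
        then have "run keep_literal s2 (60 * m + 15) (?I (Suc t))"
          using stored_literal[OF st2, of "lit z t"] t2 k2 dc m unfolding keep_literal_def sh
          by (simp add: run_simps mult_2)
        then show ?thesis
          by (rule run_Cond_False[rotated]) (use False g in simp_all)
      qed
    qed
    then show "run ?b s' (200 * m) (?I (Suc t))" by (rule run_mono) (use m in auto)
  next
    show "?I 0 s" using st k by simp
  next
    fix k s' x show "?I k (s'(''t'' := x)) = ?I k s'" by (simp add: stored_def)
  next
    fix s' assume "?I (Suc j) s'"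
    then show "stored cs (shrink xs c (length c)) s'" using lc by simp
  qed (use j m in auto)
qed

lemma clause_at:
  assumes r: "rows n xs s" and i: "s ''i'' 0 = i" "i < m" and j: "s ''j'' 0 = j" "j < n"
    and st: "stored cs [] s"
  shows "run clause_at s (500 * (n * m)) (stored (cs @ clauses_at xs (xs ! i) j) [])"
proof -
  note [simp del] = upt_Suc
  let ?z = "flip (xs ! i) j"
  let ?p = "prefix_clause (xs ! i) j"
  have p: "?p = map (lit ?z) [0..<Suc j]" unfolding prefix_clause_def by simp
  define G where "G \<longleftrightarrow> (\<forall>y\<in>set xs. 0 < count_true ?p y)"
  let ?c3 = "Cond (BEq (V ''ok'') (Num 1)) (shrink_clause ;; ''count'' :=\<^sub>v Add (V ''count'') (Num 1) ;;
       Assign ''start'' (V ''count'') (V ''size'')) Skip"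
  have nm: "n \<le> n * m" "1 \<le> n * m" using m n by auto
  have "run clause_at s (50 * n + (10 + (120 * (m * n) + (20 + (250 * (n * m) + 30)))))
    (stored (cs @ clauses_at xs (xs ! i) j) [])"
    unfolding clause_at_def
  proof (rule run_Seq[OF flip_row[OF r i j]])
    fix s1 assume b1: "bits n ?z s1" and sm: "same (avars flip_row) s s1"
    let ?s2 = "s1(''ok'' := (s1 ''ok'')(aval (Num 0) s1 := aval (Num 1) s1))"
    have "rows n xs s1" "stored cs [] s1" using rows_same[OF sm] stored_same[OF sm] r st by auto
    then have r2: "rows n xs ?s2" and st2: "stored cs [] ?s2" by (auto simp: rows_def stored_def)
    have b2: "bits n ?z ?s2" using b1 by (simp add: bits_def)
    show "run (''ok'' :=\<^sub>v Num 1 ;; count_rows ;; ?c3) s1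
      (10 + (120 * (m * n) + (20 + (250 * (n * m) + 30)))) (stored (cs @ clauses_at xs (xs ! i) j) [])"
    proof (rule run_Seq_AssignI, simp, rule run_Seq)
      show "run count_rows ?s2 (120 * (m * n)) (\<lambda>s'. (\<forall>y<m. s' ''k'' y = count_true ?p (xs ! y)) \<and>
         s' ''ok'' 0 = of_bool G)"
        unfolding p G_def by (rule count_rows[OF r2 b2]) (use j in \<open>auto simp: sameD[OF sm]\<close>)
      fix s3 assume k3: "(\<forall>y<m. s3 ''k'' y = count_true ?p (xs ! y)) \<and> s3 ''ok'' 0 = of_bool G"
        and sm3: "same (avars count_rows) ?s2 s3"
      have r3: "rows n xs s3" and st3: "stored cs [] s3"
        using rows_same[OF sm3] stored_same[OF sm3] r2 st2 by auto
      have b3: "bits n ?z s3" using b2 unfolding bits_def by (simp add: sameD[OF sm3])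
      have j3: "s3 ''j'' 0 = j" using j by (simp add: sameD[OF sm3] sameD[OF sm])
      show "run ?c3 s3 (20 + (250 * (n * m) + 30)) (stored (cs @ clauses_at xs (xs ! i) j) [])"
      proof (cases G)
        case True
        let ?ks = "shrink xs ?p (length ?p)"
        have cl: "clauses_at xs (xs ! i) j = [?ks]" using True unfolding clauses_at_def Let_def G_def by simp
        have "run (shrink_clause ;; ''count'' :=\<^sub>v Add (V ''count'') (Num 1) ;;
           Assign ''start'' (V ''count'') (V ''size'')) s3 (250 * (n * m) + 30) (stored (cs @ [?ks]) [])"
        proof (rule run_Seq)
          show "run shrink_clause s3 (250 * (n * m)) (stored cs ?ks)"
            by (rule shrink_clause[OF r3 b3 j3 j(2) p]) (use k3 st3 in auto)
          fix s4 assume "stored cs ?ks s4"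
          then show "run (''count'' :=\<^sub>v Add (V ''count'') (Num 1) ;;
            Assign ''start'' (V ''count'') (V ''size'')) s4 30 (stored (cs @ [?ks]) [])"
            using stored_clause[of cs ?ks s4] by (simp add: run_simps)
        qed
        then have "run (shrink_clause ;; ''count'' :=\<^sub>v Add (V ''count'') (Num 1) ;;
           Assign ''start'' (V ''count'') (V ''size'')) s3 (45 + 250 * (n * m)) (stored (cs @ [?ks]) [])"
          by (rule run_mono) simp_all
        then show ?thesis unfolding cl
          by (rule run_Cond_True[rotated]) (use True k3 in simp_all)
      next
        case False
        then have "clauses_at xs (xs ! i) j = []" unfolding clauses_at_def Let_def G_def by auto
        then have "run Skip s3 1 (stored (cs @ clauses_at xs (xs ! i) j) [])"
          using st3 by (simp add: run_Skip)
        then have "run Skip s3 (45 + 250 * (n * m)) (stored (cs @ clauses_at xs (xs ! i) j) [])"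
          by (rule run_mono) simp_all
        then show ?thesis
          by (rule run_Cond_False[rotated]) (use False k3 in simp_all)
      qed
    qed
  qed
  then show ?thesis
  proof (rule run_mono)
    show "50 * n + (10 + (120 * (m * n) + (20 + (250 * (n * m) + 30)))) \<le> 500 * (n * m)"
      using nm mult.commute[of m n] by linarith
  qed simp
qed

lemma find_clauses:
  assumes r: "rows n xs s" and st: "stored [] [] s"
  shows "run find_clauses s (600 * (m * (n * (n * m)))) (stored (prime_cnf n xs) [])"
  unfolding find_clauses_def
proof (rule run_For_le[where I = "\<lambda>i. stored (clauses_upto n xs i) []" and K = 550 and N = m])
  fix i s' assume h: "i < m" "s' ''i'' 0 = aval (Num 0) s + i"
    and sm: "same (insert ''i'' (avars (For ''j'' (Num 0) (V ''n'') clause_at))) s s'"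
    and st': "stored (clauses_upto n xs i) [] s'"
  let ?cs = "clauses_upto n xs i"
  have r': "rows n xs s'" using rows_same[OF sm] r by simp
  have up: "clauses_upto n xs (Suc i) = ?cs @ clauses_row xs (xs ! i) n"
    using h by (simp add: clauses_upto_def take_Suc_conv_app_nth)
  show "run (For ''j'' (Num 0) (V ''n'') clause_at) s' (550 * (n * (n * m))) (stored (clauses_upto n xs (Suc i)) [])"
  proof (rule run_For_le[where I = "\<lambda>j. stored (?cs @ clauses_row xs (xs ! i) j) []" and K = 500 and N = n])
    fix j s2 assume h2: "j < n" "s2 ''j'' 0 = aval (Num 0) s' + j"
      and sm2: "same (insert ''j'' (avars clause_at)) s' s2"
      and st2: "stored (?cs @ clauses_row xs (xs ! i) j) [] s2"
    have e: "?cs @ clauses_row xs (xs ! i) (Suc j) = (?cs @ clauses_row xs (xs ! i) j) @ clauses_at xs (xs ! i) j"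
      by (simp add: clauses_row_def)
    show "run clause_at s2 (500 * (n * m)) (stored (?cs @ clauses_row xs (xs ! i) (Suc j)) [])"
      unfolding e
      by (rule clause_at[OF _ _ h(1) _ h2(1) st2])
        (use rows_same[OF sm2] r' h h2 in \<open>auto simp: sameD[OF sm2]\<close>)
  qed (use st' up r' n m in \<open>auto simp: stored_def rows_def clauses_row_def\<close>)
qed (use st r n m in \<open>auto simp: stored_def rows_def clauses_upto_def\<close>)

end

section \<open>Tables and occurrence lists\<close>

lemma encode_lit_eq_iff [simp]: "encode_lit l = encode_lit l' \<longleftrightarrow> l = l'"
  by (cases l; cases l') (simp_all, presburger+)

lemma encode_lit_less: "encode_lit l < n + n \<longleftrightarrow> var l < n"
  by (cases l) auto

lemma encode_lit_surj: obtains l where "encode_lit l = a"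
proof (cases "even a")
  case True
  then have "encode_lit (Pos (a div 2)) = a" by simp
  then show ?thesis by (rule that)
next
  case False
  then have "encode_lit (Neg (a div 2)) = a" by simp
  then show ?thesis by (rule that)
qed

definition offset :: "literal list list \<Rightarrow> nat \<Rightarrow> nat" where
  "offset cs c = length (concat (take c cs))"

lemma offset_Suc: "c < length cs \<Longrightarrow> offset cs (Suc c) = offset cs c + length (cs ! c)"
  unfolding offset_def by (simp add: take_Suc_conv_app_nth)

lemma offset_append: "c \<le> length cs \<Longrightarrow> offset (cs @ [d]) c = offset cs c"
  unfolding offset_def by simp

lemma owners_nth:
  assumes "c < length cs" "t < length (cs ! c)"
  shows "offset cs c + t < length (concat cs)" "concat cs ! (offset cs c + t) = cs ! c ! t"
    "owners cs ! (offset cs c + t) = c"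
proof -
  have "offset cs c + t < length (concat cs) \<and> concat cs ! (offset cs c + t) = cs ! c ! t \<and>
    owners cs ! (offset cs c + t) = c"
    using assms
  proof (induction cs rule: rev_induct)
    case (snoc d cs)
    show ?case
    proof (cases "c < length cs")
      case True
      then have "t < length (cs ! c)" using snoc by (simp add: nth_append)
      from snoc.IH[OF True this] show ?thesis
        using True by (simp add: offset_append nth_append owners_append length_owners)
    next
      case False
      then have c: "c = length cs" using snoc by simp
      then have "offset (cs @ [d]) c = length (concat cs)" unfolding offset_def by simp
      then show ?thesis using snoc c by (simp add: nth_append owners_append length_owners)
    qed
  qed simp
  then show "offset cs c + t < length (concat cs)" "concat cs ! (offset cs c + t) = cs ! c ! t"
    "owners cs ! (offset cs c + t) = c" by auto
qed

lemma position_cases: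
  assumes "q < length (concat cs)"
  obtains c t where "c < length cs" "t < length (cs ! c)" "q = offset cs c + t"
proof -
  have "\<exists>c t. c < length cs \<and> t < length (cs ! c) \<and> q = offset cs c + t"
    using assms
  proof (induction cs rule: rev_induct)
    case (snoc d cs)
    show ?case
    proof (cases "q < length (concat cs)")
      case True
      then obtain c t where "c < length cs" "t < length (cs ! c)" "q = offset cs c + t"
        using snoc.IH by blast
      then show ?thesis
        by (intro exI[of _ c] exI[of _ t]) (simp add: offset_append nth_append)
    next
      case False
      then show ?thesis
        using snoc by (intro exI[of _ "length cs"] exI[of _ "q - length (concat cs)"])
          (simp add: offset_def)
    qed
  qed simp
  then show ?thesis using that by blast
qed

text \<open>The successor of the last position before \<open>q\<close> that holds \<open>l\<close>, and 0 if there is none.\<close>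

fun prev_pos :: "literal list \<Rightarrow> literal \<Rightarrow> nat \<Rightarrow> nat" where
  "prev_pos ls l 0 = 0"
| "prev_pos ls l (Suc q) = (if ls ! q = l then Suc q else prev_pos ls l q)"

lemma prev_pos_0: "prev_pos ls l q = 0 \<Longrightarrow> q' < q \<Longrightarrow> ls ! q' \<noteq> l"
  by (induction q) (auto simp: less_Suc_eq split: if_splits)

lemma prev_pos_Suc:
  "prev_pos ls l q = Suc p \<Longrightarrow> p < q \<and> ls ! p = l \<and> (\<forall>q'. p < q' \<and> q' < q \<longrightarrow> ls ! q' \<noteq> l)"
  by (induction q) (auto simp: less_Suc_eq split: if_splits)

text \<open>Occurrence lists as linked lists: \<open>head\<close> leads to the last occurrence of a
  literal and \<open>next\<close> to the preceding one. Pointers are positions plus one, since 0,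
  the initial content of memory, ends a list.\<close>

definition links :: "literal list \<Rightarrow> store \<Rightarrow> bool" where
  "links ls s \<longleftrightarrow> (\<forall>l. s ''head'' (encode_lit l) = prev_pos ls l (length ls)) \<and>
     (\<forall>q<length ls. s ''next'' q = prev_pos ls (ls ! q) q)"

text \<open>Decoding a literal needs a parity test and halving; with addition and subtraction only,
  both results are tabulated.\<close>

definition tables :: "nat \<Rightarrow> store \<Rightarrow> bool" where
  "tables n s \<longleftrightarrow> (\<forall>l. var l < n \<longrightarrow> s ''neg'' (encode_lit l) = encode_lit (neg_lit l) \<and>
     s ''var'' (encode_lit l) = var l)"

section \<open>Filling the lookup tables\<close>

definition fill_rows :: com where
  "fill_rows = For ''y'' (Num 0) (V ''m'')
     (Assign ''row'' (Add (V ''y'') (Num 1)) (Add (Cell ''row'' (V ''y'')) (V ''n'')))"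

definition fill_tables :: com where
  "fill_tables = For ''v'' (Num 0) (V ''n'')
     (''a'' :=\<^sub>v Add (V ''v'') (V ''v'') ;; ''b'' :=\<^sub>v Add (V ''a'') (Num 1) ;;
      Assign ''neg'' (V ''a'') (V ''b'') ;; Assign ''neg'' (V ''b'') (V ''a'') ;;
      Assign ''var'' (V ''a'') (V ''v'') ;; Assign ''var'' (V ''b'') (V ''v''))"

definition link_positions :: com where
  "link_positions = For ''q'' (Num 0) (V ''size'')
     (''l'' :=\<^sub>v Cell ''lits'' (V ''q'') ;; Assign ''next'' (V ''q'') (Cell ''head'' (V ''l'')) ;;
      Assign ''head'' (V ''l'') (Add (V ''q'') (Num 1)))"

lemma avars_fill [simp]:
  "avars fill_rows = {''y'', ''row''}"
  "avars fill_tables = {''v'', ''a'', ''b'', ''neg'', ''var''}"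
  "avars link_positions = {''q'', ''l'', ''next'', ''head''}"
  unfolding fill_rows_def fill_tables_def link_positions_def by auto

lemma fill_rows:
  assumes "s ''m'' 0 = m" "s ''n'' 0 = n" "s ''row'' 0 = 0" "1 \<le> m"
  shows "run fill_rows s (50 * m) (\<lambda>s'. \<forall>y\<le>m. s' ''row'' y = y * n)"
proof -
  let ?c = "Assign ''row'' (Add (V ''y'') (Num 1)) (Add (Cell ''row'' (V ''y'')) (V ''n''))"
  let ?I = "\<lambda>y s'. \<forall>y'\<le>y. s' ''row'' y' = y' * n"
  have "run fill_rows s (50 * (m * 1)) (?I m)"
    unfolding fill_rows_def
  proof (rule run_For_le[where I = ?I and K = 20 and N = m])
    fix y s' assume h: "y < m" "s' ''y'' 0 = aval (Num 0) s + y" and I: "?I y s'"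
      and sm: "same (insert ''y'' (avars ?c)) s s'"
    show "run ?c s' (20 * 1) (?I (Suc y))"
      using h I assms by (auto simp: run_simps sameD[OF sm] le_Suc_eq)
  qed (use assms in auto)
  then show ?thesis by simp
qed

lemma fill_tables:
  assumes "s ''n'' 0 = n" "1 \<le> n"
  shows "run fill_tables s (100 * n) (tables n)"
proof -
  let ?c = "''a'' :=\<^sub>v Add (V ''v'') (V ''v'') ;; ''b'' :=\<^sub>v Add (V ''a'') (Num 1) ;;
      Assign ''neg'' (V ''a'') (V ''b'') ;; Assign ''neg'' (V ''b'') (V ''a'') ;;
      Assign ''var'' (V ''a'') (V ''v'') ;; Assign ''var'' (V ''b'') (V ''v'')"
  have "run fill_tables s (100 * (n * 1)) (tables n)"
    unfolding fill_tables_def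
  proof (rule run_For_le[where I = tables and K = 60 and N = n])
    fix v s' assume h: "v < n" "s' ''v'' 0 = aval (Num 0) s + v" and I: "tables v s'"
      and sm: "same (insert ''v'' (avars ?c)) s s'"
    let ?s1 = "s'(''a'' := (s' ''a'')(0 := 2 * v), ''b'' := (s' ''b'')(0 := Suc (2 * v)),
      ''neg'' := (s' ''neg'')(2 * v := Suc (2 * v), Suc (2 * v) := 2 * v),
      ''var'' := (s' ''var'')(2 * v := v, Suc (2 * v) := v))"
    have "tables (Suc v) ?s1"
      unfolding tables_def
    proof (intro allI impI)
      fix l assume l: "var l < Suc v"
      show "?s1 ''neg'' (encode_lit l) = encode_lit (neg_lit l) \<and> ?s1 ''var'' (encode_lit l) = var l"
      proof (cases "var l = v")
        case True
        then show ?thesis by (cases l) auto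
      next
        case False
        then have "var l < v" using l by simp
        moreover from this have "encode_lit l \<noteq> 2 * v" "encode_lit l \<noteq> Suc (2 * v)"
          by (cases l; simp; presburger)+
        ultimately show ?thesis using I unfolding tables_def by simp
      qed
    qed
    then show "run ?c s' (60 * 1) (tables (Suc v))"
      using h by (simp add: run_simps mult_2)
  qed (use assms in \<open>auto simp: tables_def\<close>)
  then show ?thesis by simp
qed

lemma link_positions:
  assumes st: "stored cs [] s" and h: "s ''head'' = (\<lambda>_. 0)" and N: "length (concat cs) \<le> N" "1 \<le> N"
  shows "run link_positions s (60 * N) (links (concat cs))"
proof -
  let ?ls = "concat cs"
  let ?c = "''l'' :=\<^sub>v Cell ''lits'' (V ''q'') ;; Assign ''next'' (V ''q'') (Cell ''head'' (V ''l'')) ;;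
      Assign ''head'' (V ''l'') (Add (V ''q'') (Num 1))"
  let ?I = "\<lambda>q s'. (\<forall>l. s' ''head'' (encode_lit l) = prev_pos ?ls l q) \<and>
     (\<forall>p<q. s' ''next'' p = prev_pos ?ls (?ls ! p) p)"
  have "run link_positions s (60 * (N * 1)) (links ?ls)"
    unfolding link_positions_def
  proof (rule run_For_le[where I = ?I and K = 30 and N = "length ?ls"])
    fix q s' assume q: "q < length ?ls" "s' ''q'' 0 = aval (Num 0) s + q" and I: "?I q s'"
      and sm: "same (insert ''q'' (avars ?c)) s s'"
    have "s' ''lits'' q = encode_lit (?ls ! q)"
      using st q unfolding stored_def arr_def by (simp add: sameD[OF sm])
    then show "run ?c s' (30 * 1) (?I (Suc q))"
      using q I by (auto simp: run_simps less_Suc_eq)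
  qed (use assms in \<open>auto simp: stored_def links_def\<close>)
  then show ?thesis by simp
qed

section \<open>Horn renamings\<close>

definition queue :: "nat \<Rightarrow> literal list \<Rightarrow> store \<Rightarrow> bool" where
  "queue n qs s \<longleftrightarrow> s ''e'' 0 = length qs \<and> distinct qs \<and> (\<forall>l\<in>set qs. var l < n) \<and>
     arr (s ''queue'') (map encode_lit qs) \<and>
     (\<forall>l. var l < n \<longrightarrow> s ''mark'' (encode_lit l) = of_bool (l \<in> set qs))"

lemma queue_same:
  assumes sm: "same X s s'" and X: "{''e'', ''queue'', ''mark''} \<inter> X = {}"
  shows "queue n qs s' = queue n qs s"
  using X unfolding queue_def by (simp add: sameD[OF sm])

lemma queue_append:
  assumes "queue n qs s" "l \<notin> set qs" "var l < n"
  shows "queue n (qs @ [l]) (s(''mark'' := (s ''mark'')(encode_lit l := 1),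
     ''queue'' := (s ''queue'')(s ''e'' 0 := encode_lit l), ''e'' := (s ''e'')(0 := Suc (s ''e'' 0))))"
proof -
  have "arr ((s ''queue'')(s ''e'' 0 := encode_lit l)) (map encode_lit qs @ [encode_lit l])"
    by (rule arr_append) (use assms in \<open>auto simp: queue_def\<close>)
  then show ?thesis using assms unfolding queue_def by auto
qed

lemma queue_length: assumes "queue n qs s" shows "length qs \<le> n + n"
proof -
  have "l \<in> Pos ` {..<n} \<union> Neg ` {..<n}" if "var l < n" for l
    using that by (cases l) auto
  then have "set qs \<subseteq> Pos ` {..<n} \<union> Neg ` {..<n}" using assms unfolding queue_def by blast
  then have "card (set qs) \<le> card (Pos ` {..<n} \<union> Neg ` {..<n})"
    by (intro card_mono) auto
  also have "\<dots> \<le> card (Pos ` {..<n}) + card (Neg ` {..<n})" by (rule card_Un_le)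
  also have "\<dots> \<le> n + n"
    using card_image_le[of "{..<n}" Pos] card_image_le[of "{..<n}" Neg] by simp
  finally show ?thesis using assms distinct_card[of qs] unfolding queue_def by simp
qed

text \<open>Here \<open>b\<close> is the complement of the literal being expanded. Its own
  occurrence is exempt, as in \<open>edge\<close>; the decrement undoes the shift of the pointer
  \<open>p\<close>.\<close>

definition expand_clause :: com where
  "expand_clause = (''c'' :=\<^sub>v Cell ''owner'' (Sub (V ''p'') (Num 1)) ;;
     For ''q'' (Cell ''start'' (V ''c'')) (Cell ''start'' (Add (V ''c'') (Num 1)))
      (''l'' :=\<^sub>v Cell ''lits'' (V ''q'') ;;
       Cond (BAnd (BNot (BEq (V ''l'') (V ''b''))) (BEq (Cell ''mark'' (V ''l'')) (Num 0)))
        (Assign ''mark'' (V ''l'') (Num 1) ;; Assign ''queue'' (V ''e'') (V ''l'') ;;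
         ''e'' :=\<^sub>v Add (V ''e'') (Num 1)) Skip))"

definition expand_literal :: com where
  "expand_literal = (''p'' :=\<^sub>v Cell ''head'' (V ''b'') ;;
     While (BLess (Num 0) (V ''p''))
      (expand_clause ;; ''p'' :=\<^sub>v Cell ''next'' (Sub (V ''p'') (Num 1))))"

definition init_search :: com where
  "init_search = (For ''t'' (Num 0) (Add (V ''n'') (V ''n'')) (Assign ''mark'' (V ''t'') (Num 0)) ;;
     Assign ''mark'' (V ''a'') (Num 1) ;; Assign ''queue'' (Num 0) (V ''a'') ;;
     ''e'' :=\<^sub>v Num 1 ;; ''h'' :=\<^sub>v Num 0 ;; ''bad'' :=\<^sub>v Num 0)"

text \<open>Conflicts are tested only when a literal leaves the queue. Consistency is therefore
  known just for the processed prefix until the search ends.\<close>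

definition search_step :: com where
  "search_step = (''b'' :=\<^sub>v Cell ''neg'' (Cell ''queue'' (V ''h'')) ;;
     Cond (BEq (Cell ''mark'' (V ''b'')) (Num 1)) (''bad'' :=\<^sub>v Num 1)
      (expand_literal ;; ''h'' :=\<^sub>v Add (V ''h'') (Num 1)))"

definition search :: com where
  "search = While (BAnd (BLess (V ''h'') (V ''e'')) (BEq (V ''bad'') (Num 0))) search_step"

definition commit :: com where
  "commit = For ''t'' (Num 0) (V ''e'') (''l'' :=\<^sub>v Cell ''queue'' (V ''t'') ;;
     Assign ''sign'' (Cell ''var'' (V ''l'')) (Add (V ''l'') (Num 1)))"

definition find_signs :: com where
  "find_signs = For ''a'' (Num 0) (Add (V ''n'') (V ''n''))
     (init_search ;; search ;; Cond (BEq (V ''bad'') (Num 0)) commit Skip)"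

lemma avars_search [simp]:
  "avars expand_clause = {''c'', ''q'', ''l'', ''mark'', ''queue'', ''e''}"
  "avars expand_literal = {''p'', ''c'', ''q'', ''l'', ''mark'', ''queue'', ''e''}"
  "avars init_search = {''t'', ''mark'', ''queue'', ''e'', ''h'', ''bad''}"
  "avars search_step = {''b'', ''bad'', ''h'', ''p'', ''c'', ''q'', ''l'', ''mark'', ''queue'', ''e''}"
  "avars search = {''b'', ''bad'', ''h'', ''p'', ''c'', ''q'', ''l'', ''mark'', ''queue'', ''e''}"
  "avars commit = {''t'', ''l'', ''sign''}"
  "avars find_signs = {''a'', ''t'', ''sign'', ''b'', ''bad'', ''h'', ''p'', ''c'', ''q'', ''l'', ''mark'', ''queue'', ''e''}"
  unfolding find_signs_def commit_def search_def search_step_def init_search_def expand_literal_def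
    expand_clause_def by auto

text \<open>One plus the code of the chosen literal, which leaves 0, the initial content of memory,
  for variables outside \<open>V0\<close>.\<close>

definition sign_code :: "literal set \<Rightarrow> nat \<Rightarrow> nat" where
  "sign_code R v = (if Pos v \<in> R then Suc (2 * v) else if Neg v \<in> R then Suc (Suc (2 * v)) else 0)"

definition signs :: "nat \<Rightarrow> literal set \<Rightarrow> store \<Rightarrow> bool" where
  "signs n R s \<longleftrightarrow> (\<forall>v<n. s ''sign'' v = sign_code R v)"

lemma sign_code_0: "sign_code R v = 0 \<longleftrightarrow> v \<notin> var ` R"
  using var_in_image_iff[of "Pos v" R] unfolding sign_code_def by auto

lemma sign_code_override:
  assumes "consistent (insert l T)"
  shows "sign_code (override_lits R (insert l T)) v =
    (if v = var l then Suc (encode_lit l) else sign_code (override_lits R T) v)"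
proof (cases "v = var l")
  case True
  have "l \<in> override_lits R (insert l T)" "neg_lit l \<notin> override_lits R (insert l T)"
    using assms unfolding override_lits_def consistent_def by auto
  then show ?thesis using True unfolding sign_code_def by (cases l) auto
next
  case False
  then have "Pos v \<in> override_lits R (insert l T) \<longleftrightarrow> Pos v \<in> override_lits R T"
    "Neg v \<in> override_lits R (insert l T) \<longleftrightarrow> Neg v \<in> override_lits R T"
    unfolding override_lits_def by auto
  then show ?thesis using False unfolding sign_code_def by simp
qed

section \<open>Searching the implication graph in time linear in the CNF\<close>

locale cnf = table +
  fixes cs :: "literal list list"
  assumes prime: "c \<in> set cs \<Longrightarrow> prime_clause (set xs) c"
    and dist: "c \<in> set cs \<Longrightarrow> distinct (map var c)"
    and vars: "c \<in> set cs \<Longrightarrow> l \<in> set c \<Longrightarrow> var l < n"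
    and len_cs: "length cs \<le> m * n"
begin

lemma clause_distinct: "c \<in> set cs \<Longrightarrow> distinct c"
  using dist distinct_map by blast

lemma clause_length: "c \<in> set cs \<Longrightarrow> length c \<le> m"
  using prime_clause_length[OF prime clause_distinct] card_length[of xs] by force

lemma total_length: "length (concat cs) \<le> m * (n * m)"
proof -
  have "length (concat cs) \<le> length cs * m"
    using clause_length unfolding length_concat
    by (induction cs) (auto intro: add_mono)
  also have "\<dots> \<le> m * n * m" using len_cs by (rule mult_le_mono1)
  finally show ?thesis by (simp add: mult.assoc)
qed

definition ready :: "store \<Rightarrow> bool" where
  "ready s \<longleftrightarrow> rows n xs s \<and> tables n s \<and> stored cs [] s \<and> links (concat cs) s"

lemma ready_same:
  assumes sm: "same X s s'" and X: "{''n'', ''m'', ''D'', ''row'', ''neg'', ''var'', ''count'', ''size'',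
    ''start'', ''lits'', ''owner'', ''head'', ''next''} \<inter> X = {}"
  shows "ready s' = ready s"
  using X unfolding ready_def tables_def links_def
  by (simp add: rows_same[OF sm] stored_same[OF sm] sameD[OF sm])

lemma ready_start: "ready s \<Longrightarrow> c \<le> length cs \<Longrightarrow> s ''start'' c = offset cs c"
  unfolding ready_def stored_def arr_def offsets_def offset_def by (auto simp: nth_append simp del: upt_Suc)

lemma ready_lit: "ready s \<Longrightarrow> c < length cs \<Longrightarrow> t < length (cs ! c) \<Longrightarrow>
    s ''lits'' (offset cs c + t) = encode_lit (cs ! c ! t)"
  using owners_nth[of c cs t] unfolding ready_def stored_def arr_def by simp

lemma ready_owner: "ready s \<Longrightarrow> c < length cs \<Longrightarrow> t < length (cs ! c) \<Longrightarrow>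
    s ''owner'' (offset cs c + t) = c"
  using owners_nth[of c cs t] unfolding ready_def stored_def arr_def by (simp add: length_owners)

lemma expand_clause:
  assumes r: "ready s" and q: "queue n qs s" and p: "s ''p'' 0 = Suc p" "p < length (concat cs)"
    and b: "s ''b'' 0 = encode_lit b" and c: "c = owners cs ! p"
  shows "run expand_clause s (100 * m) (\<lambda>s'. \<exists>qs'. queue n (qs @ qs') s' \<and>
     set (qs @ qs') = set qs \<union> (set (cs ! c) - {b}))"
proof -
  obtain c' t' where ct: "c' < length cs" "t' < length (cs ! c')" "p = offset cs c' + t'"
    using position_cases[OF p(2)] by blast
  then have cc: "c' = c" using owners_nth(3) c by simp
  have c_len: "c < length cs" using ct cc by simp
  have lc: "length (cs ! c) \<le> m" using clause_length c_len by simp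
  let ?d = "cs ! c"
  let ?c = "''l'' :=\<^sub>v Cell ''lits'' (V ''q'') ;;
       Cond (BAnd (BNot (BEq (V ''l'') (V ''b''))) (BEq (Cell ''mark'' (V ''l'')) (Num 0)))
        (Assign ''mark'' (V ''l'') (Num 1) ;; Assign ''queue'' (V ''e'') (V ''l'') ;;
         ''e'' :=\<^sub>v Add (V ''e'') (Num 1)) Skip"
  let ?I = "\<lambda>k s'. \<exists>qs'. queue n (qs @ qs') s' \<and> set (qs @ qs') = set qs \<union> (set (take k ?d) - {b})"
  let ?s1 = "s(''c'' := (s ''c'')(aval (Num 0) s := aval (Cell ''owner'' (Sub (V ''p'') (Num 1))) s))"
  have sm1: "same {''c''} s ?s1" by (simp add: same_def)
  have r1: "ready ?s1" using ready_same[OF sm1] r by simp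
  have c1: "?s1 ''c'' 0 = c" using ready_owner[OF r ct(1,2)] ct(3) cc p by simp
  have st: "?s1 ''start'' c = offset cs c" "?s1 ''start'' (Suc c) = offset cs c + length ?d"
    using ready_start[OF r1] c_len by (simp_all add: offset_Suc)
  have "run (For ''q'' (Cell ''start'' (V ''c'')) (Cell ''start'' (Add (V ''c'') (Num 1))) ?c) ?s1
    (80 * (m * 1)) (?I (length ?d))"
  proof (rule run_For_le[where I = ?I and K = 50 and N = "length ?d"])
    fix k s' assume k: "k < length ?d" "s' ''q'' 0 = aval (Cell ''start'' (V ''c'')) ?s1 + k" and I: "?I k s'"
      and sm: "same (insert ''q'' (avars ?c)) ?s1 s'"
    let ?l = "?d ! k"
    have r': "ready s'" using ready_same[OF sm] r1 by simp
    have l: "s' ''lits'' (s' ''q'' 0) = encode_lit ?l"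
      using ready_lit[OF r' c_len k(1)] k(2) c1 st(1) by simp
    have bl: "s' ''b'' 0 = encode_lit b" using b by (simp add: sameD[OF sm])
    have vl: "var ?l < n" using vars[of ?d ?l] c_len k(1) by simp
    have tk: "set (take (Suc k) ?d) = insert ?l (set (take k ?d))"
      using k(1) by (simp add: take_Suc_conv_app_nth)
    from I obtain qs' where I: "queue n (qs @ qs') s'"
      "set (qs @ qs') = set qs \<union> (set (take k ?d) - {b})" by blast
    let ?s2 = "s'(''l'' := (s' ''l'')(0 := encode_lit ?l))"
    have q2: "queue n (qs @ qs') ?s2" using I(1) unfolding queue_def by simp
    have mk: "s' ''mark'' (encode_lit ?l) = of_bool (?l \<in> set (qs @ qs'))"
      using I(1) vl unfolding queue_def by blast
    show "run ?c s' (50 * 1) (?I (Suc k))"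
    proof (cases "?l = b \<or> ?l \<in> set (qs @ qs')")
      case True
      have "set (qs @ qs') = set qs \<union> (set (take (Suc k) ?d) - {b})"
        using I(2) True unfolding tk by auto
      then have "?I (Suc k) ?s2" using q2 by blast
      then show ?thesis using True l bl mk by (auto simp: run_simps simp del: set_append)
    next
      case False
      have "set (qs @ qs' @ [?l]) = set qs \<union> (set (take (Suc k) ?d) - {b})"
        using I(2) False unfolding tk by auto
      moreover have "queue n (qs @ (qs' @ [?l])) (?s2(''mark'' := (?s2 ''mark'')(encode_lit ?l := 1),
        ''queue'' := (?s2 ''queue'')(?s2 ''e'' 0 := encode_lit ?l), ''e'' := (?s2 ''e'')(0 := Suc (?s2 ''e'' 0))))"
        using queue_append[OF q2 _ vl] False by simp
      ultimately have "?I (Suc k) (?s2(''mark'' := (?s2 ''mark'')(encode_lit ?l := 1),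
        ''queue'' := (?s2 ''queue'')(?s2 ''e'' 0 := encode_lit ?l), ''e'' := (?s2 ''e'')(0 := Suc (?s2 ''e'' 0))))"
        by blast
      then show ?thesis using False l bl mk by (auto simp: run_simps simp del: set_append)
    qed
  next
    show "?I 0 ?s1" using q unfolding queue_def by (intro exI[of _ "[]"]) simp
  next
    fix k s x show "?I k (s(''q'' := x)) = ?I k s" by (simp add: queue_def)
  qed (use lc m c1 st in auto)
  then have "run (For ''q'' (Cell ''start'' (V ''c'')) (Cell ''start'' (Add (V ''c'') (Num 1))) ?c) ?s1
    (80 * m) (?I (length ?d))" by simp
  then have "run expand_clause s (10 + 80 * m) (?I (length ?d))"
    unfolding expand_clause_def by (intro run_Seq_AssignI) simp
  then show ?thesis by (rule run_mono) (use m in auto)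
qed

text \<open>A literal occurs at most once in a clause, so \<open>owners\<close> is injective on its
  occurrences. This restates the cost of an expansion in clauses, the unit in which the search is
  paid.\<close>

lemma occurrences_card:
  "card {q. q < length (concat cs) \<and> concat cs ! q = b} \<le> card {c. c < length cs \<and> b \<in> set (cs ! c)}"
proof (rule card_inj_on_le)
  let ?A = "{q. q < length (concat cs) \<and> concat cs ! q = b}"
  show "inj_on (\<lambda>q. owners cs ! q) ?A"
  proof (rule inj_onI)
    fix p q assume p: "p \<in> ?A" and q: "q \<in> ?A" and eq: "owners cs ! p = owners cs ! q"
    obtain c t where ct: "c < length cs" "t < length (cs ! c)" "p = offset cs c + t"
      using position_cases p by blast
    obtain c' t' where ct': "c' < length cs" "t' < length (cs ! c')" "q = offset cs c' + t'"
      using position_cases q by blast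
    have cc: "c = c'" using owners_nth(3)[OF ct(1,2)] owners_nth(3)[OF ct'(1,2)] eq ct ct' by simp
    have "cs ! c ! t = b" "cs ! c' ! t' = b"
      using owners_nth(2)[OF ct(1,2)] owners_nth(2)[OF ct'(1,2)] p q ct ct' by auto
    then have "t = t'"
      using clause_distinct[of "cs ! c"] ct ct' cc nth_eq_iff_index_eq by auto
    then show "p = q" using ct ct' cc by simp
  qed
  show "(\<lambda>q. owners cs ! q) ` ?A \<subseteq> {c. c < length cs \<and> b \<in> set (cs ! c)}"
  proof (rule image_subsetI)
    fix p assume p: "p \<in> ?A"
    obtain c t where ct: "c < length cs" "t < length (cs ! c)" "p = offset cs c + t"
      using position_cases p by blast
    then have "owners cs ! p = c" "cs ! c ! t = b"
      using owners_nth[OF ct(1,2)] p by auto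
    then show "owners cs ! p \<in> {c. c < length cs \<and> b \<in> set (cs ! c)}"
      using ct(1) nth_mem[OF ct(2)] by simp
  qed
qed simp

lemma expand_literal:
  assumes r: "ready s" and q: "queue n qs s" and b: "s ''b'' 0 = encode_lit b"
  shows "run expand_literal s (120 * m * card {c. c < length cs \<and> b \<in> set (cs ! c)} + 20)
    (\<lambda>s'. \<exists>qs'. queue n (qs @ qs') s' \<and> set (qs @ qs') = set qs \<union> {l. edge (set cs) (neg_lit b) l})"
proof -
  let ?ls = "concat cs"
  \<comment> \<open>The pointer descends through the positions: \<open>N q\<close> are the
    occurrences below \<open>q\<close> still to be visited, \<open>E q\<close> is what the visited
    ones have contributed.\<close>
  define N where "N q = {p. p < q \<and> ?ls ! p = b}" for q
  define E where "E q = (\<Union>p\<in>{p. q \<le> p \<and> p < length ?ls \<and> ?ls ! p = b}. set (cs ! (owners cs ! p)) - {b})" for q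
  have fN: "finite (N q)" for q unfolding N_def by simp
  define I where "I \<phi> s' \<longleftrightarrow> (\<exists>q qs'. q \<le> length ?ls \<and> s' ''p'' 0 = prev_pos ?ls b q \<and>
    queue n (qs @ qs') s' \<and> set (qs @ qs') = set qs \<union> E q \<and> \<phi> = 120 * m * card (N q))" for \<phi> s'
  let ?s1 = "s(''p'' := (s ''p'')(aval (Num 0) s := aval (Cell ''head'' (V ''b'')) s))"
  let ?c = "expand_clause ;; ''p'' :=\<^sub>v Cell ''next'' (Sub (V ''p'') (Num 1))"
  have sm1: "same {''p''} s ?s1" by (simp add: same_def)
  have r1: "ready ?s1" using ready_same[OF sm1] r by simp
  have q1: "queue n qs ?s1" using queue_same[OF sm1] q by simp
  have E0: "E (length ?ls) = {}" unfolding E_def by auto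
  have I1: "I (120 * m * card (N (length ?ls))) ?s1"
    unfolding I_def
    by (intro exI[of _ "length ?ls"] exI[of _ "[]"])
      (use r q1 b in \<open>auto simp: E0 ready_def links_def\<close>)
  have "run (While (BLess (Num 0) (V ''p'')) ?c) ?s1
     (120 * m * card (N (length ?ls)) + bcost (BLess (Num 0) (V ''p'')) + 1)
     (\<lambda>s'. \<exists>\<phi>. I \<phi> s' \<and> \<not> bval (BLess (Num 0) (V ''p'')) s')"
  proof (rule run_While[where I = I, OF I1])
    fix \<phi> s' assume "I \<phi> s'" and bv: "bval (BLess (Num 0) (V ''p'')) s'" and sm: "same (avars ?c) ?s1 s'"
    then obtain q qs' where qq: "q \<le> length ?ls" "s' ''p'' 0 = prev_pos ?ls b q"
      "queue n (qs @ qs') s'" "set (qs @ qs') = set qs \<union> E q" "\<phi> = 120 * m * card (N q)"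
      unfolding I_def by blast
    obtain p where p: "prev_pos ?ls b q = Suc p" using bv qq(2) by (cases "prev_pos ?ls b q") auto
    have p': "p < q" "?ls ! p = b" "\<And>q'. p < q' \<Longrightarrow> q' < q \<Longrightarrow> ?ls ! q' \<noteq> b"
      using prev_pos_Suc[OF p] by auto
    have pl: "p < length ?ls" using p'(1) qq(1) by simp
    have r': "ready s'" using ready_same[OF sm] r1 by simp
    have b': "s' ''b'' 0 = encode_lit b" using b by (simp add: sameD[OF sm])
    have p0: "s' ''p'' 0 = Suc p" using qq(2) p by simp
    have Nq: "card (N q) = Suc (card (N p))"
    proof -
      have "N q = insert p (N p)"
        unfolding N_def using p' by (auto simp: not_less_iff_gr_or_eq) (metis linorder_neqE_nat)
      then show ?thesis using fN unfolding N_def by simp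
    qed
    have Eq: "E p = E q \<union> (set (cs ! (owners cs ! p)) - {b})"
    proof -
      have "{p'. p \<le> p' \<and> p' < length ?ls \<and> ?ls ! p' = b} =
        insert p {p'. q \<le> p' \<and> p' < length ?ls \<and> ?ls ! p' = b}"
        using p' pl by auto (metis le_eq_less_or_eq not_le)
      then show ?thesis unfolding E_def by auto
    qed
    have "run ?c s' (100 * m + 10) (\<lambda>s''. \<exists>\<phi>'. I \<phi>' s'' \<and> 100 * m + 10 + bcost (BLess (Num 0) (V ''p'')) + 1 + \<phi>' \<le> \<phi>)"
    proof (rule run_Seq[OF expand_clause[OF r' qq(3) p0 pl b' refl]])
      fix s2 assume "\<exists>qs''. queue n ((qs @ qs') @ qs'') s2 \<and>
        set ((qs @ qs') @ qs'') = set (qs @ qs') \<union> (set (cs ! (owners cs ! p)) - {b})"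
        and sm2: "same (avars expand_clause) s' s2"
      then obtain qs'' where q2: "queue n ((qs @ qs') @ qs'') s2"
        "set ((qs @ qs') @ qs'') = set (qs @ qs') \<union> (set (cs ! (owners cs ! p)) - {b})" by blast
      let ?s3 = "s2(''p'' := (s2 ''p'')(0 := s2 ''next'' p))"
      have "s2 ''next'' p = prev_pos ?ls b p"
        using r' pl p'(2) unfolding ready_def links_def by (simp add: sameD[OF sm2])
      moreover have "queue n (qs @ (qs' @ qs'')) ?s3" using q2(1) by (simp add: queue_def)
      moreover have "set (qs @ (qs' @ qs'')) = set qs \<union> E p" using q2(2) qq(4) Eq by auto
      ultimately have "I (120 * m * card (N p)) ?s3"
        unfolding I_def by (intro exI[of _ p] exI[of _ "qs' @ qs''"]) (use pl in auto)
      moreover have "100 * m + 10 + bcost (BLess (Num 0) (V ''p'')) + 1 + 120 * m * card (N p) \<le> \<phi>"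
        using m unfolding qq(5) Nq by simp
      ultimately have "\<exists>\<phi>'. I \<phi>' ?s3 \<and> 100 * m + 10 + bcost (BLess (Num 0) (V ''p'')) + 1 + \<phi>' \<le> \<phi>" by blast
      moreover have "s2 ''p'' 0 = Suc p" using p0 by (simp add: sameD[OF sm2])
      ultimately show "run (''p'' :=\<^sub>v Cell ''next'' (Sub (V ''p'') (Num 1))) s2 10
        (\<lambda>s''. \<exists>\<phi>'. I \<phi>' s'' \<and> 100 * m + 10 + bcost (BLess (Num 0) (V ''p'')) + 1 + \<phi>' \<le> \<phi>)"
        by (simp add: run_Assign)
    qed
    then show "\<exists>T. run ?c s' T (\<lambda>s''. \<exists>\<phi>'. I \<phi>' s'' \<and> T + bcost (BLess (Num 0) (V ''p'')) + 1 + \<phi>' \<le> \<phi>)"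
      by blast
  qed
  then have "run (While (BLess (Num 0) (V ''p'')) ?c) ?s1
     (120 * m * card {c. c < length cs \<and> b \<in> set (cs ! c)} + 10)
     (\<lambda>s'. \<exists>qs'. queue n (qs @ qs') s' \<and> set (qs @ qs') = set qs \<union> {l. edge (set cs) (neg_lit b) l})"
  proof (rule run_mono)
    have "card (N (length ?ls)) \<le> card {c. c < length cs \<and> b \<in> set (cs ! c)}"
      using occurrences_card unfolding N_def .
    then have "120 * m * card (N (length ?ls)) \<le> 120 * m * card {c. c < length cs \<and> b \<in> set (cs ! c)}"
      by (rule mult_le_mono2)
    then show "120 * m * card (N (length ?ls)) + bcost (BLess (Num 0) (V ''p'')) + 1
      \<le> 120 * m * card {c. c < length cs \<and> b \<in> set (cs ! c)} + 10"
      unfolding bcost.simps acost.simps by linarith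
    fix s' assume "\<exists>\<phi>. I \<phi> s' \<and> \<not> bval (BLess (Num 0) (V ''p'')) s'"
    then obtain q qs' where qq: "q \<le> length ?ls" "prev_pos ?ls b q = 0"
      "queue n (qs @ qs') s'" "set (qs @ qs') = set qs \<union> E q"
      unfolding I_def by auto
    have no: "?ls ! p \<noteq> b" if "p < q" for p using prev_pos_0[OF qq(2) that] .
    have "E q = {l. edge (set cs) (neg_lit b) l}"
    proof (intro equalityI subsetI)
      fix l assume "l \<in> E q"
      then obtain p where p: "p < length ?ls" "?ls ! p = b" "l \<in> set (cs ! (owners cs ! p))" "l \<noteq> b"
        unfolding E_def by blast
      obtain c t where ct: "c < length cs" "t < length (cs ! c)" "p = offset cs c + t"
        using position_cases[OF p(1)] by blast
      have "cs ! c ! t = b" "l \<in> set (cs ! c)" using owners_nth[OF ct(1,2)] ct p by auto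
      then have "b \<in> set (cs ! c)" "l \<in> set (cs ! c)" using nth_mem[OF ct(2)] by auto
      then show "l \<in> {l. edge (set cs) (neg_lit b) l}" using ct(1) p(4) unfolding edge_def by auto
    next
      fix l assume "l \<in> {l. edge (set cs) (neg_lit b) l}"
      then obtain d where d: "d \<in> set cs" "b \<in> set d" "l \<in> set d" "l \<noteq> b" unfolding edge_def by auto
      then obtain c t where ct: "c < length cs" "d = cs ! c" "t < length (cs ! c)" "b = cs ! c ! t"
        by (metis in_set_conv_nth)
      note o = owners_nth[OF ct(1,3)]
      have "q \<le> offset cs c + t" using no o(2) ct(4) by (meson not_le)
      then show "l \<in> E q" unfolding E_def using o ct d by auto
    qed
    then show "\<exists>qs'. queue n (qs @ qs') s' \<and> set (qs @ qs') = set qs \<union> {l. edge (set cs) (neg_lit b) l}"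
      using qq by auto
  qed
  then have "run expand_literal s (10 + (120 * m * card {c. c < length cs \<and> b \<in> set (cs ! c)} + 10))
     (\<lambda>s'. \<exists>qs'. queue n (qs @ qs') s' \<and> set (qs @ qs') = set qs \<union> {l. edge (set cs) (neg_lit b) l})"
    unfolding expand_literal_def by (intro run_Seq_AssignI) simp
  then show ?thesis by (rule run_mono) auto
qed

lemma init_search:
  assumes n0: "s ''n'' 0 = n" and a: "s ''a'' 0 = encode_lit a" "var a < n"
  shows "run init_search s (150 * n) (\<lambda>s'. queue n [a] s' \<and> s' ''h'' 0 = 0 \<and> s' ''bad'' 0 = 0)"
proof -
  let ?c = "Assign ''mark'' (V ''t'') (Num 0)"
  let ?rest = "Assign ''mark'' (V ''a'') (Num 1) ;; Assign ''queue'' (Num 0) (V ''a'') ;;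
     ''e'' :=\<^sub>v Num 1 ;; ''h'' :=\<^sub>v Num 0 ;; ''bad'' :=\<^sub>v Num 0"
  have "run init_search s (40 * ((n + n) * 1) + 40)
    (\<lambda>s'. queue n [a] s' \<and> s' ''h'' 0 = 0 \<and> s' ''bad'' 0 = 0)"
    unfolding init_search_def
  proof (rule run_Seq)
    show "run (For ''t'' (Num 0) (Add (V ''n'') (V ''n'')) ?c) s (40 * ((n + n) * 1))
      (\<lambda>s'. \<forall>t<n + n. s' ''mark'' t = 0)"
      by (rule run_For_le[where I = "\<lambda>t s'. \<forall>u<t. s' ''mark'' u = 0" and K = 4 and N = "n + n"])
        (use n0 n in \<open>auto simp: run_simps less_Suc_eq\<close>)
    fix s' assume z: "\<forall>t<n + n. s' ''mark'' t = 0"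
      and sm: "same (avars (For ''t'' (Num 0) (Add (V ''n'') (V ''n'')) ?c)) s s'"
    have "s' ''a'' 0 = encode_lit a" using a by (simp add: sameD[OF sm])
    then show "run ?rest s' 40 (\<lambda>s'. queue n [a] s' \<and> s' ''h'' 0 = 0 \<and> s' ''bad'' 0 = 0)"
      using z a(2) encode_lit_less[of _ n] by (auto simp: run_simps queue_def arr_def)
  qed
  then show ?thesis by (rule run_mono) (use n in auto)
qed

text \<open>Every queued literal is forced by \<open>a\<close>. Hence an inconsistent queue shows
  that no closed consistent set contains \<open>a\<close>.\<close>

definition reached :: "literal \<Rightarrow> literal list \<Rightarrow> bool" where
  "reached a qs \<longleftrightarrow> a \<in> set qs \<and> (\<forall>R. closed_lits (set cs) R \<and> a \<in> R \<longrightarrow> set qs \<subseteq> R)"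

text \<open>Clauses that the search has not expanded yet: expanding a clause marks all its other
  literals, so as long as no conflict shows up it is expanded only once.\<close>

definition fresh_clauses :: "literal list \<Rightarrow> nat set" where
  "fresh_clauses ps = {c. c < length cs \<and> (\<forall>x\<in>set ps. neg_lit x \<notin> set (cs ! c))}"

text \<open>The potential reserves 80 steps for each literal that may still be dequeued and
  \<open>120 * m\<close> for each clause not yet opened. After a conflict the loop stops and nothing
  is owed.\<close>

definition search_inv :: "literal \<Rightarrow> nat \<Rightarrow> store \<Rightarrow> bool" where
  "search_inv a \<phi> s \<longleftrightarrow> (\<exists>qs h. queue n qs s \<and> s ''h'' 0 = h \<and> h \<le> length qs \<and> reached a qs \<and>
     ((s ''bad'' 0 = 1 \<and> \<not> consistent (set qs) \<and> \<phi> = 0) \<or>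
      (s ''bad'' 0 = 0 \<and> consistent (set (take h qs)) \<and>
       (\<forall>x\<in>set (take h qs). \<forall>l. edge (set cs) x l \<longrightarrow> l \<in> set qs) \<and>
       \<phi> = 80 * (n + n - h) + 120 * m * card (fresh_clauses (take h qs)))))"

lemma search_step:
  assumes r: "ready s" and I: "search_inv a \<phi> s" and b: "s ''h'' 0 < s ''e'' 0" "s ''bad'' 0 = 0"
  shows "\<exists>T. run search_step s T (\<lambda>s'. \<exists>\<phi>'. search_inv a \<phi>' s' \<and> T + 20 + \<phi>' \<le> \<phi>)"
proof -
  from I b obtain qs h where q: "queue n qs s" and h: "s ''h'' 0 = h" and hl: "h < length qs"
    and re: "reached a qs" and con: "consistent (set (take h qs))"
    and cl: "\<And>x l. x \<in> set (take h qs) \<Longrightarrow> edge (set cs) x l \<Longrightarrow> l \<in> set qs"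
    and \<phi>: "\<phi> = 80 * (n + n - h) + 120 * m * card (fresh_clauses (take h qs))"
    unfolding search_inv_def queue_def by fastforce
  have hn: "h < n + n" using queue_length[OF q] hl by simp
  let ?x = "qs ! h"
  have x: "?x \<in> set qs" using hl by simp
  have vx: "var ?x < n" using q x unfolding queue_def by blast
  have qx: "s ''queue'' h = encode_lit ?x" using q hl unfolding queue_def arr_def by simp
  have nx: "s ''neg'' (encode_lit ?x) = encode_lit (neg_lit ?x)"
    using r vx unfolding ready_def tables_def by blast
  have mk: "s ''mark'' (encode_lit (neg_lit ?x)) = of_bool (neg_lit ?x \<in> set qs)"
    using q vx unfolding queue_def by simp
  have tk: "take (Suc h) qs = take h qs @ [?x]" using hl by (rule take_Suc_conv_app_nth)
  let ?s1 = "s(''b'' := (s ''b'')(aval (Num 0) s := aval (Cell ''neg'' (Cell ''queue'' (V ''h''))) s))"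
  have sm1: "same {''b''} s ?s1" by (simp add: same_def)
  have b1: "?s1 ''b'' 0 = encode_lit (neg_lit ?x)" using h qx nx by simp
  have q1: "queue n qs ?s1" using queue_same[OF sm1] q by simp
  have r1: "ready ?s1" using ready_same[OF sm1] r by simp
  show ?thesis
  proof (cases "neg_lit ?x \<in> set qs")
    case True
    have inc: "\<not> consistent (set qs)" using True x unfolding consistent_def by blast
    let ?s2 = "?s1(''bad'' := (?s1 ''bad'')(0 := 1))"
    have "queue n qs ?s2" using q1 by (simp add: queue_def)
    then have "search_inv a 0 ?s2"
      unfolding search_inv_def using h hl re inc
      by (intro exI[of _ qs] exI[of _ h]) auto
    moreover have "50 + 20 + 0 \<le> \<phi>" unfolding \<phi> using hn by simp
    ultimately have "\<exists>\<phi>'. search_inv a \<phi>' ?s2 \<and> 50 + 20 + \<phi>' \<le> \<phi>" by blast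
    then have "run search_step s 50 (\<lambda>s'. \<exists>\<phi>'. search_inv a \<phi>' s' \<and> 50 + 20 + \<phi>' \<le> \<phi>)"
      unfolding search_step_def using h qx nx mk True by (simp add: run_simps)
    then show ?thesis by blast
  next
    case False
    define K where "K = {c. c < length cs \<and> neg_lit ?x \<in> set (cs ! c)}"
    \<comment> \<open>If an earlier literal \<open>y\<close> had already opened a clause with
      \<open>neg_lit ?x\<close>, the edge from \<open>y\<close> would have put
      \<open>neg_lit ?x\<close> into the queue, which is the conflict excluded in this case.\<close>
    have fr: "K \<subseteq> fresh_clauses (take h qs)"
    proof
      fix c assume c: "c \<in> K"
      have "neg_lit y \<notin> set (cs ! c)" if y: "y \<in> set (take h qs)" for y
      proof
        assume ny: "neg_lit y \<in> set (cs ! c)"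
        have "?x \<notin> set (take h qs)"
          using q hl distinct_take[of qs "Suc h"] unfolding queue_def tk by simp
        then have "neg_lit ?x \<noteq> neg_lit y" using y by auto
        then have "edge (set cs) y (neg_lit ?x)"
          using c ny unfolding K_def edge_def by auto
        then show False using cl[OF y] False by blast
      qed
      then show "c \<in> fresh_clauses (take h qs)" using c unfolding K_def fresh_clauses_def by blast
    qed
    have fin: "finite (fresh_clauses ps)" for ps unfolding fresh_clauses_def by simp
    have "fresh_clauses (take (Suc h) qs) = fresh_clauses (take h qs) - K"
      unfolding tk fresh_clauses_def K_def by auto
    then have cf: "card (fresh_clauses (take h qs)) = card (fresh_clauses (take (Suc h) qs)) + card K"
      using card_Diff_subset[OF finite_subset[OF fr fin] fr] card_mono[OF fin fr] by simp
    let ?T = "120 * m * card K + 20 + 30"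
    have "run (expand_literal ;; ''h'' :=\<^sub>v Add (V ''h'') (Num 1)) ?s1 (120 * m * card K + 20 + 10)
      (\<lambda>s'. \<exists>\<phi>'. search_inv a \<phi>' s' \<and> ?T + 20 + \<phi>' \<le> \<phi>)"
    proof (rule run_Seq)
      show "run expand_literal ?s1 (120 * m * card K + 20)
        (\<lambda>s'. \<exists>qs'. queue n (qs @ qs') s' \<and> set (qs @ qs') = set qs \<union> {l. edge (set cs) (neg_lit (neg_lit ?x)) l})"
        unfolding K_def by (rule expand_literal[OF r1 q1 b1])
      fix s2 assume "\<exists>qs'. queue n (qs @ qs') s2 \<and> set (qs @ qs') = set qs \<union> {l. edge (set cs) (neg_lit (neg_lit ?x)) l}"
        and sm2: "same (avars expand_literal) ?s1 s2"
      then obtain qs' where q2: "queue n (qs @ qs') s2"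
        "set (qs @ qs') = set qs \<union> {l. edge (set cs) ?x l}" by auto
      let ?s3 = "s2(''h'' := (s2 ''h'')(0 := Suc h))"
      let ?\<phi> = "80 * (n + n - Suc h) + 120 * m * card (fresh_clauses (take (Suc h) qs))"
      have tk': "take (Suc h) (qs @ qs') = take (Suc h) qs" using hl by simp
      have "reached a (qs @ qs')"
        using re x closed_litsD[of "set cs" _ ?x] unfolding reached_def q2(2) by auto
      moreover have "consistent (set (take (Suc h) qs))"
        unfolding tk consistent_def
      proof
        fix l assume l: "l \<in> set (take h qs @ [?x])"
        have sub: "set (take h qs) \<subseteq> set qs" by (rule set_take_subset)
        show "neg_lit l \<notin> set (take h qs @ [?x])"
        proof (cases "l = ?x")
          case True
          then show ?thesis using False sub by auto
        next
          case l': False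
          then have "l \<in> set (take h qs)" using l by simp
          then have "neg_lit l \<notin> set (take h qs)" "l \<noteq> neg_lit ?x"
            using con sub False unfolding consistent_def by auto
          moreover have "neg_lit l \<noteq> ?x" using \<open>l \<noteq> neg_lit ?x\<close> by (metis neg_neg_lit)
          ultimately show ?thesis by simp
        qed
      qed
      moreover have "\<forall>y\<in>set (take (Suc h) qs). \<forall>l. edge (set cs) y l \<longrightarrow> l \<in> set (qs @ qs')"
        unfolding tk q2(2) using cl by auto
      moreover have "queue n (qs @ qs') ?s3" using q2(1) by (simp add: queue_def)
      moreover have "s2 ''bad'' 0 = 0" using b by (simp add: sameD[OF sm2])
      ultimately have "search_inv a ?\<phi> ?s3"
        unfolding search_inv_def using hl tk'
        by (intro exI[of _ "qs @ qs'"] exI[of _ "Suc h"]) auto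
      moreover have "?T + 20 + ?\<phi> \<le> \<phi>"
      proof -
        have "n + n - h = Suc (n + n - Suc h)" using hn by simp
        then show ?thesis unfolding \<phi> cf by (simp add: distrib_left)
      qed
      ultimately have "\<exists>\<phi>'. search_inv a \<phi>' ?s3 \<and> ?T + 20 + \<phi>' \<le> \<phi>" by blast
      moreover have "s2 ''h'' 0 = h" using h by (simp add: sameD[OF sm2])
      ultimately show "run (''h'' :=\<^sub>v Add (V ''h'') (Num 1)) s2 10
        (\<lambda>s'. \<exists>\<phi>'. search_inv a \<phi>' s' \<and> ?T + 20 + \<phi>' \<le> \<phi>)" by (simp add: run_Assign)
    qed
    then have "run (Cond (BEq (Cell ''mark'' (V ''b'')) (Num 1)) (''bad'' :=\<^sub>v Num 1)
      (expand_literal ;; ''h'' :=\<^sub>v Add (V ''h'') (Num 1))) ?s1 (120 * m * card K + 20 + 10 + 6)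
      (\<lambda>s'. \<exists>\<phi>'. search_inv a \<phi>' s' \<and> ?T + 20 + \<phi>' \<le> \<phi>)"
      by (rule run_Cond_False[rotated]) (use mk False h qx nx in simp_all)
    then have "run search_step s (10 + (120 * m * card K + 20 + 10 + 6)) (\<lambda>s'. \<exists>\<phi>'. search_inv a \<phi>' s' \<and> ?T + 20 + \<phi>' \<le> \<phi>)"
      unfolding search_step_def by (intro run_Seq_AssignI) simp
    then have "run search_step s ?T (\<lambda>s'. \<exists>\<phi>'. search_inv a \<phi>' s' \<and> ?T + 20 + \<phi>' \<le> \<phi>)"
      by (rule run_mono) auto
    then show ?thesis by blast
  qed
qed

lemma search:
  assumes r: "ready s" and q: "queue n [a] s" and h: "s ''h'' 0 = 0" "s ''bad'' 0 = 0"
  shows "run search s (400 * (n * (m * m))) (\<lambda>s'. \<exists>qs. queue n qs s' \<and> reached a qs \<and>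
     ((s' ''bad'' 0 = 1 \<and> \<not> consistent (set qs)) \<or>
      (s' ''bad'' 0 = 0 \<and> consistent (set qs) \<and> closed_lits (set cs) (set qs))))"
proof -
  let ?b = "BAnd (BLess (V ''h'') (V ''e'')) (BEq (V ''bad'') (Num 0))"
  let ?\<phi> = "80 * (n + n) + 120 * m * length cs"
  have "fresh_clauses [] = {..<length cs}" unfolding fresh_clauses_def by auto
  then have I: "search_inv a ?\<phi> s"
    unfolding search_inv_def reached_def
    by (intro exI[of _ "[a]"] exI[of _ 0]) (use q h in \<open>auto simp: consistent_def\<close>)
  have "run search s (?\<phi> + bcost ?b + 1) (\<lambda>s'. \<exists>\<phi>. search_inv a \<phi> s' \<and> \<not> bval ?b s')"
    unfolding search_def
  proof (rule run_While[where I = "search_inv a", OF I])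
    fix \<phi> s' assume I: "search_inv a \<phi> s'" and b: "bval ?b s'" and sm: "same (avars search_step) s s'"
    have r': "ready s'" using ready_same[OF sm] r by simp
    obtain T where T: "run search_step s' T (\<lambda>s'. \<exists>\<phi>'. search_inv a \<phi>' s' \<and> T + 20 + \<phi>' \<le> \<phi>)"
      using search_step[OF r' I] b by auto
    have "run search_step s' T (\<lambda>s'. \<exists>\<phi>'. search_inv a \<phi>' s' \<and> T + bcost ?b + 1 + \<phi>' \<le> \<phi>)"
      by (rule run_mono[OF T]) auto
    then show "\<exists>T. run search_step s' T (\<lambda>s'. \<exists>\<phi>'. search_inv a \<phi>' s' \<and> T + bcost ?b + 1 + \<phi>' \<le> \<phi>)" by blast
  qed
  then show ?thesis
  proof (rule run_mono)
    have "n \<le> n * (m * m)" "1 \<le> n * (m * m)" using m n by auto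
    moreover have "m * length cs \<le> n * (m * m)"
      using mult_le_mono2[OF len_cs, of m] by (simp add: mult.commute mult.left_commute)
    moreover have "p \<le> P \<Longrightarrow> 1 \<le> P \<Longrightarrow> l \<le> P \<Longrightarrow> 80 * (p + p) + 120 * l + 15 \<le> 400 * P"
      for p P l :: nat by simp
    ultimately have "80 * (n + n) + 120 * (m * length cs) + 15 \<le> 400 * (n * (m * m))" by blast
    then show "?\<phi> + bcost ?b + 1 \<le> 400 * (n * (m * m))" by simp
    fix s' assume "\<exists>\<phi>. search_inv a \<phi> s' \<and> \<not> bval ?b s'"
    then obtain \<phi> where \<phi>: "search_inv a \<phi> s'" "\<not> bval ?b s'" by blast
    then obtain qs h where q: "queue n qs s'" "s' ''h'' 0 = h" "h \<le> length qs" "reached a qs" and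
      d: "(s' ''bad'' 0 = 1 \<and> \<not> consistent (set qs)) \<or>
      (s' ''bad'' 0 = 0 \<and> consistent (set (take h qs)) \<and>
       (\<forall>x\<in>set (take h qs). \<forall>l. edge (set cs) x l \<longrightarrow> l \<in> set qs))"
      unfolding search_inv_def by blast
    have "s' ''bad'' 0 = 0 \<longrightarrow> take h qs = qs"
      using \<phi>(2) q unfolding queue_def by auto
    then show "\<exists>qs. queue n qs s' \<and> reached a qs \<and>
     ((s' ''bad'' 0 = 1 \<and> \<not> consistent (set qs)) \<or>
      (s' ''bad'' 0 = 0 \<and> consistent (set qs) \<and> closed_lits (set cs) (set qs)))"
      using q d unfolding closed_lits_def by (intro exI[of _ qs]) auto
  qed
qed

lemma commit:
  assumes t: "tables n s" and q: "queue n qs s" and con: "consistent (set qs)" and R: "signs n R s"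
  shows "run commit s (100 * n) (signs n (override_lits R (set qs)))"
proof -
  let ?c = "''l'' :=\<^sub>v Cell ''queue'' (V ''t'') ;; Assign ''sign'' (Cell ''var'' (V ''l'')) (Add (V ''l'') (Num 1))"
  have "run commit s (50 * ((n + n) * 1)) (signs n (override_lits R (set qs)))"
    unfolding commit_def
  proof (rule run_For_le[where I = "\<lambda>t. signs n (override_lits R (set (take t qs)))" and K = 20 and N = "length qs"])
    fix t s' assume h: "t < length qs" "s' ''t'' 0 = aval (Num 0) s + t"
      and I: "signs n (override_lits R (set (take t qs))) s'" and sm: "same (insert ''t'' (avars ?c)) s s'"
    let ?l = "qs ! t"
    have tk: "set (take (Suc t) qs) = insert ?l (set (take t qs))"
      using h by (simp add: take_Suc_conv_app_nth)
    have "set (take (Suc t) qs) \<subseteq> set qs" by (rule set_take_subset)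
    then have c: "consistent (insert ?l (set (take t qs)))"
      using con unfolding tk consistent_def by blast
    have vl: "var ?l < n" using q h unfolding queue_def by simp
    have e: "s' ''queue'' t = encode_lit ?l" "s' ''var'' (encode_lit ?l) = var ?l"
      using q assms(1) h vl unfolding queue_def arr_def tables_def by (auto simp: sameD[OF sm])
    show "run ?c s' (20 * 1) (signs n (override_lits R (set (take (Suc t) qs))))"
      using h e I unfolding tk by (simp add: run_simps signs_def sign_code_override[OF c])
  next
    show "signs n (override_lits R (set (take 0 qs))) s" using R by (simp add: override_lits_def)
  qed (use q queue_length[OF q] n in \<open>auto simp: signs_def queue_def\<close>)
  then show ?thesis by simp
qed

definition search_from :: com where
  "search_from = (init_search ;; search ;; Cond (BEq (V ''bad'') (Num 0)) commit Skip)"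

text \<open>Maximality is recorded for the search roots with code below \<open>a\<close>. It
  concerns variables only, since \<open>R\<close> may have settled a variable by the opposite
  literal.\<close>

definition good_signs :: "nat \<Rightarrow> literal set \<Rightarrow> bool" where
  "good_signs a R \<longleftrightarrow> closed_lits (set cs) R \<and> consistent R \<and> var ` R \<subseteq> {..<n} \<and>
     (\<forall>l R'. encode_lit l < a \<and> closed_lits (set cs) R' \<and> consistent R' \<and> l \<in> R' \<longrightarrow> var l \<in> var ` R)"

lemma search_from:
  assumes r: "ready s" and a: "s ''a'' 0 = encode_lit a" "var a < n"
    and R: "signs n R s" "good_signs (encode_lit a) R"
  shows "run search_from s (700 * (n * (m * m))) (\<lambda>s'. \<exists>R. signs n R s' \<and> good_signs (Suc (encode_lit a)) R)"
proof -
  let ?Q = "\<lambda>s'. \<exists>R. signs n R s' \<and> good_signs (Suc (encode_lit a)) R"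
  have n0: "s ''n'' 0 = n" using r unfolding ready_def rows_def by blast
  have "run search_from s (150 * n + (400 * (n * (m * m)) + (100 * n + 10))) ?Q"
    unfolding search_from_def
  proof (rule run_Seq[OF init_search[of s a, OF n0 a]])
    fix s1 assume i: "queue n [a] s1 \<and> s1 ''h'' 0 = 0 \<and> s1 ''bad'' 0 = 0" and sm: "same (avars init_search) s s1"
    have r1: "ready s1" using ready_same[OF sm] r by simp
    have R1: "signs n R s1" using R(1) unfolding signs_def by (simp add: sameD[OF sm])
    show "run (search ;; Cond (BEq (V ''bad'') (Num 0)) commit Skip) s1
       (400 * (n * (m * m)) + (100 * n + 10)) ?Q"
    proof (rule run_Seq[OF search[OF r1, of a]])
      show "queue n [a] s1" "s1 ''h'' 0 = 0" "s1 ''bad'' 0 = 0" using i by auto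
      fix s2 assume "\<exists>qs. queue n qs s2 \<and> reached a qs \<and>
         ((s2 ''bad'' 0 = 1 \<and> \<not> consistent (set qs)) \<or>
          (s2 ''bad'' 0 = 0 \<and> consistent (set qs) \<and> closed_lits (set cs) (set qs)))"
        and sm2: "same (avars search) s1 s2"
      then obtain qs where q: "queue n qs s2" "reached a qs" and d: "(s2 ''bad'' 0 = 1 \<and> \<not> consistent (set qs)) \<or>
          (s2 ''bad'' 0 = 0 \<and> consistent (set qs) \<and> closed_lits (set cs) (set qs))" by blast
      have r2: "ready s2" using ready_same[OF sm2] r1 by simp
      have R2: "signs n R s2" using R1 unfolding signs_def by (simp add: sameD[OF sm2])
      show "run (Cond (BEq (V ''bad'') (Num 0)) commit Skip) s2 (100 * n + 10) ?Q"
        using d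
      proof
        assume bad: "s2 ''bad'' 0 = 1 \<and> \<not> consistent (set qs)"
        \<comment> \<open>A closed set with \<open>a\<close> contains the whole queue, which is
          inconsistent.\<close>
        have "\<not> (closed_lits (set cs) R' \<and> consistent R' \<and> a \<in> R')" for R'
          using bad q(2) unfolding reached_def consistent_def by blast
        then have "good_signs (Suc (encode_lit a)) R"
          using R(2) unfolding good_signs_def by (auto simp: less_Suc_eq)
        then show ?thesis using R2 bad by (auto simp: run_simps)
      next
        assume ok: "s2 ''bad'' 0 = 0 \<and> consistent (set qs) \<and> closed_lits (set cs) (set qs)"
        \<comment> \<open>Overriding may change earlier choices of literals but loses no variable,
          so the maximality reached so far is kept.\<close>
        let ?R = "override_lits R (set qs)"
        have "a \<in> set qs" using q(2) unfolding reached_def by blast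
        then have "var a \<in> var ` ?R" unfolding var_override by blast
        moreover have "var ` set qs \<subseteq> {..<n}" using q(1) unfolding queue_def by auto
        moreover have "closed_lits (set cs) ?R" "consistent ?R"
          using R(2) ok closed_override consistent_override unfolding good_signs_def by auto
        ultimately have good: "good_signs (Suc (encode_lit a)) ?R"
          using R(2) unfolding good_signs_def var_override by (auto simp: less_Suc_eq)
        have "tables n s2" using r2 unfolding ready_def by blast
        from commit[OF this q(1) _ R2] ok have "run commit s2 (100 * n) (signs n ?R)" by blast
        then have "run commit s2 (100 * n + 5) ?Q" by (rule run_mono) (use good in auto)
        then show ?thesis by (rule run_Cond_True[rotated]) (use ok in simp_all)
      qed
    qed
  qed
  then show ?thesis
  proof (rule run_mono)
    have "n \<le> n * (m * m)" "1 \<le> n * (m * m)" using m n by auto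
    then show "150 * n + (400 * (n * (m * m)) + (100 * n + 10)) \<le> 700 * (n * (m * m))" by linarith
  qed
qed

lemma find_signs:
  assumes r: "ready s" and s0: "s ''sign'' = (\<lambda>_. 0)"
  shows "run find_signs s (1600 * (n * (n * (m * m)))) (\<lambda>s'. \<exists>R. signs n R s' \<and>
    closed_lits (set cs) R \<and> consistent R \<and> var ` R \<subseteq> {..<n} \<and> horn_vars (set cs) \<inter> {..<n} \<subseteq> var ` R)"
proof -
  let ?I = "\<lambda>a s'. \<exists>R. signs n R s' \<and> good_signs a R"
  have "run find_signs s (800 * ((n + n) * (n * (m * m)))) (?I (n + n))"
    unfolding find_signs_def search_from_def[symmetric]
  proof (rule run_For_le[where I = ?I and K = 700 and N = "n + n"])
    have "good_signs 0 {}" unfolding good_signs_def closed_lits_def consistent_def by simp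
    moreover have "signs n {} s" using s0 unfolding signs_def sign_code_def by simp
    ultimately show "?I 0 s" by blast
  next
    fix a s' assume a: "a < n + n" "s' ''a'' 0 = aval (Num 0) s + a" and I: "?I a s'"
      and sm: "same (insert ''a'' (avars search_from)) s s'"
    obtain l where l: "encode_lit l = a" by (rule encode_lit_surj)
    have vl: "var l < n" using a(1) encode_lit_less[of l n] l by simp
    have "ready s'" using ready_same[OF sm] r by (simp add: search_from_def)
    then show "run search_from s' (700 * (n * (m * m))) (?I (Suc a))"
      using search_from[of s' l] a I l vl by auto
  qed (use r n m in \<open>auto simp: search_from_def signs_def ready_def rows_def\<close>)
  then show ?thesis
  proof (rule run_mono)
    fix s' assume "?I (n + n) s'"
    then obtain R where R: "signs n R s'" "good_signs (n + n) R" by blast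
    have "horn_vars (set cs) \<inter> {..<n} \<subseteq> var ` R"
    proof
      fix v assume "v \<in> horn_vars (set cs) \<inter> {..<n}"
      then obtain R' l where "closed_lits (set cs) R'" "consistent R'" "l \<in> R'" "v = var l" "var l < n"
        unfolding horn_vars_def by auto
      then show "v \<in> var ` R" using R(2) encode_lit_less[of l n] unfolding good_signs_def by blast
    qed
    then show "\<exists>R. signs n R s' \<and> closed_lits (set cs) R \<and> consistent R \<and> var ` R \<subseteq> {..<n} \<and>
      horn_vars (set cs) \<inter> {..<n} \<subseteq> var ` R"
      using R unfolding good_signs_def by blast
  qed (simp add: algebra_simps)
qed

end

section \<open>The integrity constraint\<close>

definition triggered :: "nat set \<Rightarrow> nat set \<Rightarrow> literal list \<Rightarrow> bool" where
  "triggered V0 Z c \<longleftrightarrow> 3 \<le> length (filter (\<lambda>l. var l \<notin> V0) c) \<or> (\<exists>l\<in>set c. var l \<notin> V0 \<and> var l \<in> Z)"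

text \<open>All literals outside \<open>V0\<close> go under the exclusive or, whether or not they
  are in \<open>Z\<close>. Once \<open>Z\<close> is a fixed point of the marking, a clause with one
  of them in \<open>Z\<close> has all of them in \<open>Z\<close>.\<close>

definition to_clause :: "nat set \<Rightarrow> nat set \<Rightarrow> literal list \<Rightarrow> clause" where
  "to_clause V0 Z c = (if \<exists>l\<in>set c. var l \<notin> V0 \<and> var l \<in> Z
     then DisjXor (filter (\<lambda>l. var l \<in> V0) c) (filter (\<lambda>l. var l \<notin> V0) c) else Disj c)"

lemma clause_vars_to_clause: "clause_vars (to_clause V0 Z c) = var ` set c"
  unfolding clause_vars_def to_clause_def by auto

lemma set_to_clause: "set (clause_lits (to_clause V0 Z c)) = set c"
  unfolding to_clause_def by auto

lemma clause_lits_rename: "clause_lits (rename_clause W c) = map (rename_lit W) (clause_lits c)"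
  by (cases c) auto

lemma var_rename_lit [simp]: "var (rename_lit W l) = var l"
  by (cases l) auto

lemma clause_vars_rename: "clause_vars (rename_clause W c) = clause_vars c"
  unfolding clause_vars_def clause_lits_rename by (simp add: image_image)

text \<open>Flipping exactly the variables with \<open>Pos v\<close> in \<open>R\<close> makes the
  literals of \<open>R\<close> negative and their complements positive.\<close>

lemma is_Pos_rename:
  assumes "consistent R" "var l \<in> var ` R"
  shows "is_Pos (rename_lit {v. Pos v \<in> R} l) \<longleftrightarrow> neg_lit l \<in> R"
  using assms unfolding var_in_image_iff consistent_def by (cases l) auto

lemma length_filter_le_1:
  assumes "distinct c" "\<And>l l'. l \<in> set c \<Longrightarrow> l' \<in> set c \<Longrightarrow> P l \<Longrightarrow> P l' \<Longrightarrow> l = l'"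
  shows "length (filter P c) \<le> 1"
proof -
  have "card {l\<in>set c. P l} \<le> Suc 0"
    unfolding card_le_Suc0_iff_eq[of "{l\<in>set c. P l}", simplified] using assms(2) by simp
  then show ?thesis using distinct_card[of "filter P c"] assms(1) by simp
qed

text \<open>A literal over \<open>V0\<close> that is positive after the renaming has its complement
  in \<open>R\<close>, so closedness puts all other literals of its clause into \<open>R\<close>.
  They are then negative and over \<open>V0\<close>. This gives the Horn condition and excludes
  positive \<open>V0\<close> literals next to outside variables.\<close>

lemma partially_horn_rename:
  assumes dist: "\<And>c. c \<in> set cs \<Longrightarrow> distinct (map var c)"
    and R: "closed_lits (set cs) R" "consistent R"
    and Z: "Z \<inter> var ` R = {}"
  shows "partially_horn (var ` R) (rename {v. Pos v \<in> R} (map (to_clause (var ` R) Z) cs))"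
  unfolding partially_horn_def
proof
  let ?V0 = "var ` R" and ?W = "{v. Pos v \<in> R}"
  fix d assume "d \<in> set (rename ?W (map (to_clause ?V0 Z) cs))"
  then obtain c where c: "c \<in> set cs" and d: "d = rename_clause ?W (to_clause ?V0 Z c)"
    unfolding rename_def by auto
  have cv: "clause_vars d = var ` set c"
    unfolding d clause_vars_rename clause_vars_to_clause ..
  have step: "l' \<in> R" if "l \<in> set c" "l' \<in> set c" "l \<noteq> l'" "neg_lit l \<in> R" for l l'
    using closed_litsD[OF R(1) that(4), of l'] that c unfolding edge_def by auto
  show "(clause_vars d \<subseteq> ?V0 \<longrightarrow> length (filter is_Pos (clause_lits d)) \<le> 1) \<and>
    (\<not> clause_vars d \<subseteq> ?V0 \<longrightarrow> (\<forall>l\<in>set (clause_lits d). var l \<in> ?V0 \<longrightarrow> is_Neg l))"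
  proof (intro conjI impI ballI)
    assume sub: "clause_vars d \<subseteq> ?V0"
    then have V0: "\<And>l. l \<in> set c \<Longrightarrow> var l \<in> ?V0" unfolding cv by auto
    then have "to_clause ?V0 Z c = Disj c" unfolding to_clause_def by auto
    then have "length (filter is_Pos (clause_lits d)) = length (filter (\<lambda>l. is_Pos (rename_lit ?W l)) c)"
      unfolding d clause_lits_rename by (simp add: filter_map comp_def)
    also have "\<dots> \<le> 1"
    proof (rule length_filter_le_1)
      show "distinct c" using dist[OF c] by (simp add: distinct_map)
      fix l l' assume l: "l \<in> set c" "l' \<in> set c" "is_Pos (rename_lit ?W l)" "is_Pos (rename_lit ?W l')"
      then have "neg_lit l \<in> R" "neg_lit l' \<in> R" using is_Pos_rename[OF R(2)] V0 by auto
      then show "l = l'" using step[OF l(1,2)] R(2) unfolding consistent_def by blast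
    qed
    finally show "length (filter is_Pos (clause_lits d)) \<le> 1" .
  next
    fix l0 assume "\<not> clause_vars d \<subseteq> ?V0" and l0: "l0 \<in> set (clause_lits d)" "var l0 \<in> ?V0"
    then obtain u where u: "u \<in> set c" "var u \<notin> ?V0" unfolding cv by auto
    obtain l where l: "l \<in> set c" "l0 = rename_lit ?W l"
      using l0(1) set_to_clause[of ?V0 Z c] unfolding d clause_lits_rename by auto
    have vl: "var l \<in> ?V0" using l0(2) l(2) by simp
    have "u \<noteq> l" using u(2) vl by auto
    moreover have "u \<notin> R" using u(2) by auto
    ultimately have "neg_lit l \<notin> R" using step[OF l(1) u(1)] by auto
    then have "\<not> is_Pos l0" using is_Pos_rename[OF R(2) vl] l(2) by simp
    then show "is_Neg l0" by (cases l0) auto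
  qed
qed

text \<open>With \<open>V2 = Z\<close> and \<open>V1\<close> the remaining variables, the closure
  condition \<open>fixed\<close> leaves two kinds of clauses: triggered ones have no variable in
  \<open>V1\<close>, the others have at most two literals outside \<open>V0\<close>.\<close>

lemma lpic_to_clause:
  assumes dist: "\<And>c. c \<in> set cs \<Longrightarrow> distinct (map var c)"
    and vars: "\<And>c l. c \<in> set cs \<Longrightarrow> l \<in> set c \<Longrightarrow> var l < n"
    and R: "closed_lits (set cs) R" "consistent R" "var ` R \<subseteq> {..<n}"
    and Z: "Z \<subseteq> {..<n} - var ` R"
    and fixed: "\<And>c l. c \<in> set cs \<Longrightarrow> triggered (var ` R) Z c \<Longrightarrow> l \<in> set c \<Longrightarrow> var l \<notin> var ` R \<Longrightarrow> var l \<in> Z"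
  shows "lpic n (map (to_clause (var ` R) Z) cs)"
proof -
  let ?V0 = "var ` R" and ?\<phi> = "map (to_clause (var ` R) Z) cs"
  let ?V1 = "{..<n} - ?V0 - Z"
  have all: "P d" if "d \<in> set ?\<phi>" "\<And>c. c \<in> set cs \<Longrightarrow> P (to_clause ?V0 Z c)" for P d
    using that by auto
  have mix: "triggered ?V0 Z c" if "l \<in> set c" "var l \<in> Z" for c l
    using that Z unfolding triggered_def by auto
  have p: "\<exists>W\<subseteq>?V0. partially_horn ?V0 (rename W ?\<phi>)"
    using partially_horn_rename[OF dist R(1,2), of Z] Z
    by (intro exI[of _ "{v. Pos v \<in> R}"] conjI subsetI) (use image_eqI[of _ var "Pos _" R] in force)+
  have 1: "\<forall>d\<in>set ?\<phi>. clause_vars d \<subseteq> {..<n}"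
    using vars by (auto simp: clause_vars_to_clause)
  have 2: "\<forall>d\<in>set ?\<phi>. clause_vars d \<inter> ?V1 = {} \<or> clause_vars d \<inter> Z = {}"
  proof
    fix d assume "d \<in> set ?\<phi>"
    then show "clause_vars d \<inter> ?V1 = {} \<or> clause_vars d \<inter> Z = {}"
    proof (rule all)
      fix c assume c: "c \<in> set cs"
      show "clause_vars (to_clause ?V0 Z c) \<inter> ?V1 = {} \<or> clause_vars (to_clause ?V0 Z c) \<inter> Z = {}"
        unfolding clause_vars_to_clause using fixed[OF c] mix[of _ c] by fastforce
    qed
  qed
  have 3: "\<forall>d\<in>set ?\<phi>. card (clause_vars d \<inter> ?V1) \<le> 2"
  proof
    fix d assume "d \<in> set ?\<phi>"
    then show "card (clause_vars d \<inter> ?V1) \<le> 2"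
    proof (rule all)
      fix c assume c: "c \<in> set cs"
      show "card (clause_vars (to_clause ?V0 Z c) \<inter> ?V1) \<le> 2"
      proof (cases "triggered ?V0 Z c")
        case True
        then have "clause_vars (to_clause ?V0 Z c) \<inter> ?V1 = {}"
          unfolding clause_vars_to_clause using fixed[OF c] by auto
        then show ?thesis by simp
      next
        case False
        let ?us = "filter (\<lambda>l. var l \<notin> ?V0) c"
        have "clause_vars (to_clause ?V0 Z c) \<inter> ?V1 \<subseteq> var ` set ?us"
          unfolding clause_vars_to_clause by auto
        then have "card (clause_vars (to_clause ?V0 Z c) \<inter> ?V1) \<le> card (var ` set ?us)"
          by (intro card_mono) auto
        also have "\<dots> \<le> card (set ?us)" by (rule card_image_le) simp
        also have "\<dots> \<le> length ?us" by (rule card_length)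
        also have "\<dots> \<le> 2" using False unfolding triggered_def by simp
        finally show ?thesis .
      qed
    qed
  qed
  have 4: "\<forall>d\<in>set ?\<phi>. clause_vars d \<inter> Z \<noteq> {} \<longrightarrow> generalized_clause ?V0 Z d"
  proof
    fix d assume "d \<in> set ?\<phi>"
    then show "clause_vars d \<inter> Z \<noteq> {} \<longrightarrow> generalized_clause ?V0 Z d"
    proof (rule all, intro impI)
      fix c assume c: "c \<in> set cs" and "clause_vars (to_clause ?V0 Z c) \<inter> Z \<noteq> {}"
      then obtain l where l: "l \<in> set c" "var l \<in> Z" unfolding clause_vars_to_clause by auto
      then have "var l \<notin> ?V0" using Z by auto
      moreover from this have "to_clause ?V0 Z c =
        DisjXor (filter (\<lambda>l. var l \<in> ?V0) c) (filter (\<lambda>l. var l \<notin> ?V0) c)"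
        unfolding to_clause_def using l by auto
      ultimately show "generalized_clause ?V0 Z (to_clause ?V0 Z c)"
        using fixed[OF c mix[OF l]] l by (auto simp: filter_empty_conv)
    qed
  qed
  have 5: "\<forall>d\<in>set ?\<phi>. clause_vars d \<inter> Z = {} \<longrightarrow> (\<exists>ls. d = Disj ls)"
  proof
    fix d assume "d \<in> set ?\<phi>"
    then show "clause_vars d \<inter> Z = {} \<longrightarrow> (\<exists>ls. d = Disj ls)"
    proof (rule all, intro impI)
      fix c assume "clause_vars (to_clause ?V0 Z c) \<inter> Z = {}"
      then have "\<not> (\<exists>l\<in>set c. var l \<notin> ?V0 \<and> var l \<in> Z)"
        unfolding clause_vars_to_clause by blast
      then have "to_clause ?V0 Z c = Disj c" unfolding to_clause_def by (rule if_not_P)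
      then show "\<exists>ls. to_clause ?V0 Z c = Disj ls" by blast
    qed
  qed
  show ?thesis
    unfolding lpic_def
    by (intro conjI 1 exI[of _ ?V0] exI[of _ ?V1] exI[of _ Z] 2 p 3 4 5) (use R(3) Z in auto)
qed

text \<open>Odd means nonzero, so passing from disjunction to exclusive or can lose models but never
  adds one.\<close>

lemma clause_true_some: "clause_true x d \<Longrightarrow> \<exists>l\<in>set (clause_lits d). lit_true x l"
proof (cases d)
  case (DisjXor ls ks)
  assume d: "clause_true x d"
  have "\<exists>l\<in>set ks. lit_true x l" if "odd (length (filter (lit_true x) ks))"
  proof -
    have "filter (lit_true x) ks \<noteq> []" using that by (metis even_zero list.size(3))
    then show ?thesis by (simp add: filter_empty_conv)
  qed
  then show ?thesis using d DisjXor by auto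
qed simp

text \<open>Only variables of clauses matter. The computed \<open>V0\<close> lies below
  \<open>n\<close>, whereas \<open>horn_vars\<close> also contains every variable that occurs in no
  clause, as a singleton is closed there.\<close>

lemma xor_vars_cong:
  assumes "\<And>c l. c \<in> \<C> \<Longrightarrow> l \<in> set c \<Longrightarrow> var l \<in> V0 \<longleftrightarrow> var l \<in> V0'"
  shows "xor_vars \<C> V0 \<subseteq> xor_vars \<C> V0'"
proof
  fix v assume "v \<in> xor_vars \<C> V0"
  then show "v \<in> xor_vars \<C> V0'"
  proof induction
    case (base c l)
    have "filter (\<lambda>l. var l \<notin> V0) c = filter (\<lambda>l. var l \<notin> V0') c"
      by (rule filter_cong) (use assms[OF base(1)] in auto)
    then show ?case using base assms[OF base(1,3)] xor_vars.base[of c \<C> V0' l] by simp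
  next
    case (step v c l)
    then show ?case using assms[OF step(2,4)] xor_vars.step[of v \<C> V0' c l] by blast
  qed
qed

text \<open>Applied in contrapositive form: a vector of \<open>D\<close> that violates a new clause
  proves that \<open>D\<close> is not a local possibility domain.\<close>

lemma to_clause_holds:
  assumes D: "local_possibility_domain n D"
    and C: "\<And>c. c \<in> set cs \<Longrightarrow> prime_clause D c \<and> distinct c \<and> (\<forall>l\<in>set c. var l < n)"
    and V0: "V0 \<inter> {..<n} = horn_vars (set cs) \<inter> {..<n}" and Z: "Z \<subseteq> xor_vars (set cs) V0"
    and c: "c \<in> set cs" and x: "x \<in> D"
  shows "clause_true x (to_clause V0 Z c)"
proof (cases "\<exists>l\<in>set c. var l \<notin> V0 \<and> var l \<in> Z")
  case False
  then have "to_clause V0 Z c = Disj c" unfolding to_clause_def by (rule if_not_P)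
  moreover obtain l where "l \<in> set c" "lit_true x l"
    using C[OF c] x by (meson prime_clauseD)
  ultimately show ?thesis by auto
next
  case True
  then have tc: "to_clause V0 Z c = DisjXor (filter (\<lambda>l. var l \<in> V0) c) (filter (\<lambda>l. var l \<notin> V0) c)"
    unfolding to_clause_def by (rule if_P)
  obtain l where l: "l \<in> set c" "var l \<in> Z" using True by blast
  have iff: "var l \<in> V0 \<longleftrightarrow> var l \<in> horn_vars (set cs)" if "d \<in> set cs" "l \<in> set d" for d l
  proof -
    have "var l < n" using C[OF that(1)] that(2) by simp
    moreover have "var l \<in> V0 \<inter> {..<n} \<longleftrightarrow> var l \<in> horn_vars (set cs) \<inter> {..<n}" unfolding V0 ..
    ultimately show ?thesis by simp
  qed
  have lx: "var l \<in> xor_vars (set cs) (horn_vars (set cs))"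
    using subsetD[OF xor_vars_cong[of "set cs" V0, OF iff]] Z l(2) by auto
  show ?thesis
  proof (cases "\<exists>l\<in>set c. var l \<in> V0 \<and> lit_true x l")
    case t: True
    then show ?thesis unfolding tc by auto
  next
    case no: False
    have "odd (length (filter (lit_true x) c))"
    proof (rule xor_clause_odd[OF D C c l(1) lx x])
      show "\<not> lit_true x l" if "l \<in> set c" "var l \<in> horn_vars (set cs)" for l
        using no that iff[OF c that(1)] by auto
    qed
    moreover have "filter (lit_true x) c = filter (lit_true x) (filter (\<lambda>l. var l \<notin> V0) c)"
      unfolding filter_filter by (rule filter_cong) (use no in auto)
    ultimately have "odd (length (filter (lit_true x) (filter (\<lambda>l. var l \<notin> V0) c)))" by simp
    then show ?thesis unfolding tc clause_true.simps by (rule disjI2)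
  qed
qed

section \<open>Marking the affine part\<close>

definition mark_clause :: "nat set \<Rightarrow> nat set \<Rightarrow> literal list \<Rightarrow> nat set" where
  "mark_clause V0 Z c = (if triggered V0 Z c then Z \<union> (var ` set c - V0) else Z)"

abbreviation mark_pass :: "nat set \<Rightarrow> literal list list \<Rightarrow> nat set \<Rightarrow> nat set" where
  "mark_pass V0 cs Z \<equiv> foldl (mark_clause V0) Z cs"

lemma mark_clause_mono: "Z \<subseteq> mark_clause V0 Z c"
  unfolding mark_clause_def by auto

lemma mark_pass_mono: "Z \<subseteq> mark_pass V0 cs Z"
proof (induction cs arbitrary: Z)
  case (Cons c cs)
  show ?case using Cons[of "mark_clause V0 Z c"] mark_clause_mono[of Z V0 c] by simp
qed simp

text \<open>Marking only adds variables, so a pass without overall change has changed nothing at any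
  clause.\<close>

lemma mark_pass_fixed: "mark_pass V0 cs Z = Z \<Longrightarrow> c \<in> set cs \<Longrightarrow> mark_clause V0 Z c = Z"
proof (induction cs)
  case (Cons d cs)
  have "mark_clause V0 Z d = Z"
    using Cons(2) mark_clause_mono[of Z V0 d] mark_pass_mono[of "mark_clause V0 Z d" V0 cs] by auto
  then show ?case using Cons by auto
qed simp

lemma mark_pass_sound:
  assumes "Z \<subseteq> xor_vars \<C> V0" "set cs \<subseteq> \<C>"
  shows "mark_pass V0 cs Z \<subseteq> xor_vars \<C> V0"
  using assms
proof (induction cs arbitrary: Z)
  case (Cons c cs)
  have c: "c \<in> \<C>" using Cons.prems by simp
  have "mark_clause V0 Z c \<subseteq> xor_vars \<C> V0"
  proof (cases "triggered V0 Z c")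
    case True
    have "var l \<in> xor_vars \<C> V0" if "l \<in> set c" "var l \<notin> V0" for l
      using True unfolding triggered_def
    proof
      assume "3 \<le> length (filter (\<lambda>l. var l \<notin> V0) c)"
      then show ?thesis using xor_vars.base[OF c _ that] by blast
    next
      assume "\<exists>l\<in>set c. var l \<notin> V0 \<and> var l \<in> Z"
      then obtain l' where "l' \<in> set c" "var l' \<in> xor_vars \<C> V0" using Cons.prems(1) by blast
      then show ?thesis using xor_vars.step[OF _ c _ that] by blast
    qed
    then show ?thesis using Cons.prems(1) unfolding mark_clause_def by auto
  qed (use Cons.prems in \<open>simp add: mark_clause_def\<close>)
  then show ?case using Cons by simp
qed simp

lemma xor_vars_less:
  assumes "\<forall>c\<in>\<C>. \<forall>l\<in>set c. var l < n"
  shows "xor_vars \<C> V0 \<subseteq> {..<n} - V0"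
proof
  fix v assume "v \<in> xor_vars \<C> V0"
  then show "v \<in> {..<n} - V0"
  proof cases
    case (base c l)
    then show ?thesis using assms base(1,2,4,5) by simp
  next
    case (step v' c l)
    then show ?thesis using assms step(1,3,5,6) by simp
  qed
qed

definition marked :: "nat set \<Rightarrow> literal list list \<Rightarrow> nat \<Rightarrow> nat set" where
  "marked V0 cs k = (mark_pass V0 cs ^^ k) {}"

lemma marked_sound: "marked V0 cs k \<subseteq> xor_vars (set cs) V0"
proof (induction k)
  case 0
  then show ?case unfolding marked_def by simp
next
  case (Suc k)
  from mark_pass_sound[OF this order_refl] show ?case unfolding marked_def by simp
qed

text \<open>Until the marking is stable each pass adds a variable, and there are only
  \<open>n\<close> of them.\<close>

lemma marked_fixed:
  assumes "\<forall>c\<in>set cs. \<forall>l\<in>set c. var l < n"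
  shows "mark_pass V0 cs (marked V0 cs n) = marked V0 cs n"
proof -
  let ?Z = "marked V0 cs"
  have S: "?Z (Suc k) = mark_pass V0 cs (?Z k)" for k unfolding marked_def by simp
  have sub: "?Z k \<subseteq> {..<n}" for k
    using order_trans[OF marked_sound[of V0 cs k] xor_vars_less[OF assms]] by auto
  have fin: "finite (?Z k)" for k by (rule finite_subset[OF sub]) simp
  have "?Z (Suc k) = ?Z k \<or> k \<le> card (?Z k)" for k
  proof (induction k)
    case (Suc k)
    show ?case
    proof (cases "?Z (Suc k) = ?Z k")
      case True
      then have "?Z (Suc (Suc k)) = ?Z (Suc k)" using S[of "Suc k"] S[of k] by simp
      then show ?thesis by simp
    next
      case False
      then have "?Z k \<subset> ?Z (Suc k)" using mark_pass_mono[of "?Z k" V0 cs] S[of k] by auto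
      then have "card (?Z k) < card (?Z (Suc k))" by (rule psubset_card_mono[OF fin])
      then show ?thesis using Suc False by simp
    qed
  qed simp
  from this[of n] show ?thesis
  proof
    assume "?Z (Suc n) = ?Z n"
    then show ?thesis using S[of n] by simp
  next
    assume "n \<le> card (?Z n)"
    then have "?Z n = {..<n}" using sub[of n] card_subset_eq[OF _ sub[of n]] card_mono[OF _ sub[of n]] by simp
    then show ?thesis using sub[of "Suc n"] mark_pass_mono[of "?Z n" V0 cs] S[of n] by auto
  qed
qed

lemma marked_closed:
  assumes "\<forall>c\<in>set cs. \<forall>l\<in>set c. var l < n"
    and "c \<in> set cs" "triggered V0 (marked V0 cs n) c" "l \<in> set c" "var l \<notin> V0"
  shows "var l \<in> marked V0 cs n"
proof -
  have "mark_clause V0 (marked V0 cs n) c = marked V0 cs n"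
    by (rule mark_pass_fixed[OF marked_fixed[OF assms(1)] assms(2)])
  then show ?thesis using assms(3-5) unfolding mark_clause_def by auto
qed

text \<open>Marked variables weigh three, so the weight exceeds two exactly for triggered clauses.\<close>

definition weight :: "nat set \<Rightarrow> nat set \<Rightarrow> literal list \<Rightarrow> nat" where
  "weight V0 Z c = sum_list (map (\<lambda>l. if var l \<in> V0 then 0 else if var l \<in> Z then 3 else 1) c)"

lemma weight_triggered: "2 < weight V0 Z c \<longleftrightarrow> triggered V0 Z c"
proof -
  let ?w = "\<lambda>l. if var l \<in> V0 then 0 else if var l \<in> Z then 3 else (1::nat)"
  have le: "length (filter (\<lambda>l. var l \<notin> V0) c) \<le> weight V0 Z c"
    unfolding weight_def by (induction c) auto
  show ?thesis
  proof (cases "\<exists>l\<in>set c. var l \<notin> V0 \<and> var l \<in> Z")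
    case True
    then obtain l where l: "l \<in> set c" "var l \<notin> V0" "var l \<in> Z" by blast
    then have "?w l \<le> weight V0 Z c" unfolding weight_def by (intro member_le_sum_list) auto
    then show ?thesis using l True unfolding triggered_def by auto
  next
    case False
    then have "weight V0 Z c = length (filter (\<lambda>l. var l \<notin> V0) c)"
      unfolding weight_def by (induction c) auto
    then show ?thesis using False unfolding triggered_def by auto
  qed
qed

section \<open>Programs for the marking\<close>

definition each_literal :: "com \<Rightarrow> com" where
  "each_literal b = For ''q'' (Cell ''start'' (V ''c'')) (Cell ''start'' (Add (V ''c'') (Num 1)))
     (''l'' :=\<^sub>v Cell ''lits'' (V ''q'') ;; b)"

lemma avars_each_literal [simp]: "avars (each_literal b) = insert ''q'' (insert ''l'' (avars b))"
  unfolding each_literal_def by auto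

text \<open>What the body of \<open>each_literal\<close> must leave alone: the loop control and all
  arrays that \<open>ready\<close> describes.\<close>

definition loop_arrays :: "string set" where
  "loop_arrays = {''q'', ''c'', ''n'', ''m'', ''D'', ''row'', ''neg'', ''var'', ''count'', ''size'',
    ''start'', ''lits'', ''owner'', ''head'', ''next''}"

text \<open>Adding 1 and twice the mark realizes \<open>weight\<close>: an unmarked variable outside
  \<open>V0\<close> counts 1, a marked one 3.\<close>

definition mark_pass_com :: com where
  "mark_pass_com = For ''c'' (Num 0) (V ''count'')
     (''w'' :=\<^sub>v Num 0 ;;
      each_literal (''v'' :=\<^sub>v Cell ''var'' (V ''l'') ;; Cond (BEq (Cell ''sign'' (V ''v'')) (Num 0))
        (''w'' :=\<^sub>v Add (Add (V ''w'') (Num 1)) (Add (Cell ''xor'' (V ''v'')) (Cell ''xor'' (V ''v'')))) Skip) ;;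
      Cond (BLess (Num 2) (V ''w''))
       (each_literal (''v'' :=\<^sub>v Cell ''var'' (V ''l'') ;; Cond (BEq (Cell ''sign'' (V ''v'')) (Num 0))
          (Assign ''xor'' (V ''v'') (Num 1)) Skip)) Skip)"

definition find_marks :: com where
  "find_marks = For ''i'' (Num 0) (V ''n'') mark_pass_com"

lemma avars_marks [simp]:
  "avars mark_pass_com = {''c'', ''w'', ''q'', ''l'', ''v'', ''xor''}"
  "avars find_marks = {''i'', ''c'', ''w'', ''q'', ''l'', ''v'', ''xor''}"
  unfolding find_marks_def mark_pass_com_def by auto

definition marks :: "nat \<Rightarrow> nat set \<Rightarrow> store \<Rightarrow> bool" where
  "marks n Z s \<longleftrightarrow> (\<forall>v<n. s ''xor'' v = of_bool (v \<in> Z))"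

context cnf
begin

text \<open>The counterpart of \<open>clause_length\<close>. Marking goes through up to
  \<open>m * n\<close> clauses \<open>n\<close> times and is charged at most \<open>m\<close>
  literals per clause; evaluation goes through them once for each of the \<open>m\<close> rows and
  is charged at most \<open>n\<close>. Both products are \<open>m\<^sup>2 * n\<^sup>2\<close>, while
  exchanging the two length bounds would exceed it in general.\<close>

lemma clause_length_n: "c \<in> set cs \<Longrightarrow> length c \<le> n"
proof -
  assume c: "c \<in> set cs"
  have "var ` set c \<subseteq> {..<n}" using vars[OF c] by auto
  then have "card (set (map var c)) \<le> card {..<n}" by (intro card_mono) auto
  then show "length c \<le> n" using distinct_card[OF dist[OF c]] by simp
qed

text \<open>The length bound \<open>B\<close> is a parameter because marking instantiates it with
  \<open>m\<close>, evaluation and output with \<open>n\<close>.\<close>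

lemma run_each_literal:
  assumes r: "ready s" and c: "s ''c'' 0 = c" "c < length cs"
    and fresh: "avars b \<inter> loop_arrays = {}"
    and I0: "I 0 s" and inv: "\<And>k s x. I k (s(''q'' := x)) = I k s" "\<And>k s x. I k (s(''l'' := x)) = I k s"
    and step: "\<And>k s'. k < length (cs ! c) \<Longrightarrow> s' ''l'' 0 = encode_lit (cs ! c ! k) \<Longrightarrow>
      var (cs ! c ! k) < n \<Longrightarrow> ready s' \<Longrightarrow>
      same (insert ''q'' (insert ''l'' (avars b))) s s' \<Longrightarrow> I k s' \<Longrightarrow> run b s' K (I (Suc k))"
    and Q: "\<And>s'. I (length (cs ! c)) s' \<Longrightarrow> same (insert ''q'' (insert ''l'' (avars b))) s s' \<Longrightarrow> Q s'"
    and B: "length (cs ! c) \<le> B" "1 \<le> B"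
  shows "run (each_literal b) s ((K + 40) * B) Q"
proof -
  let ?b = "''l'' :=\<^sub>v Cell ''lits'' (V ''q'') ;; b"
  have fr': "a \<notin> avars b" if "a \<in> loop_arrays" for a
    using fresh that by blast
  note fr = fr'[unfolded loop_arrays_def]
  have st: "s ''start'' c = offset cs c" "s ''start'' (Suc c) = offset cs c + length (cs ! c)"
    using ready_start[OF r] c by (simp_all add: offset_Suc)
  have "run (For ''q'' (Cell ''start'' (V ''c'')) (Cell ''start'' (Add (V ''c'') (Num 1))) ?b) s
    ((K + 40) * (B * 1)) Q"
  proof (rule run_For_le[where I = I and K = "K + 5" and N = "length (cs ! c)"])
    fix k s' assume k: "k < length (cs ! c)" "s' ''q'' 0 = aval (Cell ''start'' (V ''c'')) s + k"
      and sm: "same (insert ''q'' (avars ?b)) s s'" and I: "I k s'"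
    have r': "ready s'" using ready_same[OF sm] r fr by simp
    have l: "s' ''lits'' (s' ''q'' 0) = encode_lit (cs ! c ! k)"
      using ready_lit[OF r' c(2) k(1)] k(2) c(1) st by simp
    let ?s1 = "s'(''l'' := (s' ''l'')(aval (Num 0) s' := aval (Cell ''lits'' (V ''q'')) s'))"
    have sm1: "same {''l''} s' ?s1" by (simp add: same_def)
    have "run b ?s1 K (I (Suc k))"
    proof (rule step[OF k(1)])
      show "ready ?s1" using ready_same[OF sm1] r' by simp
      show "same (insert ''q'' (insert ''l'' (avars b))) s ?s1"
        by (rule same_trans[OF same_mono[OF sm] same_mono[OF sm1]]) auto
      show "I k ?s1" using I inv(2) by simp
      show "var (cs ! c ! k) < n" using vars[of "cs ! c" "cs ! c ! k"] k(1) c(2) by simp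
    qed (use l in simp)
    then have "run ?b s' (5 + K) (I (Suc k))" by (intro run_Seq_AssignI) simp
    then show "run ?b s' ((K + 5) * 1) (I (Suc k))" by (simp add: add.commute)
  next
    show "''q'' \<notin> avars ?b" using fr by simp
    show "reads (Cell ''start'' (Add (V ''c'') (Num 1))) \<inter> insert ''q'' (avars ?b) = {}" using fr by simp
    show "aval (Cell ''start'' (Add (V ''c'') (Num 1))) s = aval (Cell ''start'' (V ''c'')) s + length (cs ! c)"
      using c st by simp
    show "I 0 s" by (rule I0)
    show "\<And>k s x. I k (s(''q'' := x)) = I k s" by (rule inv(1))
    show "\<And>s'. I (length (cs ! c)) s' \<Longrightarrow> same (insert ''q'' (avars ?b)) s s' \<Longrightarrow> Q s'"
      using Q by simp
  qed (use B in simp_all)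
  then show ?thesis unfolding each_literal_def by simp
qed

lemma mark_clause_step:
  assumes r: "ready s" and sg: "signs n R s" and c: "s ''c'' 0 = c" "c < length cs" and Z: "marks n Z s"
  shows "run (''w'' :=\<^sub>v Num 0 ;;
      each_literal (''v'' :=\<^sub>v Cell ''var'' (V ''l'') ;; Cond (BEq (Cell ''sign'' (V ''v'')) (Num 0))
        (''w'' :=\<^sub>v Add (Add (V ''w'') (Num 1)) (Add (Cell ''xor'' (V ''v'')) (Cell ''xor'' (V ''v'')))) Skip) ;;
      Cond (BLess (Num 2) (V ''w''))
       (each_literal (''v'' :=\<^sub>v Cell ''var'' (V ''l'') ;; Cond (BEq (Cell ''sign'' (V ''v'')) (Num 0))
          (Assign ''xor'' (V ''v'') (Num 1)) Skip)) Skip) s (200 * m)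
    (marks n (mark_clause (var ` R) Z (cs ! c)))"
proof -
  let ?b1 = "''v'' :=\<^sub>v Cell ''var'' (V ''l'') ;; Cond (BEq (Cell ''sign'' (V ''v'')) (Num 0))
        (''w'' :=\<^sub>v Add (Add (V ''w'') (Num 1)) (Add (Cell ''xor'' (V ''v'')) (Cell ''xor'' (V ''v'')))) Skip"
  let ?b2 = "''v'' :=\<^sub>v Cell ''var'' (V ''l'') ;; Cond (BEq (Cell ''sign'' (V ''v'')) (Num 0))
          (Assign ''xor'' (V ''v'') (Num 1)) Skip"
  let ?V0 = "var ` R" and ?d = "cs ! c"
  let ?s1 = "s(''w'' := (s ''w'')(aval (Num 0) s := aval (Num 0) s))"
  have lc: "length ?d \<le> m" using clause_length c by simp
  have sm1: "same {''w''} s ?s1" by (simp add: same_def)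
  have r1: "ready ?s1" using ready_same[OF sm1] r by simp
  have rest: "run (each_literal ?b1 ;; Cond (BLess (Num 2) (V ''w'')) (each_literal ?b2) Skip) ?s1
    ((30 + 40) * m + (10 + (30 + 40) * m)) (marks n (mark_clause ?V0 Z ?d))"
  proof (rule run_Seq)
    show "run (each_literal ?b1) ?s1 ((30 + 40) * m) (\<lambda>s'. s' ''w'' 0 = weight ?V0 Z ?d)"
    proof (rule run_each_literal[where I = "\<lambda>k s'. s' ''w'' 0 = weight ?V0 Z (take k ?d)", OF r1 _ c(2)])
      fix k s' assume k: "k < length ?d" "s' ''l'' 0 = encode_lit (?d ! k)" "var (?d ! k) < n" "ready s'"
        "same (insert ''q'' (insert ''l'' (avars ?b1))) ?s1 s'" "s' ''w'' 0 = weight ?V0 Z (take k ?d)"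
      note sm = k(5)
      have "s' ''var'' (encode_lit (?d ! k)) = var (?d ! k)"
        using k(3,4) unfolding ready_def tables_def by blast
      moreover have "s' ''sign'' (var (?d ! k)) = 0 \<longleftrightarrow> var (?d ! k) \<notin> ?V0"
        using sg k(3) unfolding signs_def by (simp add: sameD[OF sm] sign_code_0)
      moreover have "s' ''xor'' (var (?d ! k)) = of_bool (var (?d ! k) \<in> Z)"
        using Z k(3) unfolding marks_def by (simp add: sameD[OF sm])
      ultimately show "run ?b1 s' 30 (\<lambda>s'. s' ''w'' 0 = weight ?V0 Z (take (Suc k) ?d))"
        using k(1,2,6) by (simp add: run_simps weight_def take_Suc_conv_app_nth)
    qed (use c lc m in \<open>simp_all add: weight_def loop_arrays_def\<close>)
    fix s2 assume w: "s2 ''w'' 0 = weight ?V0 Z ?d" and sm2: "same (avars (each_literal ?b1)) ?s1 s2"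
    have r2: "ready s2" using ready_same[OF sm2] r1 by simp
    have Z2: "marks n Z s2" using Z unfolding marks_def by (simp add: sameD[OF sm2])
    have sg2: "signs n R s2" using sg unfolding signs_def by (simp add: sameD[OF sm2])
    have c2: "s2 ''c'' 0 = c" using c by (simp add: sameD[OF sm2])
    show "run (Cond (BLess (Num 2) (V ''w'')) (each_literal ?b2) Skip) s2 (10 + (30 + 40) * m)
      (marks n (mark_clause ?V0 Z ?d))"
    proof (cases "triggered ?V0 Z ?d")
      case False
      then show ?thesis
        using w weight_triggered[of ?V0 Z ?d] Z2 by (simp add: run_simps mark_clause_def)
    next
      case True
      have "run (each_literal ?b2) s2 ((30 + 40) * m) (marks n (Z \<union> (var ` set ?d - ?V0)))"
      proof (rule run_each_literal[where I = "\<lambda>k. marks n (Z \<union> (var ` set (take k ?d) - ?V0))", OF r2 c2 c(2)])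
        fix k s' assume k: "k < length ?d" "s' ''l'' 0 = encode_lit (?d ! k)" "var (?d ! k) < n" "ready s'"
          "same (insert ''q'' (insert ''l'' (avars ?b2))) s2 s'"
          "marks n (Z \<union> (var ` set (take k ?d) - ?V0)) s'"
        note sm = k(5)
        have "s' ''var'' (encode_lit (?d ! k)) = var (?d ! k)"
          using k(3,4) unfolding ready_def tables_def by blast
        moreover have "s' ''sign'' (var (?d ! k)) = 0 \<longleftrightarrow> var (?d ! k) \<notin> ?V0"
          using sg2 k(3) unfolding signs_def by (simp add: sameD[OF sm] sign_code_0)
        moreover have "set (take (Suc k) ?d) = insert (?d ! k) (set (take k ?d))"
          using k(1) by (simp add: take_Suc_conv_app_nth)
        ultimately show "run ?b2 s' 30 (marks n (Z \<union> (var ` set (take (Suc k) ?d) - ?V0)))"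
          using k(2,3,6) by (auto simp: run_simps marks_def)
      qed (use Z2 lc m in \<open>simp_all add: marks_def loop_arrays_def\<close>)
      then have "run (each_literal ?b2) s2 ((30 + 40) * m + 5) (marks n (mark_clause ?V0 Z ?d))"
        by (rule run_mono) (use True in \<open>auto simp: mark_clause_def\<close>)
      then show ?thesis
        by (rule run_Cond_True[rotated]) (use w True weight_triggered[of ?V0 Z ?d] in simp_all)
    qed
  qed
  have "run (''w'' :=\<^sub>v Num 0 ;; each_literal ?b1 ;; Cond (BLess (Num 2) (V ''w'')) (each_literal ?b2) Skip) s
    (5 + ((30 + 40) * m + (10 + (30 + 40) * m))) (marks n (mark_clause ?V0 Z ?d))"
    by (rule run_Seq_AssignI[OF _ rest]) simp
  then show ?thesis by (rule run_mono) (use m in auto)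
qed

lemma mark_pass_com:
  assumes r: "ready s" and sg: "signs n R s" and Z: "marks n Z s"
  shows "run mark_pass_com s (250 * (m * n * m)) (marks n (mark_pass (var ` R) cs Z))"
  unfolding mark_pass_com_def
proof (rule run_For_le[where I = "\<lambda>k. marks n (mark_pass (var ` R) (take k cs) Z)" and K = 200 and N = "length cs"],
    goal_cases)
  \<comment> \<open>The sixth premise of \<open>run_For_le\<close> is the loop body.\<close>
  case (6 k s')
  note sm = \<open>same _ s s'\<close>
  have "ready s'" using ready_same[OF sm] r by simp
  moreover have "signs n R s'" using sg unfolding signs_def by (simp add: sameD[OF sm])
  moreover have "s' ''c'' 0 = k" using 6 by simp
  moreover have "mark_pass (var ` R) (take (Suc k) cs) Z
    = mark_clause (var ` R) (mark_pass (var ` R) (take k cs) Z) (cs ! k)"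
    using 6(1) by (simp add: take_Suc_conv_app_nth)
  ultimately show ?case using mark_clause_step[of s' R k] 6 by simp
qed (use r Z n m len_cs in \<open>auto simp: ready_def stored_def marks_def\<close>)

lemma find_marks:
  assumes r: "ready s" and sg: "signs n R s" and z: "s ''xor'' = (\<lambda>_. 0)"
  shows "run find_marks s (300 * (n * (m * n * m))) (marks n (marked (var ` R) cs n))"
  unfolding find_marks_def
proof (rule run_For_le[where I = "\<lambda>k. marks n (marked (var ` R) cs k)" and K = 250 and N = n])
  fix k s' assume k: "k < n" "marks n (marked (var ` R) cs k) s'" and sm: "same (insert ''i'' (avars mark_pass_com)) s s'"
  have "ready s'" using ready_same[OF sm] r by simp
  moreover have "signs n R s'" using sg unfolding signs_def by (simp add: sameD[OF sm])
  ultimately show "run mark_pass_com s' (250 * (m * n * m)) (marks n (marked (var ` R) cs (Suc k)))"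
    using mark_pass_com[of s' R "marked (var ` R) cs k"] k(2) by (simp add: marked_def)
qed (use r z n m in \<open>auto simp: ready_def rows_def marks_def marked_def\<close>)

end

section \<open>Writing the formula\<close>

definition classify :: com where
  "classify = (''a'' :=\<^sub>v Num 0 ;; ''b'' :=\<^sub>v Num 0 ;; ''g'' :=\<^sub>v Num 0 ;;
     each_literal (''v'' :=\<^sub>v Cell ''var'' (V ''l'') ;; Cond (BEq (Cell ''sign'' (V ''v'')) (Num 0))
       (''b'' :=\<^sub>v Add (V ''b'') (Num 1) ;;
        Cond (BEq (Cell ''xor'' (V ''v'')) (Num 1)) (''g'' :=\<^sub>v Num 1) Skip)
       (''a'' :=\<^sub>v Add (V ''a'') (Num 1))))"

text \<open>\<open>t\<close> tells whether a literal over \<open>V0\<close> is true in the row,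
  \<open>w\<close> is the parity of the true literals outside; subtracting \<open>w\<close> from 1
  toggles it.\<close>

definition check_row :: com where
  "check_row = (''t'' :=\<^sub>v Num 0 ;; ''w'' :=\<^sub>v Num 0 ;;
     each_literal (''v'' :=\<^sub>v Cell ''var'' (V ''l'') ;;
       Cond (BEq (Add (Add (V ''v'') (V ''v'')) (bit ''y'' ''v'')) (V ''l'')) Skip
        (Cond (BEq (Cell ''sign'' (V ''v'')) (Num 0))
          (''w'' :=\<^sub>v Sub (Num 1) (V ''w'')) (''t'' :=\<^sub>v Num 1))) ;;
     Cond (BAnd (BEq (V ''t'') (Num 0)) (BEq (V ''w'') (Num 0))) (''bad'' :=\<^sub>v Num 1) Skip)"

definition check_rows :: com where
  "check_rows = For ''y'' (Num 0) (V ''m'') check_row"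

definition put :: "aexp \<Rightarrow> com" where
  "put e = (Assign ''out'' (V ''o'') e ;; ''o'' :=\<^sub>v Add (V ''o'') (Num 1))"

definition put_literals :: "bexp \<Rightarrow> com" where
  "put_literals b = each_literal (''v'' :=\<^sub>v Cell ''var'' (V ''l'') ;; Cond b (put (V ''l'')) Skip)"

abbreviation in_horn :: bexp where "in_horn \<equiv> BNot (BEq (Cell ''sign'' (V ''v'')) (Num 0))"

text \<open>In the output format lengths precede literals, so \<open>classify\<close> counts both
  groups beforehand, and each group of an exclusive-or clause gets its own pass.\<close>

definition put_clause :: com where
  "put_clause = (put (V ''g'') ;; Cond (BEq (V ''g'') (Num 1))
     (put (V ''a'') ;; put_literals in_horn ;; put (V ''b'') ;; put_literals (BNot in_horn))
     (put (Add (V ''a'') (V ''b'')) ;; put_literals (BEq (Num 0) (Num 0))))"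

text \<open>Only clauses turned into exclusive ors are evaluated on the rows; the unchanged ones are
  implicates of the domain.\<close>

definition process_clause :: com where
  "process_clause = (classify ;; Cond (BEq (V ''g'') (Num 1)) check_rows Skip ;; put_clause)"

text \<open>The formula is written in any case; a single violated clause sets \<open>bad\<close>,
  and this flag alone decides the answer.\<close>

definition write_formula :: com where
  "write_formula = (''bad'' :=\<^sub>v Num 0 ;; Assign ''out'' (Num 0) (V ''count'') ;; ''o'' :=\<^sub>v Num 1 ;;
     For ''c'' (Num 0) (V ''count'') process_clause ;; ''answer'' :=\<^sub>v Sub (Num 1) (V ''bad''))"

lemma avars_write [simp]:
  "avars classify = {''a'', ''b'', ''g'', ''q'', ''l'', ''v''}"
  "avars check_row = {''t'', ''w'', ''q'', ''l'', ''v'', ''bad''}"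
  "avars check_rows = {''y'', ''t'', ''w'', ''q'', ''l'', ''v'', ''bad''}"
  "avars (put e) = {''out'', ''o''}"
  "avars (put_literals b) = {''q'', ''l'', ''v'', ''out'', ''o''}"
  "avars put_clause = {''q'', ''l'', ''v'', ''out'', ''o''}"
  "avars process_clause = {''a'', ''b'', ''g'', ''y'', ''t'', ''w'', ''bad'', ''q'', ''l'', ''v'', ''out'', ''o''}"
  unfolding process_clause_def put_clause_def put_literals_def put_def check_rows_def check_row_def
    classify_def by auto

definition out_list :: "nat list \<Rightarrow> store \<Rightarrow> bool" where
  "out_list E s \<longleftrightarrow> s ''o'' 0 = length E \<and> arr (s ''out'') E"

lemma out_list_same:
  assumes sm: "same X s s'" and X: "''o'' \<notin> X" "''out'' \<notin> X"
  shows "out_list E s' = out_list E s"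
  using X unfolding out_list_def by (simp add: sameD[OF sm])

lemma put:
  assumes "out_list E s"
  shows "run (put e) s (acost e + 9) (out_list (E @ [aval e s]))"
proof -
  have "arr ((s ''out'')(s ''o'' 0 := aval e s)) (E @ [aval e s])"
    by (rule arr_append) (use assms in \<open>auto simp: out_list_def\<close>)
  then show ?thesis using assms unfolding put_def out_list_def by (simp add: run_simps)
qed

context cnf
begin

lemma classify:
  assumes r: "ready s" and sg: "signs n R s" and Z: "marks n Z s" and c: "s ''c'' 0 = c" "c < length cs"
  shows "run classify s (120 * n) (\<lambda>s'. s' ''a'' 0 = length (filter (\<lambda>l. var l \<in> var ` R) (cs ! c)) \<and>
     s' ''b'' 0 = length (filter (\<lambda>l. var l \<notin> var ` R) (cs ! c)) \<and>
     s' ''g'' 0 = of_bool (\<exists>l\<in>set (cs ! c). var l \<notin> var ` R \<and> var l \<in> Z))"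
proof -
  let ?V0 = "var ` R" and ?d = "cs ! c"
  let ?b = "''v'' :=\<^sub>v Cell ''var'' (V ''l'') ;; Cond (BEq (Cell ''sign'' (V ''v'')) (Num 0))
       (''b'' :=\<^sub>v Add (V ''b'') (Num 1) ;;
        Cond (BEq (Cell ''xor'' (V ''v'')) (Num 1)) (''g'' :=\<^sub>v Num 1) Skip)
       (''a'' :=\<^sub>v Add (V ''a'') (Num 1))"
  define I where "I k s' \<longleftrightarrow> s' ''a'' 0 = length (filter (\<lambda>l. var l \<in> ?V0) (take k ?d)) \<and>
     s' ''b'' 0 = length (filter (\<lambda>l. var l \<notin> ?V0) (take k ?d)) \<and>
     s' ''g'' 0 = of_bool (\<exists>l\<in>set (take k ?d). var l \<notin> ?V0 \<and> var l \<in> Z)" for k and s' :: store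
  let ?s1 = "s(''a'' := (s ''a'')(0 := 0), ''b'' := (s ''b'')(0 := 0), ''g'' := (s ''g'')(0 := 0))"
  have sm1: "same {''a'', ''b'', ''g''} s ?s1" by (simp add: same_def)
  have r1: "ready ?s1" using ready_same[OF sm1] r by simp
  have e: "run (each_literal ?b) ?s1 ((40 + 40) * n) (I (length ?d))"
  proof (rule run_each_literal[where I = I, OF r1 _ c(2)])
    fix k s' assume k: "k < length ?d" "s' ''l'' 0 = encode_lit (?d ! k)" "var (?d ! k) < n" "ready s'"
      "same (insert ''q'' (insert ''l'' (avars ?b))) ?s1 s'" "I k s'"
    note sm = k(5)
    have "s' ''var'' (encode_lit (?d ! k)) = var (?d ! k)"
      using k(3,4) unfolding ready_def tables_def by blast
    moreover have "s' ''sign'' (var (?d ! k)) = 0 \<longleftrightarrow> var (?d ! k) \<notin> ?V0"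
      using sg k(3) unfolding signs_def by (simp add: sameD[OF sm] sign_code_0)
    moreover have "s' ''xor'' (var (?d ! k)) = of_bool (var (?d ! k) \<in> Z)"
      using Z k(3) unfolding marks_def by (simp add: sameD[OF sm])
    ultimately show "run ?b s' 40 (I (Suc k))"
      using k(1,2,6) unfolding I_def by (auto simp: run_simps take_Suc_conv_app_nth)
  qed (use c clause_length_n n in \<open>simp_all add: I_def loop_arrays_def\<close>)
  then have "run classify s (5 + (5 + (5 + (40 + 40) * n))) (I (length ?d))"
    unfolding classify_def by (intro run_Seq_AssignI) simp_all
  then show ?thesis by (rule run_mono) (use n in \<open>auto simp: I_def\<close>)
qed

text \<open>Twice the variable plus its bit is the code of the literal on that variable which
  \<open>x\<close> falsifies, so a comparison of codes evaluates a literal without decoding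
  it.\<close>

lemma lit_true_code:
  "lit_true x l \<longleftrightarrow> \<not> (var l + var l + of_bool (x ! var l) = encode_lit l)"
  by (cases l) auto

lemma check_row:
  assumes r: "ready s" and sg: "signs n R s" and c: "s ''c'' 0 = c" "c < length cs"
    and y: "s ''y'' 0 = y" "y < m" and bad: "s ''bad'' 0 = of_bool B"
  shows "run check_row s (140 * n) (\<lambda>s'. s' ''bad'' 0 = of_bool (B \<or>
     \<not> clause_true (xs ! y) (DisjXor (filter (\<lambda>l. var l \<in> var ` R) (cs ! c)) (filter (\<lambda>l. var l \<notin> var ` R) (cs ! c)))))"
proof -
  let ?V0 = "var ` R" and ?d = "cs ! c" and ?x = "xs ! y"
  let ?b = "''v'' :=\<^sub>v Cell ''var'' (V ''l'') ;;
       Cond (BEq (Add (Add (V ''v'') (V ''v'')) (bit ''y'' ''v'')) (V ''l'')) Skip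
        (Cond (BEq (Cell ''sign'' (V ''v'')) (Num 0))
          (''w'' :=\<^sub>v Sub (Num 1) (V ''w'')) (''t'' :=\<^sub>v Num 1))"
  let ?c = "Cond (BAnd (BEq (V ''t'') (Num 0)) (BEq (V ''w'') (Num 0))) (''bad'' :=\<^sub>v Num 1) Skip"
  define I where "I k s' \<longleftrightarrow> s' ''t'' 0 = of_bool (\<exists>l\<in>set (take k ?d). var l \<in> ?V0 \<and> lit_true ?x l) \<and>
     s' ''w'' 0 = of_bool (odd (length (filter (lit_true ?x) (filter (\<lambda>l. var l \<notin> ?V0) (take k ?d)))))"
    for k and s' :: store
  let ?s1 = "s(''t'' := (s ''t'')(0 := 0), ''w'' := (s ''w'')(0 := 0))"
  let ?Q = "\<lambda>s'. s' ''bad'' 0 = of_bool (B \<or>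
     \<not> clause_true ?x (DisjXor (filter (\<lambda>l. var l \<in> ?V0) ?d) (filter (\<lambda>l. var l \<notin> ?V0) ?d)))"
  have sm1: "same {''t'', ''w''} s ?s1" by (simp add: same_def)
  have r1: "ready ?s1" using ready_same[OF sm1] r by simp
  have e: "run (each_literal ?b ;; ?c) ?s1 ((50 + 40) * n + 20) ?Q"
  proof (rule run_Seq)
    show "run (each_literal ?b) ?s1 ((50 + 40) * n) (I (length ?d))"
    proof (rule run_each_literal[where I = I, OF r1 _ c(2)])
      fix k s' assume k: "k < length ?d" "s' ''l'' 0 = encode_lit (?d ! k)" "var (?d ! k) < n" "ready s'"
        "same (insert ''q'' (insert ''l'' (avars ?b))) ?s1 s'" "I k s'"
      note sm = k(5)
      let ?l = "?d ! k"
      have v: "s' ''var'' (encode_lit ?l) = var ?l"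
        using k(3,4) unfolding ready_def tables_def by blast
      have sgn: "s' ''sign'' (var ?l) = 0 \<longleftrightarrow> var ?l \<notin> ?V0"
        using sg k(3) unfolding signs_def by (simp add: sameD[OF sm] sign_code_0)
      have y': "s' ''y'' 0 = y" using y by (simp add: sameD[OF sm])
      have D: "s' ''D'' (s' ''row'' y + var ?l) = of_bool (?x ! var ?l)"
        using k(3,4) y(2) unfolding ready_def rows_def by blast
      have tk: "take (Suc k) ?d = take k ?d @ [?l]" using k(1) by (rule take_Suc_conv_app_nth)
      show "run ?b s' 50 (I (Suc k))"
      proof (cases "lit_true ?x ?l")
        case False
        then have "I (Suc k) (s'(''v'' := (s' ''v'')(0 := var ?l)))"
          using k(6) unfolding I_def tk by simp
        moreover have "var ?l + var ?l + of_bool (?x ! var ?l) = encode_lit ?l"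
          using False unfolding lit_true_code by simp
        ultimately show ?thesis using k(2) v y' D by (simp add: run_simps)
      next
        case t: True
        then have ne: "var ?l + var ?l + of_bool (?x ! var ?l) \<noteq> encode_lit ?l"
          unfolding lit_true_code .
        show ?thesis
        proof (cases "var ?l \<in> ?V0")
          case True
          then have "I (Suc k) (s'(''v'' := (s' ''v'')(0 := var ?l), ''t'' := (s' ''t'')(0 := 1)))"
            using k(6) t unfolding I_def tk by simp
          then show ?thesis using k(2) v y' D ne sgn True by (simp add: run_simps)
        next
          case False
          then have "I (Suc k) (s'(''v'' := (s' ''v'')(0 := var ?l), ''w'' := (s' ''w'')(0 := 1 - s' ''w'' 0)))"
            using k(6) t unfolding I_def tk by simp
          then show ?thesis using k(2) v y' D ne sgn False by (simp add: run_simps)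
        qed
      qed
    qed (use c clause_length_n n in \<open>simp_all add: I_def loop_arrays_def\<close>)
    fix s2 assume I: "I (length ?d) s2" and sm2: "same (avars (each_literal ?b)) ?s1 s2"
    have "s2 ''bad'' 0 = of_bool B" using bad by (simp add: sameD[OF sm2])
    then show "run ?c s2 20 ?Q"
      using I unfolding I_def by (auto simp: run_simps)
  qed
  have "run check_row s (5 + (5 + ((50 + 40) * n + 20))) ?Q"
    unfolding check_row_def by (intro run_Seq_AssignI) (use e in simp_all)
  then show ?thesis by (rule run_mono) (use n in simp_all)
qed

lemma check_rows:
  assumes r: "ready s" and sg: "signs n R s" and c: "s ''c'' 0 = c" "c < length cs"
    and bad: "s ''bad'' 0 = of_bool B"
  shows "run check_rows s (180 * (m * n)) (\<lambda>s'. s' ''bad'' 0 = of_bool (B \<or> (\<exists>x\<in>set xs.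
     \<not> clause_true x (DisjXor (filter (\<lambda>l. var l \<in> var ` R) (cs ! c)) (filter (\<lambda>l. var l \<notin> var ` R) (cs ! c))))))"
proof -
  define G where "G x \<longleftrightarrow> clause_true x (DisjXor (filter (\<lambda>l. var l \<in> var ` R) (cs ! c))
    (filter (\<lambda>l. var l \<notin> var ` R) (cs ! c)))" for x
  let ?I = "\<lambda>k s'. s' ''bad'' 0 = of_bool (B \<or> (\<exists>y<k. \<not> G (xs ! y)))"
  have "run check_rows s (180 * (m * n)) (?I m)"
    unfolding check_rows_def
  proof (rule run_For_le[where I = ?I and K = 140 and N = m])
    fix k s' assume k: "k < m" "s' ''y'' 0 = aval (Num 0) s + k" and I: "?I k s'"
      and sm: "same (insert ''y'' (avars check_row)) s s'"
    have r': "ready s'" using ready_same[OF sm] r by simp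
    have sg': "signs n R s'" using sg unfolding signs_def by (simp add: sameD[OF sm])
    have c': "s' ''c'' 0 = c" using c by (simp add: sameD[OF sm])
    have y': "s' ''y'' 0 = k" using k(2) by simp
    have "run check_row s' (140 * n) (\<lambda>s'. s' ''bad'' 0 =
        of_bool ((B \<or> (\<exists>y<k. \<not> G (xs ! y))) \<or> \<not> G (xs ! k)))"
      unfolding G_def[of "xs ! k"] by (rule check_row[OF r' sg' c' c(2) y' k(1) I])
    then show "run check_row s' (140 * n) (?I (Suc k))"
      by (rule run_mono) (simp_all add: less_Suc_eq ex_disj_distrib conj_disj_distribR disj_commute)
  qed (use r bad n m in \<open>simp_all add: ready_def rows_def\<close>)
  moreover have "(\<forall>x\<in>set xs. G x) \<longleftrightarrow> (\<forall>y<m. G (xs ! y))" by (rule all_set_conv_all_nth)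
  then have "(\<exists>y<m. \<not> G (xs ! y)) \<longleftrightarrow> (\<exists>x\<in>set xs. \<not> G x)" by blast
  ultimately show ?thesis unfolding G_def by simp
qed

lemma put_literals:
  assumes r: "ready s" and sg: "signs n R s" and c: "s ''c'' 0 = c" "c < length cs" and E: "out_list E s"
    and b: "\<And>s' l. var l < n \<Longrightarrow> s' ''v'' 0 = var l \<Longrightarrow> (s' ''sign'' (var l) = 0 \<longleftrightarrow> var l \<notin> var ` R) \<Longrightarrow>
      bval b s' = P l" "bcost b \<le> 10"
  shows "run (put_literals b) s (80 * n) (out_list (E @ map encode_lit (filter P (cs ! c))))"
proof -
  let ?d = "cs ! c"
  let ?b = "''v'' :=\<^sub>v Cell ''var'' (V ''l'') ;; Cond b (put (V ''l'')) Skip"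
  have "run (put_literals b) s ((40 + 40) * n) (out_list (E @ map encode_lit (filter P ?d)))"
    unfolding put_literals_def
  proof (rule run_each_literal[where I = "\<lambda>k. out_list (E @ map encode_lit (filter P (take k ?d)))", OF r c])
    fix k s' assume k: "k < length ?d" "s' ''l'' 0 = encode_lit (?d ! k)" "var (?d ! k) < n" "ready s'"
      "same (insert ''q'' (insert ''l'' (avars ?b))) s s'"
      "out_list (E @ map encode_lit (filter P (take k ?d))) s'"
    note sm = k(5)
    let ?l = "?d ! k"
    let ?s1 = "s'(''v'' := (s' ''v'')(aval (Num 0) s' := aval (Cell ''var'' (V ''l'')) s'))"
    have v: "s' ''var'' (encode_lit ?l) = var ?l"
      using k(3,4) unfolding ready_def tables_def by blast
    have "s' ''sign'' (var ?l) = 0 \<longleftrightarrow> var ?l \<notin> var ` R"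
      using sg k(3) unfolding signs_def by (simp add: sameD[OF sm] sign_code_0)
    then have P: "bval b ?s1 = P ?l" using k(2,3) v by (intro b(1)) simp_all
    have tk: "take (Suc k) ?d = take k ?d @ [?l]" using k(1) by (rule take_Suc_conv_app_nth)
    have o1: "out_list (E @ map encode_lit (filter P (take k ?d))) ?s1"
      using k(6) by (simp add: out_list_def)
    have "run (Cond b (put (V ''l'')) Skip) ?s1 30 (out_list (E @ map encode_lit (filter P (take (Suc k) ?d))))"
    proof (cases "P ?l")
      case True
      have "run (put (V ''l'')) ?s1 (29 - bcost b) (out_list (E @ map encode_lit (filter P (take (Suc k) ?d))))"
        by (rule run_mono[OF put[OF o1]]) (use b(2) True k(2) tk in simp_all)
      then show ?thesis
        by (rule run_Cond_True[rotated]) (use True P b(2) in simp_all)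
    next
      case False
      then show ?thesis using P o1 b(2) tk by (simp add: run_simps)
    qed
    then have "run ?b s' (10 + 30) (out_list (E @ map encode_lit (filter P (take (Suc k) ?d))))"
      by (intro run_Seq_AssignI) simp
    then show "run ?b s' 40 (out_list (E @ map encode_lit (filter P (take (Suc k) ?d))))" by simp
  qed (use E clause_length_n c n in \<open>simp_all add: out_list_def loop_arrays_def\<close>)
  then show ?thesis by simp
qed

lemma put_clause:
  assumes r: "ready s" and sg: "signs n R s" and c: "s ''c'' 0 = c" "c < length cs" and E: "out_list E s"
    and a: "s ''a'' 0 = length (filter (\<lambda>l. var l \<in> var ` R) (cs ! c))"
    and b: "s ''b'' 0 = length (filter (\<lambda>l. var l \<notin> var ` R) (cs ! c))"
    and g: "s ''g'' 0 = of_bool (\<exists>l\<in>set (cs ! c). var l \<notin> var ` R \<and> var l \<in> Z)"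
  shows "run put_clause s (300 * n) (out_list (E @ encode_clause (to_clause (var ` R) Z (cs ! c))))"
proof -
  let ?d = "cs ! c" and ?V0 = "var ` R"
  define G where "G \<longleftrightarrow> (\<exists>l\<in>set ?d. var l \<notin> ?V0 \<and> var l \<in> Z)"
  let ?A = "filter (\<lambda>l. var l \<in> ?V0) ?d" and ?B = "filter (\<lambda>l. var l \<notin> ?V0) ?d"
  have step: "run (put e ;; c') t (20 + T) Q"
    if "out_list F t" "acost e \<le> 10" "\<And>t'. out_list (F @ [aval e t]) t' \<Longrightarrow> same {''out'', ''o''} t t' \<Longrightarrow> run c' t' T Q"
    for e c' t T Q F
  proof (rule run_Seq)
    show "run (put e) t 20 (out_list (F @ [aval e t]))"
      by (rule run_mono[OF put[OF that(1)]]) (use that(2) in simp_all)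
  qed (use that(3) in simp)
  let ?Y = "{''q'', ''l'', ''v'', ''out'', ''o''}"
  have keep: "ready t" "signs n R t" "t ''c'' 0 = c" "t ''a'' 0 = length ?A" "t ''b'' 0 = length ?B"
    "t ''g'' 0 = of_bool G" if sm: "same ?Y s t" for t
    using ready_same[OF sm] r sg c a b g unfolding signs_def G_def by (simp_all add: sameD[OF sm])
  have pl: "run (put_literals bb) t (80 * n) (out_list (F @ map encode_lit (filter P ?d)))"
    if "same ?Y s t" "out_list F t" "bcost bb \<le> 10" "\<And>s' l. var l < n \<Longrightarrow> s' ''v'' 0 = var l \<Longrightarrow>
      (s' ''sign'' (var l) = 0 \<longleftrightarrow> var l \<notin> ?V0) \<Longrightarrow> bval bb s' = P l" for t F bb P
    by (rule put_literals[OF keep(1)[OF that(1)] keep(2)[OF that(1)] keep(3)[OF that(1)] c(2) that(2)])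
      (rule that, assumption+, rule that)
  have "run put_clause s (20 + (200 * n + 70)) (out_list (E @ encode_clause (to_clause ?V0 Z ?d)))"
    unfolding put_clause_def
  proof (rule step[OF E])
    fix t1 assume o1: "out_list (E @ [aval (V ''g'') s]) t1" and sm1: "same {''out'', ''o''} s t1"
    have y1: "same ?Y s t1" by (rule same_mono[OF sm1]) auto
    note k1 = keep[OF y1]
    have g1: "aval (V ''g'') s = of_bool G" using g unfolding G_def by simp
    show "run (Cond (BEq (V ''g'') (Num 1))
     (put (V ''a'') ;; put_literals in_horn ;; put (V ''b'') ;; put_literals (BNot in_horn))
     (put (Add (V ''a'') (V ''b'')) ;; put_literals (BEq (Num 0) (Num 0)))) t1 (200 * n + 70)
     (out_list (E @ encode_clause (to_clause ?V0 Z ?d)))"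
    proof (cases G)
      case True
      then have tc: "to_clause ?V0 Z ?d = DisjXor ?A ?B" unfolding to_clause_def G_def by (rule if_P)
      have "run (put (V ''a'') ;; put_literals in_horn ;; put (V ''b'') ;; put_literals (BNot in_horn)) t1
        (20 + (80 * n + (20 + 80 * n))) (out_list (E @ encode_clause (to_clause ?V0 Z ?d)))"
      proof (rule step[OF o1])
        fix t2 assume o2: "out_list ((E @ [aval (V ''g'') s]) @ [aval (V ''a'') t1]) t2"
          and sm2: "same {''out'', ''o''} t1 t2"
        have y2: "same ?Y s t2" by (rule same_trans[OF y1 same_mono[OF sm2]]) auto
        show "run (put_literals in_horn ;; put (V ''b'') ;; put_literals (BNot in_horn)) t2
          (80 * n + (20 + 80 * n)) (out_list (E @ encode_clause (to_clause ?V0 Z ?d)))"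
        proof (rule run_Seq[OF pl[OF y2 o2, where P = "\<lambda>l. var l \<in> ?V0"]])
          fix t3 assume o3: "out_list (((E @ [aval (V ''g'') s]) @ [aval (V ''a'') t1]) @ map encode_lit ?A) t3"
            and sm3: "same (avars (put_literals in_horn)) t2 t3"
          have y3: "same ?Y s t3" by (rule same_trans[OF y2 same_mono[OF sm3]]) auto
          show "run (put (V ''b'') ;; put_literals (BNot in_horn)) t3 (20 + 80 * n)
            (out_list (E @ encode_clause (to_clause ?V0 Z ?d)))"
          proof (rule step[OF o3])
            fix t4 assume o4: "out_list ((((E @ [aval (V ''g'') s]) @ [aval (V ''a'') t1]) @ map encode_lit ?A) @
              [aval (V ''b'') t3]) t4" and sm4: "same {''out'', ''o''} t3 t4"
            have y4: "same ?Y s t4" by (rule same_trans[OF y3 same_mono[OF sm4]]) auto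
            have "run (put_literals (BNot in_horn)) t4 (80 * n) (out_list (((((E @ [aval (V ''g'') s]) @
              [aval (V ''a'') t1]) @ map encode_lit ?A) @ [aval (V ''b'') t3]) @ map encode_lit ?B))"
              by (rule pl[OF y4 o4]) simp_all
            then show "run (put_literals (BNot in_horn)) t4 (80 * n)
              (out_list (E @ encode_clause (to_clause ?V0 Z ?d)))"
              using g1 True k1(4) keep(5)[OF y3] unfolding tc by (simp add: encode_lits_def)
          qed simp
        qed simp_all
      qed simp
      then have "run (put (V ''a'') ;; put_literals in_horn ;; put (V ''b'') ;; put_literals (BNot in_horn)) t1
        (200 * n + 65) (out_list (E @ encode_clause (to_clause ?V0 Z ?d)))"
        by (rule run_mono) simp_all
      then show ?thesis by (rule run_Cond_True[rotated]) (use True k1(6) in simp_all)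
    next
      case False
      then have tc: "to_clause ?V0 Z ?d = Disj ?d" unfolding to_clause_def G_def by (rule if_not_P)
      have len: "length ?A + length ?B = length ?d" by (rule sum_length_filter_compl)
      have "run (put (Add (V ''a'') (V ''b'')) ;; put_literals (BEq (Num 0) (Num 0))) t1 (20 + 80 * n)
        (out_list (E @ encode_clause (to_clause ?V0 Z ?d)))"
      proof (rule step[OF o1])
        fix t2 assume o2: "out_list ((E @ [aval (V ''g'') s]) @ [aval (Add (V ''a'') (V ''b'')) t1]) t2"
          and sm2: "same {''out'', ''o''} t1 t2"
        have y2: "same ?Y s t2" by (rule same_trans[OF y1 same_mono[OF sm2]]) auto
        have "run (put_literals (BEq (Num 0) (Num 0))) t2 (80 * n) (out_list (((E @ [aval (V ''g'') s]) @
          [aval (Add (V ''a'') (V ''b'')) t1]) @ map encode_lit (filter (\<lambda>l. True) ?d)))"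
          by (rule pl[OF y2 o2]) simp_all
        then show "run (put_literals (BEq (Num 0) (Num 0))) t2 (80 * n)
          (out_list (E @ encode_clause (to_clause ?V0 Z ?d)))"
          using g1 False k1(4,5) len unfolding tc by (simp add: encode_lits_def)
      qed simp
      then have "run (put (Add (V ''a'') (V ''b'')) ;; put_literals (BEq (Num 0) (Num 0))) t1 (200 * n + 65)
        (out_list (E @ encode_clause (to_clause ?V0 Z ?d)))"
        by (rule run_mono) simp_all
      then show ?thesis by (rule run_Cond_False[rotated]) (use False k1(6) in simp_all)
    qed
  qed simp
  then show ?thesis by (rule run_mono) (use n in simp_all)
qed

definition holds :: "nat set \<Rightarrow> nat set \<Rightarrow> literal list \<Rightarrow> bool" where
  "holds V0 Z c \<longleftrightarrow> (\<forall>x\<in>set xs. clause_true x (to_clause V0 Z c))"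

lemma process_clause:
  assumes r: "ready s" and sg: "signs n R s" and Z: "marks n Z s" and c: "s ''c'' 0 = c" "c < length cs"
    and E: "out_list E s" and bad: "s ''bad'' 0 = of_bool B"
  shows "run process_clause s (700 * (m * n)) (\<lambda>s'. out_list (E @ encode_clause (to_clause (var ` R) Z (cs ! c))) s' \<and>
     s' ''bad'' 0 = of_bool (B \<or> \<not> holds (var ` R) Z (cs ! c)))"
proof -
  let ?d = "cs ! c" and ?V0 = "var ` R"
  define G where "G \<longleftrightarrow> (\<exists>l\<in>set ?d. var l \<notin> ?V0 \<and> var l \<in> Z)"
  let ?A = "filter (\<lambda>l. var l \<in> ?V0) ?d" and ?B = "filter (\<lambda>l. var l \<notin> ?V0) ?d"
  let ?Q = "\<lambda>s'. out_list (E @ encode_clause (to_clause ?V0 Z ?d)) s' \<and>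
     s' ''bad'' 0 = of_bool (B \<or> \<not> holds ?V0 Z ?d)"
  have "run process_clause s (120 * n + ((180 * (m * n) + 10) + 300 * n)) ?Q"
    unfolding process_clause_def
  proof (rule run_Seq[OF classify[OF r sg Z c]])
    fix s1 assume s1: "s1 ''a'' 0 = length ?A \<and> s1 ''b'' 0 = length ?B \<and>
      s1 ''g'' 0 = of_bool (\<exists>l\<in>set ?d. var l \<notin> ?V0 \<and> var l \<in> Z)"
      and sm: "same (avars classify) s s1"
    have r1: "ready s1" using ready_same[OF sm] r by simp
    have sg1: "signs n R s1" using sg unfolding signs_def by (simp add: sameD[OF sm])
    have c1: "s1 ''c'' 0 = c" "s1 ''bad'' 0 = of_bool B" using c bad by (simp_all add: sameD[OF sm])
    have E1: "out_list E s1" using out_list_same[OF sm] E by simp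
    have g1: "s1 ''g'' 0 = of_bool G" using s1 unfolding G_def by blast
    show "run (Cond (BEq (V ''g'') (Num 1)) check_rows Skip ;; put_clause) s1
      ((180 * (m * n) + 10) + 300 * n) ?Q"
    proof (rule run_Seq)
      show "run (Cond (BEq (V ''g'') (Num 1)) check_rows Skip) s1 (180 * (m * n) + 10)
        (\<lambda>s'. s' ''bad'' 0 = of_bool (B \<or> \<not> holds ?V0 Z ?d))"
      proof (cases G)
        case True
        then have tc: "to_clause ?V0 Z ?d = DisjXor ?A ?B" unfolding to_clause_def G_def by (rule if_P)
        have "run check_rows s1 (180 * (m * n)) (\<lambda>s'. s' ''bad'' 0 = of_bool (B \<or> \<not> holds ?V0 Z ?d))"
          using check_rows[OF r1 sg1 c1(1) c(2) c1(2)] unfolding holds_def tc by simp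
        then have "run check_rows s1 (180 * (m * n) + 5) (\<lambda>s'. s' ''bad'' 0 = of_bool (B \<or> \<not> holds ?V0 Z ?d))"
          by (rule run_mono) simp_all
        then show ?thesis by (rule run_Cond_True[rotated]) (use True g1 in simp_all)
      next
        case False
        then have tc: "to_clause ?V0 Z ?d = Disj ?d" unfolding to_clause_def G_def by (rule if_not_P)
        have "holds ?V0 Z ?d"
          using prime[of ?d] c(2) unfolding holds_def tc prime_clause_def by simp
        then show ?thesis using False g1 c1 by (simp add: run_simps)
      qed
      fix s2 assume b2: "s2 ''bad'' 0 = of_bool (B \<or> \<not> holds ?V0 Z ?d)"
        and sm2: "same (avars (Cond (BEq (V ''g'') (Num 1)) check_rows Skip)) s1 s2"
      have r2: "ready s2" using ready_same[OF sm2] r1 by simp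
      have sg2: "signs n R s2" using sg1 unfolding signs_def by (simp add: sameD[OF sm2])
      have c2: "s2 ''c'' 0 = c" using c1 by (simp add: sameD[OF sm2])
      have E2: "out_list E s2" using out_list_same[OF sm2] E1 by simp
      have abg: "s2 ''a'' 0 = length ?A" "s2 ''b'' 0 = length ?B"
        "s2 ''g'' 0 = of_bool (\<exists>l\<in>set ?d. var l \<notin> ?V0 \<and> var l \<in> Z)"
        using s1 by (simp_all add: sameD[OF sm2])
      show "run put_clause s2 (300 * n) ?Q"
      proof (rule run_mono[OF put_clause[OF r2 sg2 c2 c(2) E2 abg]])
        fix s3 assume "out_list (E @ encode_clause (to_clause ?V0 Z ?d)) s3" and sm3: "same (avars put_clause) s2 s3"
        then show "?Q s3" using b2 by (simp add: sameD[OF sm3])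
      qed simp
    qed
  qed
  then show ?thesis
  proof (rule run_mono)
    have "n \<le> m * n" "1 \<le> m * n" using m n by auto
    then show "120 * n + ((180 * (m * n) + 10) + 300 * n) \<le> 700 * (m * n)" by linarith
  qed simp
qed

lemma write_formula:
  assumes r: "ready s" and sg: "signs n R s" and Z: "marks n Z s"
  shows "run write_formula s (900 * (m * n * (m * n)))
    (\<lambda>s'. arr (s' ''out'') (encode_formula (map (to_clause (var ` R) Z) cs)) \<and>
      s' ''answer'' 0 = of_bool (\<forall>c\<in>set cs. holds (var ` R) Z c))"
proof -
  let ?V0 = "var ` R"
  let ?f = "For ''c'' (Num 0) (V ''count'') process_clause"
  let ?enc = "\<lambda>k. length cs # concat (map encode_clause (map (to_clause ?V0 Z) (take k cs)))"
  let ?I = "\<lambda>k s'. out_list (?enc k) s' \<and> s' ''bad'' 0 = of_bool (\<exists>i<k. \<not> holds ?V0 Z (cs ! i))"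
  let ?s1 = "s(''bad'' := (s ''bad'')(0 := 0), ''out'' := (s ''out'')(0 := length cs), ''o'' := (s ''o'')(0 := 1))"
  let ?Q = "\<lambda>s'. arr (s' ''out'') (encode_formula (map (to_clause ?V0 Z) cs)) \<and>
      s' ''answer'' 0 = of_bool (\<forall>c\<in>set cs. holds ?V0 Z c)"
  have cnt: "s ''count'' 0 = length cs" using r unfolding ready_def stored_def by blast
  have sm1: "same {''bad'', ''out'', ''o''} s ?s1" by (simp add: same_def)
  have r1: "ready ?s1" using ready_same[OF sm1] r by simp
  have "run ?f ?s1 (800 * (m * n * (m * n))) (?I (length cs))"
  proof (rule run_For_le[where I = ?I and K = 700 and N = "length cs"])
    fix k s' assume k: "k < length cs" "s' ''c'' 0 = aval (Num 0) ?s1 + k" and I: "?I k s'"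
      and sm: "same (insert ''c'' (avars process_clause)) ?s1 s'"
    have r': "ready s'" using ready_same[OF sm] r1 by simp
    have sg': "signs n R s'" using sg unfolding signs_def by (simp add: sameD[OF sm])
    have Z': "marks n Z s'" using Z unfolding marks_def by (simp add: sameD[OF sm])
    have c': "s' ''c'' 0 = k" using k(2) by simp
    have e: "?enc (Suc k) = ?enc k @ encode_clause (to_clause ?V0 Z (cs ! k))"
      using k(1) by (simp add: take_Suc_conv_app_nth)
    have "run process_clause s' (700 * (m * n)) (\<lambda>s'. out_list (?enc k @ encode_clause (to_clause ?V0 Z (cs ! k))) s' \<and>
      s' ''bad'' 0 = of_bool ((\<exists>i<k. \<not> holds ?V0 Z (cs ! i)) \<or> \<not> holds ?V0 Z (cs ! k)))"
      using process_clause[OF r' sg' Z' c' k(1)] I by blast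
    then show "run process_clause s' (700 * (m * n)) (?I (Suc k))"
      unfolding e by (rule run_mono) (simp_all add: less_Suc_eq ex_disj_distrib conj_disj_distribR disj_commute)
  next
    show "?I 0 ?s1" by (simp add: out_list_def arr_def)
  next
    fix k s' x show "?I k (s'(''c'' := x)) = ?I k s'" by (simp add: out_list_def)
  qed (use cnt len_cs m n in \<open>simp_all\<close>)
  then have "run (?f ;; ''answer'' :=\<^sub>v Sub (Num 1) (V ''bad'')) ?s1 (800 * (m * n * (m * n)) + 10) ?Q"
  proof (rule run_Seq)
    fix s2 assume I: "?I (length cs) s2"
    have "(\<exists>i<length cs. \<not> holds ?V0 Z (cs ! i)) \<longleftrightarrow> \<not> (\<forall>c\<in>set cs. holds ?V0 Z c)"
      unfolding all_set_conv_all_nth by simp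
    then have "s2 ''bad'' 0 = of_bool (\<not> (\<forall>c\<in>set cs. holds ?V0 Z c))" using I by simp
    moreover have "arr (s2 ''out'') (encode_formula (map (to_clause ?V0 Z) cs))"
      using I unfolding out_list_def encode_formula_def by simp
    ultimately show "run (''answer'' :=\<^sub>v Sub (Num 1) (V ''bad'')) s2 10 ?Q"
      unfolding run_Assign by (cases "\<forall>c\<in>set cs. holds ?V0 Z c") simp_all
  qed
  then have "run write_formula s (10 + (10 + (10 + (800 * (m * n * (m * n)) + 10)))) ?Q"
    unfolding write_formula_def by (intro run_Seq_AssignI) (simp_all add: cnt)
  then show ?thesis
  proof (rule run_mono)
    have "1 \<le> m * n * (m * n)" using m n by simp
    then show "10 + (10 + (10 + (800 * (m * n * (m * n)) + 10))) \<le> 900 * (m * n * (m * n))" by linarith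
  qed simp
qed

end

section \<open>The algorithm\<close>

definition algorithm :: com where
  "algorithm = (fill_rows ;; fill_tables ;; find_clauses ;; link_positions ;; find_signs ;;
     find_marks ;; write_formula)"

lemma concat_uniform_nth:
  assumes "\<forall>x\<in>set xs. length x = n" "y < length xs" "t < n"
  shows "y * n + t < length (concat xs) \<and> concat xs ! (y * n + t) = xs ! y ! t"
  using assms
proof (induction xs arbitrary: y)
  case (Cons x xs)
  then show ?case by (cases y) (auto simp: nth_append)
qed simp

context table
begin

sublocale cnf n xs "prime_cnf n xs"
  using prime_cnf_prime length_clauses_upto[of m xs n] by unfold_locales auto

definition final :: "store \<Rightarrow> bool" where
  "final s \<longleftrightarrow> (\<exists>R. closed_lits (set (prime_cnf n xs)) R \<and> consistent R \<and> var ` R \<subseteq> {..<n} \<and>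
     horn_vars (set (prime_cnf n xs)) \<inter> {..<n} \<subseteq> var ` R \<and>
     arr (s ''out'') (encode_formula
       (map (to_clause (var ` R) (marked (var ` R) (prime_cnf n xs) n)) (prime_cnf n xs))) \<and>
     s ''answer'' 0 = of_bool (\<forall>c\<in>set (prime_cnf n xs). holds (var ` R) (marked (var ` R) (prime_cnf n xs) n) c))"

lemma run_algorithm: "run algorithm (input_store n xs) (4000 * (m\<^sup>2 * n\<^sup>2)) final"
proof -
  let ?cs = "prime_cnf n xs" and ?s = "input_store n xs"
  have z: "?s a = (\<lambda>_. 0)" if "a \<notin> {''n'', ''m'', ''D''}" for a
    using that by (auto simp: input_store_def)
  have s_n: "?s ''n'' 0 = n" and s_m: "?s ''m'' 0 = m" by (simp_all add: input_store_def)
  have s_D: "?s ''D'' (y * n + t) = of_bool (xs ! y ! t)" if "y < m" "t < n" for y t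
    using concat_uniform_nth[of xs n y t] len that by (simp add: input_store_def)
  let ?T = "50 * m + (100 * n + (600 * (m * (n * (n * m))) + (60 * (m * (n * m)) +
    (1600 * (n * (n * (m * m))) + (300 * (n * (m * n * m)) + 900 * (m * n * (m * n)))))))"
  have "run algorithm ?s ?T final"
    unfolding algorithm_def
  proof (rule run_Seq[OF fill_rows[of ?s m n, OF s_m s_n _ m]])
    show "?s ''row'' 0 = 0" using z[of "''row''"] by simp
    fix s1 assume row: "\<forall>y\<le>m. s1 ''row'' y = y * n" and sm1: "same (avars fill_rows) ?s s1"
    have r1: "rows n xs s1" using row s_n s_m s_D unfolding rows_def by (simp add: sameD[OF sm1])
    have n1: "s1 ''n'' 0 = n" using r1 unfolding rows_def by blast
    show "run (fill_tables ;; find_clauses ;; link_positions ;; find_signs ;; find_marks ;; write_formula) s1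
      (100 * n + (600 * (m * (n * (n * m))) + (60 * (m * (n * m)) +
      (1600 * (n * (n * (m * m))) + (300 * (n * (m * n * m)) + 900 * (m * n * (m * n))))))) final"
    proof (rule run_Seq[OF fill_tables[of s1 n, OF n1 n]])
      fix s2 assume t2: "tables n s2" and sm2: "same (avars fill_tables) s1 s2"
      have r2: "rows n xs s2" using rows_same[OF sm2] r1 by simp
      have st2: "stored [] [] s2"
        by (simp add: stored_def offsets_def owners_def arr_def sameD[OF sm2] sameD[OF sm1] z)
      show "run (find_clauses ;; link_positions ;; find_signs ;; find_marks ;; write_formula) s2
        (600 * (m * (n * (n * m))) + (60 * (m * (n * m)) +
        (1600 * (n * (n * (m * m))) + (300 * (n * (m * n * m)) + 900 * (m * n * (m * n)))))) final"
      proof (rule run_Seq[OF find_clauses[OF r2 st2]])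
        fix s3 assume st3: "stored ?cs [] s3" and sm3: "same (avars find_clauses) s2 s3"
        have r3: "rows n xs s3" using rows_same[OF sm3] r2 by simp
        have t3: "tables n s3" using t2 unfolding tables_def by (simp add: sameD[OF sm3])
        have h3: "s3 ''head'' = (\<lambda>_. 0)" by (simp add: sameD[OF sm3] sameD[OF sm2] sameD[OF sm1] z)
        have N: "1 \<le> m * (n * m)" using m n by simp
        show "run (link_positions ;; find_signs ;; find_marks ;; write_formula) s3
          (60 * (m * (n * m)) + (1600 * (n * (n * (m * m))) + (300 * (n * (m * n * m)) +
           900 * (m * n * (m * n))))) final"
        proof (rule run_Seq[OF link_positions[OF st3 h3 total_length N]])
          fix s4 assume l4: "links (concat ?cs) s4" and sm4: "same (avars link_positions) s3 s4"
          have r4: "ready s4"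
            using rows_same[OF sm4] stored_same[OF sm4] r3 t3 st3 l4 unfolding ready_def tables_def
            by (simp add: sameD[OF sm4])
          have g4: "s4 ''sign'' = (\<lambda>_. 0)"
            by (simp add: sameD[OF sm4] sameD[OF sm3] sameD[OF sm2] sameD[OF sm1] z)
          show "run (find_signs ;; find_marks ;; write_formula) s4 (1600 * (n * (n * (m * m))) +
            (300 * (n * (m * n * m)) + 900 * (m * n * (m * n)))) final"
          proof (rule run_Seq[OF find_signs[OF r4 g4]])
            fix s5 assume "\<exists>R. signs n R s5 \<and> closed_lits (set ?cs) R \<and> consistent R \<and> var ` R \<subseteq> {..<n} \<and>
              horn_vars (set ?cs) \<inter> {..<n} \<subseteq> var ` R"
              and sm5: "same (avars find_signs) s4 s5"
            then obtain R where sg: "signs n R s5" and R: "closed_lits (set ?cs) R" "consistent R"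
              "var ` R \<subseteq> {..<n}" "horn_vars (set ?cs) \<inter> {..<n} \<subseteq> var ` R" by blast
            have r5: "ready s5" using ready_same[OF sm5] r4 by simp
            have x5: "s5 ''xor'' = (\<lambda>_. 0)"
              by (simp add: sameD[OF sm5] sameD[OF sm4] sameD[OF sm3] sameD[OF sm2] sameD[OF sm1] z)
            show "run (find_marks ;; write_formula) s5 (300 * (n * (m * n * m)) + 900 * (m * n * (m * n))) final"
            proof (rule run_Seq[OF find_marks[OF r5 sg x5]])
              fix s6 assume mk: "marks n (marked (var ` R) ?cs n) s6" and sm6: "same (avars find_marks) s5 s6"
              have r6: "ready s6" using ready_same[OF sm6] r5 by simp
              have sg6: "signs n R s6" using sg unfolding signs_def by (simp add: sameD[OF sm6])
              show "run write_formula s6 (900 * (m * n * (m * n))) final"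
                by (rule run_mono[OF write_formula[OF r6 sg6 mk] order_refl]) (use R final_def in blast)
            qed
          qed
        qed
      qed
    qed
  qed
  then show ?thesis
  proof (rule run_mono)
    define P where "P = m\<^sup>2 * n\<^sup>2"
    have e: "m * (n * (n * m)) = P" "n * (n * (m * m)) = P" "n * (m * n * m) = P" "m * n * (m * n) = P"
      unfolding P_def power2_eq_square by (simp_all add: mult.commute mult.left_commute)
    have "m * 1 \<le> m * (n * (n * m))" "n * 1 \<le> n * (n * (m * m))" "(m * (n * m)) * 1 \<le> (m * (n * m)) * n"
      using m n by (intro mult_le_mono2; simp)+
    then have le: "m \<le> P" "n \<le> P" "m * (n * m) \<le> P"
      unfolding e P_def power2_eq_square by (simp_all add: mult.commute mult.left_commute)
    show "?T \<le> 4000 * (m\<^sup>2 * n\<^sup>2)"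
      unfolding P_def[symmetric] e using le by linarith
  qed
qed

lemma final_correct:
  assumes f: "final s"
  shows "(returns_none s \<and> \<not> local_possibility_domain n (set xs)) \<or>
    (\<exists>\<phi>. outputs_formula s \<phi> \<and> lpic n \<phi> \<and> length \<phi> \<le> m * n \<and> satisfying n \<phi> = set xs)"
proof -
  let ?cs = "prime_cnf n xs"
  obtain R where R: "closed_lits (set ?cs) R" "consistent R" "var ` R \<subseteq> {..<n}"
    "horn_vars (set ?cs) \<inter> {..<n} \<subseteq> var ` R"
    and out: "arr (s ''out'') (encode_formula (map (to_clause (var ` R) (marked (var ` R) ?cs n)) ?cs))"
    and ans: "s ''answer'' 0 = of_bool (\<forall>c\<in>set ?cs. holds (var ` R) (marked (var ` R) ?cs n) c)"
    using f unfolding final_def by blast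
  let ?V0 = "var ` R" and ?Z = "marked (var ` R) ?cs n"
  let ?\<phi> = "map (to_clause ?V0 ?Z) ?cs"
  have less: "\<forall>c\<in>set ?cs. \<forall>l\<in>set c. var l < n" using vars by blast
  show ?thesis
  proof (cases "\<forall>c\<in>set ?cs. holds ?V0 ?Z c")
    case True
    have "lpic n ?\<phi>"
    proof (rule lpic_to_clause[OF _ _ R(1-3)])
      show "distinct (map var c)" if "c \<in> set ?cs" for c using dist[OF that] .
      show "var l < n" if "c \<in> set ?cs" "l \<in> set c" for c l using vars[OF that] .
      show "?Z \<subseteq> {..<n} - ?V0"
        using order_trans[OF marked_sound xor_vars_less[OF less]] by blast
      show "var l \<in> ?Z" if "c \<in> set ?cs" "triggered ?V0 ?Z c" "l \<in> set c" "var l \<notin> ?V0" for c l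
        using marked_closed[OF less that] .
    qed
    moreover have "satisfying n ?\<phi> = set xs"
    proof
      have "\<exists>l\<in>set c. lit_true x l" if "x \<in> satisfying n ?\<phi>" "c \<in> set ?cs" for x c
        using that clause_true_some[of x "to_clause ?V0 ?Z c"] unfolding set_to_clause satisfying_def by auto
      then have "satisfying n ?\<phi> \<subseteq> {x. length x = n \<and> (\<forall>c\<in>set ?cs. \<exists>l\<in>set c. lit_true x l)}"
        unfolding satisfying_def by blast
      also have "\<dots> = set xs" using prime_cnf_sat[OF ne] len by blast
      finally show "satisfying n ?\<phi> \<subseteq> set xs" .
      show "set xs \<subseteq> satisfying n ?\<phi>"
        using True len unfolding holds_def satisfying_def by auto
    qed
    moreover have "outputs_formula s ?\<phi>"
      using ans True out unfolding outputs_formula_def arr_def by simp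
    moreover have "length ?\<phi> \<le> m * n" using len_cs by simp
    ultimately show ?thesis by blast
  next
    case False
    then obtain c x where c: "c \<in> set ?cs" "x \<in> set xs" "\<not> clause_true x (to_clause ?V0 ?Z c)"
      unfolding holds_def by blast
    have "?V0 \<subseteq> horn_vars (set ?cs)" using R(1,2) unfolding horn_vars_def by blast
    then have V0: "?V0 \<inter> {..<n} = horn_vars (set ?cs) \<inter> {..<n}" using R(3,4) by blast
    have "\<not> local_possibility_domain n (set xs)"
    proof
      assume "local_possibility_domain n (set xs)"
      then have "clause_true x (to_clause ?V0 ?Z c)"
        by (rule to_clause_holds[OF _ _ V0 marked_sound c(1,2)])
          (use prime clause_distinct vars in blast)
      with c(3) show False ..
    qed
    moreover have "returns_none s" using ans False unfolding returns_none_def by simp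
    ultimately show ?thesis by blast
  qed
qed

end

theorem theorem4p12:
  "\<exists>(c :: com) (A :: nat) (B :: nat).
     \<forall>(n :: nat) (D :: bool list set) (xs :: bool list list).
       n \<ge> 1 \<and> nondegenerate_domain n D \<and> distinct xs \<and> set xs = D \<longrightarrow>
       (\<exists>t s. exec c (input_store n xs) t s \<and>
          t \<le> A * ((card D)\<^sup>2 * n\<^sup>2) \<and>
          ((returns_none s \<and> \<not> local_possibility_domain n D) \<or>
           (\<exists>\<phi>. outputs_formula s \<phi> \<and> lpic n \<phi> \<and>
                length \<phi> \<le> B * (card D * n) \<and>
                satisfying n \<phi> = D)))"
proof (rule exI[of _ algorithm], rule exI[of _ 4000], rule exI[of _ 1], intro allI impI)
  fix n :: nat and D :: "bool list set" and xs :: "bool list list"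
  assume h: "n \<ge> 1 \<and> nondegenerate_domain n D \<and> distinct xs \<and> set xs = D"
  have "(\<lambda>x. x ! 0) ` D = {False, True}"
    using h unfolding nondegenerate_domain_def by auto
  then have "D \<noteq> {}" by auto
  then interpret table n xs
    using h unfolding nondegenerate_domain_def by unfold_locales auto
  have card: "card D = length xs" using h distinct_card[of xs] by simp
  obtain t s where "exec algorithm (input_store n xs) t s" "t \<le> 4000 * ((length xs)\<^sup>2 * n\<^sup>2)" "final s"
    using run_algorithm unfolding run_def by blast
  then show "\<exists>t s. exec algorithm (input_store n xs) t s \<and> t \<le> 4000 * ((card D)\<^sup>2 * n\<^sup>2) \<and>
      ((returns_none s \<and> \<not> local_possibility_domain n D) \<or>
       (\<exists>\<phi>. outputs_formula s \<phi> \<and> lpic n \<phi> \<and> length \<phi> \<le> 1 * (card D * n) \<and> satisfying n \<phi> = D))"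
    using final_correct[of s] h card by auto
qed

end
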